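(* If the strong exponential time hypothesis (SETH) holds, the Bayesian network structure learning (BNSL) problem over $n$ variables and $2^{o(n)}$ potential parent sets cannot be solved in time $O\big(2^{\delta n}\big)$ for any $\delta<1$ by a classical algorithm.
   Context: BNSL problem: The input is a node set $N$ of size $n$ (nodes are also called variables) and, for each node $i\in N$, a collection $\mathcal{C}_i$ of subsets of $N\setminus\{i\}$ (the potential parent sets of $i$), together with a local score $s_i(J)$ for each $J\in\mathcal{C}_i$. For $J\subseteq N\setminus\{i\}$ with $J\notin\mathcal{C}_i$ the local score is $s_i(J)=-\infty$ and is not given explicitly. For an arc set $A\subseteq N\times N$ and $i\in N$, let $A_i=\{j : ji\in A\}$ be the parent set of $i$. The task is to find a directed acyclic graph $(N,A)$ that maximizes $s(A)=\sum_{i\in N} s_i(A_i)$. The number of potential parent sets of the instance is $\sum_{i\in N}|\mathcal{C}_i|$. Strong exponential time hypothesis (SETH): for any $\delta<1$ there exists a number $k$ such that the $k$-CNF-SAT problem over $n$ variables cannot be solved in time $O\big(2^{\delta n}\big)$ by a classical algorithm. *)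

theory Defs
  imports "HOL-Library.Landau_Symbols" "HOL-Library.Extended_Real"
begin

section \<open>Machine model\<close>

text \<open>
  Algorithms are deterministic while-programs over binary trees (the language WHILE of N. D. Jones,
  "Computability and Complexity", 1997) with unit-cost pairing, projections and tests. A tree is
  a pointer to an immutable pair, so a unit-cost word RAM simulates a program with constant overhead
  per step, and a program simulates a word RAM with overhead polylogarithmic in time and space
  (memory kept in a balanced tree). Such factors do not affect the existence of an algorithm with
  running time \<open>O(2\<^sup>\<delta>\<^sup>n)\<close> for some \<open>\<delta> < 1\<close>.
\<close>

datatype data = Atom | Pair data data

fun left :: "data \<Rightarrow> data" where
  "left Atom = Atom"
| "left (Pair x y) = x"

fun right :: "data \<Rightarrow> data" where
  "right Atom = Atom"
| "right (Pair x y) = y"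

datatype expr = EAtom | EVar nat | EPair expr expr | ELeft expr | ERight expr

datatype prog =
    Assign nat expr
  | Seq prog prog
  | Cond expr prog prog
  | While expr prog

type_synonym store = "nat \<Rightarrow> data"

fun eval_expr :: "expr \<Rightarrow> store \<Rightarrow> data" where
  "eval_expr EAtom \<sigma> = Atom"
| "eval_expr (EVar x) \<sigma> = \<sigma> x"
| "eval_expr (EPair e e') \<sigma> = Pair (eval_expr e \<sigma>) (eval_expr e' \<sigma>)"
| "eval_expr (ELeft e) \<sigma> = left (eval_expr e \<sigma>)"
| "eval_expr (ERight e) \<sigma> = right (eval_expr e \<sigma>)"

fun expr_cost :: "expr \<Rightarrow> nat" where
  "expr_cost EAtom = 1"
| "expr_cost (EVar x) = 1"
| "expr_cost (EPair e e') = 1 + expr_cost e + expr_cost e'"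
| "expr_cost (ELeft e) = 1 + expr_cost e"
| "expr_cost (ERight e) = 1 + expr_cost e"

text \<open>\<open>exec c \<sigma> t \<sigma>'\<close>: started in \<open>\<sigma>\<close>, \<open>c\<close> halts in \<open>\<sigma>'\<close> after exactly \<open>t\<close> steps.
  Tests succeed on every tree other than \<open>Atom\<close>.\<close>

inductive exec :: "prog \<Rightarrow> store \<Rightarrow> nat \<Rightarrow> store \<Rightarrow> bool" where
  assign: "exec (Assign x e) \<sigma> (1 + expr_cost e) (\<sigma>(x := eval_expr e \<sigma>))"
| seq: "exec c \<sigma> t \<sigma>' \<Longrightarrow> exec c' \<sigma>' t' \<sigma>'' \<Longrightarrow> exec (Seq c c') \<sigma> (t + t') \<sigma>''"
| cond_true: "eval_expr e \<sigma> \<noteq> Atom \<Longrightarrow> exec c \<sigma> t \<sigma>' \<Longrightarrow>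
    exec (Cond e c c') \<sigma> (1 + expr_cost e + t) \<sigma>'"
| cond_false: "eval_expr e \<sigma> = Atom \<Longrightarrow> exec c' \<sigma> t \<sigma>' \<Longrightarrow>
    exec (Cond e c c') \<sigma> (1 + expr_cost e + t) \<sigma>'"
| while_true: "eval_expr e \<sigma> \<noteq> Atom \<Longrightarrow> exec c \<sigma> t \<sigma>' \<Longrightarrow> exec (While e c) \<sigma>' t' \<sigma>'' \<Longrightarrow>
    exec (While e c) \<sigma> (1 + expr_cost e + t + t') \<sigma>''"
| while_false: "eval_expr e \<sigma> = Atom \<Longrightarrow> exec (While e c) \<sigma> (1 + expr_cost e) \<sigma>"

inductive_cases assignE: "exec (Assign x e) \<sigma> t \<sigma>'"
inductive_cases seqE: "exec (Seq c c') \<sigma> t \<sigma>'"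
inductive_cases condE: "exec (Cond e c c') \<sigma> t \<sigma>'"
inductive_cases whileE: "exec (While e c) \<sigma> t \<sigma>'"

lemma exec_deterministic:
  "exec c \<sigma> t \<sigma>' \<Longrightarrow> exec c \<sigma> u \<tau> \<Longrightarrow> u = t \<and> \<tau> = \<sigma>'"
proof (induction arbitrary: u \<tau> rule: exec.induct)
  case (assign x e \<sigma>)
  then show ?case by (auto elim: assignE)
next
  case (seq c \<sigma> t \<sigma>' c' t' \<sigma>'')
  from seq.prems obtain a b \<rho> where *: "u = a + b" "exec c \<sigma> a \<rho>" "exec c' \<rho> b \<tau>"
    by (rule seqE)
  from seq.IH(1)[OF *(2)] * have "a = t" "exec c' \<sigma>' b \<tau>" by simp_all
  with seq.IH(2) *(1) show ?case by simp
next
  case (cond_true e \<sigma> c t \<sigma>' c')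
  from cond_true.prems cond_true.hyps(1) obtain a where
    *: "u = 1 + expr_cost e + a" "exec c \<sigma> a \<tau>"
    by (elim condE) simp_all
  from cond_true.IH[OF *(2)] *(1) show ?case by simp
next
  case (cond_false e \<sigma> c' t \<sigma>' c)
  from cond_false.prems cond_false.hyps(1) obtain a where
    *: "u = 1 + expr_cost e + a" "exec c' \<sigma> a \<tau>"
    by (elim condE) simp_all
  from cond_false.IH[OF *(2)] *(1) show ?case by simp
next
  case (while_true e \<sigma> c t \<sigma>' t' \<sigma>'')
  from while_true.prems obtain a b \<rho> where
    *: "u = 1 + expr_cost e + a + b" "exec c \<sigma> a \<rho>" "exec (While e c) \<rho> b \<tau>"
    by (rule whileE) (use while_true.hyps(1) in simp_all)
  from while_true.IH(1)[OF *(2)] * have "a = t" "exec (While e c) \<sigma>' b \<tau>" by simp_all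
  with while_true.IH(2) *(1) show ?case by simp
next
  case (while_false e \<sigma>)
  from while_false.prems show ?case by (rule whileE) (use while_false.hyps in simp_all)
qed

text \<open>Variable 0 holds the input at the start and the output at the end; all other variables
  are initially \<open>Atom\<close>.\<close>

definition runs :: "prog \<Rightarrow> data \<Rightarrow> nat \<Rightarrow> data \<Rightarrow> bool" where
  "runs c x t y \<longleftrightarrow> (\<exists>\<sigma>. exec c ((\<lambda>_. Atom)(0 := x)) t \<sigma> \<and> \<sigma> 0 = y)"

text \<open>A problem \<open>P\<close> is given by its instances: \<open>P n x Q\<close> says that \<open>x\<close> is an input with size
  parameter \<open>n\<close> for which exactly the outputs satisfying \<open>Q\<close> are correct. Running time is
  measured in the worst case as a function of \<open>n\<close>, not of the length of \<open>x\<close>.\<close>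

type_synonym problem = "nat \<Rightarrow> data \<Rightarrow> (data \<Rightarrow> bool) \<Rightarrow> bool"

definition solves_within :: "prog \<Rightarrow> problem \<Rightarrow> (nat \<Rightarrow> nat) \<Rightarrow> bool" where
  "solves_within c P T \<longleftrightarrow> (\<forall>n x Q. P n x Q \<longrightarrow> (\<exists>t y. runs c x t y \<and> t \<le> T n \<and> Q y))"

definition solvable_in_time :: "problem \<Rightarrow> (nat \<Rightarrow> real) \<Rightarrow> bool" where
  "solvable_in_time P g \<longleftrightarrow> (\<exists>c T. solves_within c P T \<and> (\<lambda>n. real (T n)) \<in> O(g))"


section \<open>Encodings\<close>

fun list_data :: "data list \<Rightarrow> data" where
  "list_data [] = Atom"
| "list_data (x # xs) = Pair x (list_data xs)"

definition bool_data :: "bool \<Rightarrow> data" where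
  "bool_data b = (if b then Pair Atom Atom else Atom)"

text \<open>Numbers are in binary, least significant bit first.\<close>

fun nat_data :: "nat \<Rightarrow> data" where
  "nat_data n = (if n = 0 then Atom else Pair (bool_data (odd n)) (nat_data (n div 2)))"

declare nat_data.simps [simp del]

definition int_data :: "int \<Rightarrow> data" where
  "int_data z = Pair (bool_data (z < 0)) (nat_data (nat \<bar>z\<bar>))"

definition rat_data :: "rat \<Rightarrow> data" where
  "rat_data r = (case quotient_of r of (p, q) \<Rightarrow> Pair (int_data p) (nat_data (nat q)))"

text \<open>A finite set is encoded by any repetition-free list of its elements, so it has several codes
  and \<open>set_code R\<close> lifts a coding relation \<open>R\<close> for the elements. Forbidding repetitions bounds the
  length of the input by the size of the instance.\<close>

definition set_code :: "('a \<Rightarrow> data \<Rightarrow> bool) \<Rightarrow> 'a set \<Rightarrow> data \<Rightarrow> bool" where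
  "set_code R A x \<longleftrightarrow>
     (\<exists>as xs. distinct as \<and> set as = A \<and> list_all2 R as xs \<and> x = list_data xs)"

definition pair_code ::
  "('a \<Rightarrow> data \<Rightarrow> bool) \<Rightarrow> ('b \<Rightarrow> data \<Rightarrow> bool) \<Rightarrow> 'a \<times> 'b \<Rightarrow> data \<Rightarrow> bool" where
  "pair_code R S p x \<longleftrightarrow> (\<exists>y z. R (fst p) y \<and> S (snd p) z \<and> x = Pair y z)"

definition nat_code :: "nat \<Rightarrow> data \<Rightarrow> bool" where
  "nat_code n x \<longleftrightarrow> x = nat_data n"

definition bool_code :: "bool \<Rightarrow> data \<Rightarrow> bool" where
  "bool_code b x \<longleftrightarrow> x = bool_data b"

definition rat_code :: "rat \<Rightarrow> data \<Rightarrow> bool" where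
  "rat_code r x \<longleftrightarrow> x = rat_data r"


section \<open>Satisfiability and the strong exponential time hypothesis\<close>

text \<open>The literal \<open>(v, b)\<close> over the variables \<open>{..<n}\<close> is \<open>v\<close> if \<open>b\<close> holds and the
  negation of \<open>v\<close> otherwise.\<close>

type_synonym literal = "nat \<times> bool"
type_synonym clause = "literal set"

definition k_cnf :: "nat \<Rightarrow> nat \<Rightarrow> clause set \<Rightarrow> bool" where
  "k_cnf k n F \<longleftrightarrow> (\<forall>c\<in>F. c \<subseteq> {..<n} \<times> UNIV \<and> card c \<le> k)"

definition satisfiable :: "clause set \<Rightarrow> bool" where
  "satisfiable F \<longleftrightarrow> (\<exists>\<alpha>::nat \<Rightarrow> bool. \<forall>c\<in>F. \<exists>(v, b)\<in>c. \<alpha> v = b)"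

definition k_cnf_sat :: "nat \<Rightarrow> problem" where
  "k_cnf_sat k n x Q \<longleftrightarrow>
     (\<exists>F. k_cnf k n F \<and>
          pair_code nat_code (set_code (set_code (pair_code nat_code bool_code))) (n, F) x \<and>
          Q = (\<lambda>y. y \<noteq> Atom \<longleftrightarrow> satisfiable F))"

definition SETH :: bool where
  "SETH \<longleftrightarrow> (\<forall>\<delta>::real. \<delta> < 1 \<longrightarrow>
     (\<exists>k. \<not> solvable_in_time (k_cnf_sat k) (\<lambda>n. 2 powr (\<delta> * real n))))"


section \<open>Bayesian network structure learning\<close>

text \<open>The node set is \<open>{..<n}\<close>; \<open>C i\<close> is the collection of potential parent sets of \<open>i\<close>, and
  the values of \<open>s i\<close> outside \<open>C i\<close> are irrelevant.\<close>

definition bnsl_instance :: "nat \<Rightarrow> (nat \<Rightarrow> nat set set) \<Rightarrow> bool" where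
  "bnsl_instance n C \<longleftrightarrow> (\<forall>i<n. C i \<subseteq> Pow ({..<n} - {i}))"

definition num_parent_sets :: "nat \<Rightarrow> (nat \<Rightarrow> nat set set) \<Rightarrow> nat" where
  "num_parent_sets n C = (\<Sum>i<n. card (C i))"

definition local_score ::
  "(nat \<Rightarrow> nat set set) \<Rightarrow> (nat \<Rightarrow> nat set \<Rightarrow> rat) \<Rightarrow> nat \<Rightarrow> nat set \<Rightarrow> ereal" where
  "local_score C s i J = (if J \<in> C i then ereal (real_of_rat (s i J)) else -\<infinity>)"

definition parents :: "(nat \<times> nat) set \<Rightarrow> nat \<Rightarrow> nat set" where
  "parents A i = {j. (j, i) \<in> A}"

definition score ::
  "nat \<Rightarrow> (nat \<Rightarrow> nat set set) \<Rightarrow> (nat \<Rightarrow> nat set \<Rightarrow> rat) \<Rightarrow> (nat \<times> nat) set \<Rightarrow> ereal" where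
  "score n C s A = (\<Sum>i<n. local_score C s i (parents A i))"

definition dag :: "nat \<Rightarrow> (nat \<times> nat) set \<Rightarrow> bool" where
  "dag n A \<longleftrightarrow> A \<subseteq> {..<n} \<times> {..<n} \<and> acyclic A"

definition optimal_dag ::
  "nat \<Rightarrow> (nat \<Rightarrow> nat set set) \<Rightarrow> (nat \<Rightarrow> nat set \<Rightarrow> rat) \<Rightarrow> (nat \<times> nat) set \<Rightarrow> bool" where
  "optimal_dag n C s A \<longleftrightarrow> dag n A \<and> (\<forall>B. dag n B \<longrightarrow> score n C s B \<le> score n C s A)"

definition bnsl_code ::
  "nat \<Rightarrow> (nat \<Rightarrow> nat set set) \<Rightarrow> (nat \<Rightarrow> nat set \<Rightarrow> rat) \<Rightarrow> data \<Rightarrow> bool" where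
  "bnsl_code n C s x \<longleftrightarrow>
     (\<exists>xs. length xs = n \<and> x = list_data xs \<and>
        (\<forall>i<n. set_code (pair_code (set_code nat_code) rat_code) ((\<lambda>J. (J, s i J)) ` C i) (xs ! i)))"

text \<open>Numerator and denominator of \<open>r\<close> have at most \<open>m\<close> bits.\<close>

definition rat_bits_le :: "nat \<Rightarrow> rat \<Rightarrow> bool" where
  "rat_bits_le m r \<longleftrightarrow> (case quotient_of r of (p, q) \<Rightarrow> \<bar>p\<bar> < 2 ^ m \<and> q < 2 ^ m)"

text \<open>BNSL restricted to instances with at most \<open>2 powr f n\<close> potential parent sets whose local
  scores have precision \<open>b n\<close>. Since time is measured in \<open>n\<close> alone, some precision bound is needed:
  with arbitrarily long scores no algorithm could even read the input in time.\<close>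

definition bnsl :: "(nat \<Rightarrow> nat) \<Rightarrow> (nat \<Rightarrow> real) \<Rightarrow> problem" where
  "bnsl b f n x Q \<longleftrightarrow>
     (\<exists>C s. bnsl_instance n C \<and>
            real (num_parent_sets n C) \<le> 2 powr f n \<and>
            (\<forall>i<n. \<forall>J\<in>C i. rat_bits_le (b n) (s i J)) \<and>
            bnsl_code n C s x \<and>
            Q = (\<lambda>y. \<exists>A. set_code (pair_code nat_code nat_code) A y \<and> optimal_dag n C s A))"

end

theory Submission
  imports Defs "HOL-Real_Asymp.Real_Asymp"
begin

text \<open>
  A \<open>k\<close>-CNF formula over \<open>n\<close> variables is turned into a BNSL instance with \<open>n + o(n)\<close> nodes. The variables
  are split into about \<open>log n\<close> groups of equal size \<open>m\<close>. A group owns \<open>m + O(log n)\<close> nodes, and an assignment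
  to its variables is a set of exactly half of these nodes, which is possible since the central binomial
  coefficient is at least \<open>2 ^ m\<close>. For every set of at most \<open>k\<close> groups there is a checker node; its potential parent
  sets are the node sets of the assignments to these groups that do not falsify a clause. There are only
  polylogarithmically many checkers, and each has \<open>2 ^ O(n / log n)\<close> parent sets.

  A group node has either no parents (score \<open>-1\<close>) or all checkers (score \<open>1\<close>). By acyclicity every node that a
  checker selects has no parents, so a group contributes at most \<open>0\<close>, and exactly \<open>0\<close> only if all checkers select
  the same assignment for it. An extra node \<open>0\<close> gains score \<open>1\<close> by taking all checkers as parents, and a checker may
  add node \<open>0\<close> to any selection, falsifying or not, which by acyclicity forfeits this gain. An inconsistency between
  checkers costs at least \<open>2\<close>, so in an optimal DAG node \<open>0\<close> has parents if and only if the formula is satisfiable.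
\<close>

section \<open>Polynomial bounds\<close>

text \<open>The node count must be \<open>n + o(n)\<close>: even a constant factor above 1 could
  turn an exponent below 1 for BNSL into one above 1 for satisfiability, so two nodes per variable
  would be too many. A code of half weight loses only a polynomial factor against all subsets, which
  \<open>O(log n)\<close> extra nodes per group repay. Since all codewords have the same size, two
  different ones have a union larger than either; this is how local scores detect that checkers
  disagree.

  The number of groups meets two opposite demands. A checker lists about \<open>2 ^ (k * m)\<close>
  assignments, so \<open>m\<close> must be \<open>o(n)\<close>; the checkers, polynomially many in
  the number of groups, must themselves be only \<open>o(n)\<close> nodes. Logarithmically many
  groups serve every \<open>k\<close> at once. This matters because the bound \<open>f\<close> on
  the parent sets is fixed before SETH supplies \<open>k\<close>; \<open>exponent\<close> is
  therefore chosen above every constant multiple of \<open>n / log n\<close>.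

  A solver returns a DAG and no score, so the answer has to be visible in the arcs, which is the
  purpose of node \<open>0\<close>. The option to take it as a parent keeps every instance feasible,
  with optimum at least 0.\<close>

definition poly_bounded :: "'a set \<Rightarrow> ('a \<Rightarrow> nat) \<Rightarrow> ('a \<Rightarrow> nat) \<Rightarrow> bool" where
  "poly_bounded D \<mu> f \<longleftrightarrow> (\<exists>k. \<forall>a\<in>D. f a \<le> (\<mu> a + 2) ^ k)"

lemma poly_boundedI: "(\<And>a. a \<in> D \<Longrightarrow> f a \<le> (\<mu> a + 2) ^ k) \<Longrightarrow> poly_bounded D \<mu> f"
  unfolding poly_bounded_def by blast

lemma poly_boundedE:
  assumes "poly_bounded D \<mu> f"
  obtains k where "\<And>a. a \<in> D \<Longrightarrow> f a \<le> (\<mu> a + 2) ^ k"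
  using assms unfolding poly_bounded_def by blast

lemma poly_bounded_mono:
  assumes "poly_bounded D \<mu> g" "\<And>a. a \<in> D \<Longrightarrow> f a \<le> g a"
  shows "poly_bounded D \<mu> f"
  using assms unfolding poly_bounded_def by (meson order_trans)

text \<open>The \<open>2\<close> in \<open>poly_bounded\<close> serves this case and sums: with base
  at least 2, a higher power absorbs any constant even where the measure is 0.\<close>

lemma poly_bounded_const: "poly_bounded D \<mu> (\<lambda>_. c)"
proof (rule poly_boundedI)
  fix a
  have "c \<le> 2 ^ c" by (simp add: less_imp_le)
  also have "\<dots> \<le> (\<mu> a + 2) ^ c" by (intro power_mono) auto
  finally show "c \<le> (\<mu> a + 2) ^ c" .
qed

lemma poly_bounded_measure: "poly_bounded D \<mu> \<mu>"
  by (rule poly_boundedI[where k = 1]) simp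

lemma poly_bounded_add:
  assumes "poly_bounded D \<mu> f" "poly_bounded D \<mu> g"
  shows "poly_bounded D \<mu> (\<lambda>a. f a + g a)"
proof -
  obtain i where i: "\<And>a. a \<in> D \<Longrightarrow> f a \<le> (\<mu> a + 2) ^ i" using assms(1) by (rule poly_boundedE) blast
  obtain j where j: "\<And>a. a \<in> D \<Longrightarrow> g a \<le> (\<mu> a + 2) ^ j" using assms(2) by (rule poly_boundedE) blast
  show ?thesis
  proof (rule poly_boundedI)
    fix a assume a: "a \<in> D"
    have "f a \<le> (\<mu> a + 2) ^ max i j" "g a \<le> (\<mu> a + 2) ^ max i j"
      using i[OF a] j[OF a] by (meson le_add2 le_trans max.cobounded1 max.cobounded2 one_le_numeral power_increasing)+
    then have "f a + g a \<le> 2 * (\<mu> a + 2) ^ max i j" by simp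
    also have "\<dots> \<le> (\<mu> a + 2) * (\<mu> a + 2) ^ max i j" by (intro mult_right_mono) auto
    finally show "f a + g a \<le> (\<mu> a + 2) ^ Suc (max i j)" by simp
  qed
qed

lemma poly_bounded_mult:
  assumes "poly_bounded D \<mu> f" "poly_bounded D \<mu> g"
  shows "poly_bounded D \<mu> (\<lambda>a. f a * g a)"
proof -
  obtain i where i: "\<And>a. a \<in> D \<Longrightarrow> f a \<le> (\<mu> a + 2) ^ i" using assms(1) by (rule poly_boundedE) blast
  obtain j where j: "\<And>a. a \<in> D \<Longrightarrow> g a \<le> (\<mu> a + 2) ^ j" using assms(2) by (rule poly_boundedE) blast
  show ?thesis
    by (rule poly_boundedI[where k = "i + j"]) (simp only: power_add, intro mult_mono i j, auto)
qed

lemma poly_bounded_power: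
  assumes "poly_bounded D \<mu> f"
  shows "poly_bounded D \<mu> (\<lambda>a. f a ^ c)"
  by (induction c) (auto intro: poly_bounded_const poly_bounded_mult assms)

lemma poly_bounded_subst:
  assumes "poly_bounded D' \<nu> f" "\<And>z. z \<in> D \<Longrightarrow> \<pi> z \<in> D'" "poly_bounded D \<mu> (\<lambda>z. \<nu> (\<pi> z))"
  shows "poly_bounded D \<mu> (\<lambda>z. f (\<pi> z))"
proof -
  obtain i where i: "\<And>a. a \<in> D' \<Longrightarrow> f a \<le> (\<nu> a + 2) ^ i" using assms(1) by (rule poly_boundedE) blast
  show ?thesis
    by (rule poly_bounded_mono[where g = "\<lambda>z. (\<nu> (\<pi> z) + 2) ^ i"])
      (intro poly_bounded_power poly_bounded_add poly_bounded_const assms, intro i assms)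
qed

section \<open>Polynomial-time programs\<close>

text \<open>Upper bounds compose more easily than the exact step counts of \<open>exec\<close>, and
  may be rounded up.\<close>

definition exec_within :: "prog \<Rightarrow> store \<Rightarrow> nat \<Rightarrow> store \<Rightarrow> bool" where
  "exec_within c \<sigma> b \<tau> \<longleftrightarrow> (\<exists>t\<le>b. exec c \<sigma> t \<tau>)"

lemma exec_within_mono: "exec_within c \<sigma> b \<tau> \<Longrightarrow> b \<le> b' \<Longrightarrow> exec_within c \<sigma> b' \<tau>"
  unfolding exec_within_def using order_trans by blast

lemma exec_within_assign:
  "\<tau> = \<sigma>(x := eval_expr e \<sigma>) \<Longrightarrow> 1 + expr_cost e \<le> b \<Longrightarrow> exec_within (Assign x e) \<sigma> b \<tau>"
  unfolding exec_within_def using exec.assign by blast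

lemma exec_within_seq:
  "exec_within c \<sigma> b \<tau> \<Longrightarrow> exec_within c' \<tau> b' \<upsilon> \<Longrightarrow> exec_within (Seq c c') \<sigma> (b + b') \<upsilon>"
  unfolding exec_within_def by (meson add_mono exec.seq)

lemma exec_within_cond_true:
  "eval_expr e \<sigma> \<noteq> Atom \<Longrightarrow> exec_within c \<sigma> b \<tau> \<Longrightarrow> exec_within (Cond e c c') \<sigma> (1 + expr_cost e + b) \<tau>"
  unfolding exec_within_def by (metis add_left_mono exec.cond_true)

lemma exec_within_cond_false:
  "eval_expr e \<sigma> = Atom \<Longrightarrow> exec_within c' \<sigma> b \<tau> \<Longrightarrow> exec_within (Cond e c c') \<sigma> (1 + expr_cost e + b) \<tau>"
  unfolding exec_within_def by (metis add_left_mono exec.cond_false)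

lemma exec_within_while_false:
  "eval_expr e \<sigma> = Atom \<Longrightarrow> exec_within (While e c) \<sigma> (1 + expr_cost e) \<sigma>"
  unfolding exec_within_def using exec.while_false by blast

lemma exec_within_while_true:
  "eval_expr e \<sigma> \<noteq> Atom \<Longrightarrow> exec_within c \<sigma> b \<tau> \<Longrightarrow> exec_within (While e c) \<tau> b' \<upsilon> \<Longrightarrow>
   exec_within (While e c) \<sigma> (1 + expr_cost e + b + b') \<upsilon>"
  unfolding exec_within_def
  by (metis (no_types, opaque_lifting) add_left_mono add_mono exec.while_true)

text \<open>The parameter \<open>a\<close> is abstract; the program sees only \<open>inp a\<close>,
  and \<mu> need not be the size of this input. The store is arbitrary and is preserved, both apart
  from variable \<open>0\<close>. This frame condition makes every such program usable as a
  subroutine.\<close>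

definition poly_time ::
  "'a set \<Rightarrow> ('a \<Rightarrow> nat) \<Rightarrow> ('a \<Rightarrow> data) \<Rightarrow> ('a \<Rightarrow> data) \<Rightarrow> bool" where
  "poly_time D \<mu> inp F \<longleftrightarrow> (\<exists>c b. poly_bounded D \<mu> b \<and>
     (\<forall>a\<in>D. \<forall>\<sigma>. \<sigma> 0 = inp a \<longrightarrow> exec_within c \<sigma> (b a) (\<sigma>(0 := F a))))"

lemma poly_timeI:
  assumes "poly_bounded D \<mu> b"
    and "\<And>a \<sigma>. a \<in> D \<Longrightarrow> \<sigma> 0 = inp a \<Longrightarrow> exec_within c \<sigma> (b a) (\<sigma>(0 := F a))"
  shows "poly_time D \<mu> inp F"
  using assms unfolding poly_time_def by blast

lemma poly_timeE:
  assumes "poly_time D \<mu> inp F"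
  obtains c b where "poly_bounded D \<mu> b"
    "\<And>a \<sigma>. a \<in> D \<Longrightarrow> \<sigma> 0 = inp a \<Longrightarrow> exec_within c \<sigma> (b a) (\<sigma>(0 := F a))"
  using assms unfolding poly_time_def by blast

lemma poly_time_cong:
  assumes "poly_time D \<mu> inp F" "\<And>a. a \<in> D \<Longrightarrow> F a = G a"
  shows "poly_time D \<mu> inp G"
  using assms unfolding poly_time_def by metis

lemma poly_time_expr:
  assumes "\<And>a \<sigma>. a \<in> D \<Longrightarrow> \<sigma> 0 = inp a \<Longrightarrow> eval_expr e \<sigma> = F a"
  shows "poly_time D \<mu> inp F"
  by (rule poly_timeI[where c = "Assign 0 e", OF poly_bounded_const[where c = "1 + expr_cost e"]])
    (rule exec_within_assign, simp_all add: assms)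

lemma poly_time_id: "poly_time D \<mu> inp inp"
  by (rule poly_time_expr[where e = "EVar 0"]) simp

lemma poly_time_const: "poly_time D \<mu> inp (\<lambda>_. d)"
proof -
  have "\<exists>e. \<forall>\<sigma>. eval_expr e \<sigma> = d"
  proof (induction d)
    case Atom show ?case by (rule exI[of _ EAtom]) simp
  next
    case (Pair x y)
    then obtain e e' where "\<forall>\<sigma>. eval_expr e \<sigma> = x" "\<forall>\<sigma>. eval_expr e' \<sigma> = y" by blast
    then show ?case by (intro exI[of _ "EPair e e'"]) simp
  qed
  then obtain e where "\<forall>\<sigma>. eval_expr e \<sigma> = d" by blast
  then show ?thesis by (intro poly_time_expr[where e = e]) simp
qed

lemma poly_time_comp:
  assumes "poly_time D \<mu> inp F" "poly_time D \<mu> F G"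
  shows "poly_time D \<mu> inp G"
proof -
  obtain c b where c: "poly_bounded D \<mu> b"
    "\<And>a \<sigma>. a \<in> D \<Longrightarrow> \<sigma> 0 = inp a \<Longrightarrow> exec_within c \<sigma> (b a) (\<sigma>(0 := F a))"
    using assms(1) by (rule poly_timeE) blast
  obtain c' b' where c': "poly_bounded D \<mu> b'"
    "\<And>a \<sigma>. a \<in> D \<Longrightarrow> \<sigma> 0 = F a \<Longrightarrow> exec_within c' \<sigma> (b' a) (\<sigma>(0 := G a))"
    using assms(2) by (rule poly_timeE) blast
  show ?thesis
  proof (rule poly_timeI[where c = "Seq c c'", OF poly_bounded_add[OF c(1) c'(1)]])
    fix a and \<sigma> :: store assume a: "a \<in> D" "\<sigma> 0 = inp a"
    have "exec_within c' (\<sigma>(0 := F a)) (b' a) (\<sigma>(0 := G a))"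
      using c'(2)[OF a(1), of "\<sigma>(0 := F a)"] by simp
    then show "exec_within (Seq c c') \<sigma> (b a + b' a) (\<sigma>(0 := G a))"
      using c(2)[of a \<sigma>] a exec_within_seq by blast
  qed
qed

lemma poly_time_left: "poly_time D \<mu> inp F \<Longrightarrow> poly_time D \<mu> inp (\<lambda>a. left (F a))"
  by (erule poly_time_comp) (rule poly_time_expr[where e = "ELeft (EVar 0)"], simp)

lemma poly_time_right: "poly_time D \<mu> inp F \<Longrightarrow> poly_time D \<mu> inp (\<lambda>a. right (F a))"
  by (erule poly_time_comp) (rule poly_time_expr[where e = "ERight (EVar 0)"], simp)

text \<open>Variable 1 holds a stack of saved values; every program that is built here restores it.\<close>

lemma poly_time_pair:
  assumes "poly_time D \<mu> inp F" "poly_time D \<mu> inp G"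
  shows "poly_time D \<mu> inp (\<lambda>a. Pair (F a) (G a))"
proof -
  obtain c b where c: "poly_bounded D \<mu> b"
    "\<And>a \<sigma>. a \<in> D \<Longrightarrow> \<sigma> 0 = inp a \<Longrightarrow> exec_within c \<sigma> (b a) (\<sigma>(0 := F a))"
    using assms(1) by (rule poly_timeE) blast
  obtain c' b' where c': "poly_bounded D \<mu> b'"
    "\<And>a \<sigma>. a \<in> D \<Longrightarrow> \<sigma> 0 = inp a \<Longrightarrow> exec_within c' \<sigma> (b' a) (\<sigma>(0 := G a))"
    using assms(2) by (rule poly_timeE) blast
  let ?push = "Assign 1 (EPair (EVar 0) (EVar 1))"
  let ?get = "Assign 0 (ELeft (ERight (EVar 1)))"
  let ?put = "Assign 0 (EPair (ELeft (EVar 1)) (EVar 0))"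
  let ?pop = "Assign 1 (ERight (ERight (EVar 1)))"
  let ?p = "Seq ?push (Seq c (Seq ?push (Seq ?get (Seq c' (Seq ?put ?pop)))))"
  show ?thesis
  proof (rule poly_timeI[where c = ?p and b = "\<lambda>a. 10 + (b a + (10 + (10 + (b' a + (10 + 10)))))"])
    show "poly_bounded D \<mu> (\<lambda>a. 10 + (b a + (10 + (10 + (b' a + (10 + 10))))))"
      by (intro poly_bounded_add poly_bounded_const c c')
    fix a and \<sigma> :: store assume a: "a \<in> D" "\<sigma> 0 = inp a"
    let ?s = "\<sigma> 1" and ?x = "inp a"
    define s1 where "s1 = \<sigma>(1 := Pair ?x ?s)"
    define s2 where "s2 = s1(0 := F a)"
    define s3 where "s3 = s2(1 := Pair (F a) (Pair ?x ?s))"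
    define s4 where "s4 = s3(0 := ?x)"
    define s5 where "s5 = s4(0 := G a)"
    define s6 where "s6 = s5(0 := Pair (F a) (G a))"
    note d = s1_def s2_def s3_def s4_def s5_def s6_def
    show "exec_within ?p \<sigma> (10 + (b a + (10 + (10 + (b' a + (10 + 10)))))) (\<sigma>(0 := Pair (F a) (G a)))"
    proof (intro exec_within_seq)
      show "exec_within ?push \<sigma> 10 s1" by (rule exec_within_assign) (simp_all add: d a)
      show "exec_within c s1 (b a) s2" unfolding s2_def by (rule c(2)[OF a(1)]) (simp add: d a)
      show "exec_within ?push s2 10 s3" by (rule exec_within_assign) (simp_all add: d a)
      show "exec_within ?get s3 10 s4" by (rule exec_within_assign) (simp_all add: d a)
      show "exec_within c' s4 (b' a) s5" unfolding s5_def by (rule c'(2)[OF a(1)]) (simp add: d a)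
      show "exec_within ?put s5 10 s6" by (rule exec_within_assign) (simp_all add: d a)
      show "exec_within ?pop s6 10 (\<sigma>(0 := Pair (F a) (G a)))"
        by (rule exec_within_assign) (simp_all add: d a fun_upd_twist)
    qed
  qed
qed

lemma poly_time_if:
  assumes "poly_time D \<mu> inp B"
    and "poly_time {a\<in>D. B a \<noteq> Atom} \<mu> inp F" and "poly_time {a\<in>D. B a = Atom} \<mu> inp G"
  shows "poly_time D \<mu> inp (\<lambda>a. if B a \<noteq> Atom then F a else G a)"
proof -
  obtain c0 b0 where c0: "poly_bounded D \<mu> b0"
    "\<And>a \<sigma>. a \<in> D \<Longrightarrow> \<sigma> 0 = inp a \<Longrightarrow> exec_within c0 \<sigma> (b0 a) (\<sigma>(0 := B a))"
    using assms(1) by (rule poly_timeE) blast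
  \<comment> \<open>The bounds of the branches are known only on their parts of \<open>D\<close>.
    Explicit powers of \<mu> are controlled on all of \<open>D\<close>, and their sum covers both
    cases.\<close>
  obtain c k where c:
    "\<And>a \<sigma>. a \<in> D \<Longrightarrow> B a \<noteq> Atom \<Longrightarrow> \<sigma> 0 = inp a \<Longrightarrow> exec_within c \<sigma> ((\<mu> a + 2) ^ k) (\<sigma>(0 := F a))"
    using assms(2) by (elim poly_timeE poly_boundedE) (use exec_within_mono in blast)
  obtain c' k' where c':
    "\<And>a \<sigma>. a \<in> D \<Longrightarrow> B a = Atom \<Longrightarrow> \<sigma> 0 = inp a \<Longrightarrow> exec_within c' \<sigma> ((\<mu> a + 2) ^ k') (\<sigma>(0 := G a))"
    using assms(3) by (elim poly_timeE poly_boundedE) (use exec_within_mono in blast)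
  let ?push = "Assign 1 (EPair (EVar 0) (EVar 1))"
  let ?get = "Assign 0 (ELeft (EVar 1))"
  let ?pop = "Assign 1 (ERight (EVar 1))"
  let ?p = "Seq ?push (Seq c0 (Cond (EVar 0) (Seq ?get (Seq ?pop c)) (Seq ?get (Seq ?pop c'))))"
  let ?b = "\<lambda>a. (\<mu> a + 2) ^ k + (\<mu> a + 2) ^ k'"
  show ?thesis
  proof (rule poly_timeI[where c = ?p and b = "\<lambda>a. 10 + (b0 a + (1 + 1 + (10 + (10 + ?b a))))"])
    show "poly_bounded D \<mu> (\<lambda>a. 10 + (b0 a + (1 + 1 + (10 + (10 + ?b a)))))"
      by (intro poly_bounded_add poly_bounded_const c0 poly_bounded_power poly_bounded_measure)
    fix a and \<sigma> :: store assume a: "a \<in> D" "\<sigma> 0 = inp a"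
    let ?s = "\<sigma> 1" and ?x = "inp a" and ?r = "if B a \<noteq> Atom then F a else G a"
    define s1 where "s1 = \<sigma>(1 := Pair ?x ?s)"
    define s2 where "s2 = s1(0 := B a)"
    define s3 where "s3 = s2(0 := ?x)"
    note d = s1_def s2_def s3_def
    have get: "exec_within ?get s2 10 s3" by (rule exec_within_assign) (simp_all add: d a)
    have pop: "exec_within ?pop s3 10 \<sigma>"
      by (rule exec_within_assign) (auto simp add: d a fun_eq_iff)
    have "exec_within (Cond (EVar 0) (Seq ?get (Seq ?pop c)) (Seq ?get (Seq ?pop c'))) s2
            (1 + expr_cost (EVar 0) + (10 + (10 + ?b a))) (\<sigma>(0 := ?r))"
    proof (cases "B a = Atom")
      case False
      have "exec_within c \<sigma> (?b a) (\<sigma>(0 := ?r))"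
        using c[of a \<sigma>] a False by (auto elim: exec_within_mono)
      then show ?thesis using False
        by (intro exec_within_cond_true exec_within_seq[OF get exec_within_seq[OF pop]]) (simp_all add: d)
    next
      case True
      have "exec_within c' \<sigma> (?b a) (\<sigma>(0 := ?r))"
        using c'[of a \<sigma>] a True by (auto elim: exec_within_mono)
      then show ?thesis using True
        by (intro exec_within_cond_false exec_within_seq[OF get exec_within_seq[OF pop]]) (simp_all add: d)
    qed
    then have cond: "exec_within (Cond (EVar 0) (Seq ?get (Seq ?pop c)) (Seq ?get (Seq ?pop c'))) s2
            (1 + 1 + (10 + (10 + ?b a))) (\<sigma>(0 := ?r))" by simp
    show "exec_within ?p \<sigma> (10 + (b0 a + (1 + 1 + (10 + (10 + ?b a))))) (\<sigma>(0 := ?r))"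
    proof (intro exec_within_seq)
      show "exec_within ?push \<sigma> 10 s1" by (rule exec_within_assign) (simp_all add: d a)
      show "exec_within c0 s1 (b0 a) s2" unfolding s2_def by (rule c0(2)[OF a(1)]) (simp add: d a)
    qed (rule cond)
  qed
qed

text \<open>Reuse of a program at parameters \<pi> \<open>z\<close> computed from another domain, as
  happens inside loops.\<close>

lemma poly_time_call:
  assumes "poly_time D' \<nu> inp' F" "poly_time D \<mu> inp (\<lambda>z. inp' (\<pi> z))"
    and "\<And>z. z \<in> D \<Longrightarrow> \<pi> z \<in> D'" "poly_bounded D \<mu> (\<lambda>z. \<nu> (\<pi> z))"
  shows "poly_time D \<mu> inp (\<lambda>z. F (\<pi> z))"
proof (rule poly_time_comp[OF assms(2)])
  obtain c b where c: "poly_bounded D' \<nu> b"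
    "\<And>a \<sigma>. a \<in> D' \<Longrightarrow> \<sigma> 0 = inp' a \<Longrightarrow> exec_within c \<sigma> (b a) (\<sigma>(0 := F a))"
    using assms(1) by (rule poly_timeE) blast
  show "poly_time D \<mu> (\<lambda>z. inp' (\<pi> z)) (\<lambda>z. F (\<pi> z))"
    by (rule poly_timeI[where c = c, OF poly_bounded_subst[OF c(1) assms(3,4)]])
      (simp_all add: c(2) assms(3))
qed

text \<open>The accumulator is given in closed form \<open>acc a i\<close>, so the index becomes
  part of the domain of the step. One polynomial in \<mu> \<open>a\<close> then bounds all
  iterations, and polynomials are never iterated.\<close>

lemma poly_time_fold:
  assumes L: "poly_time D \<mu> inp (\<lambda>a. list_data (L a))"
    and acc0: "poly_time D \<mu> inp (\<lambda>a. acc a 0)"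
    and step: "poly_time {(a, i). a \<in> D \<and> i < length (L a)} (\<lambda>z. \<mu> (fst z))
      (\<lambda>z. Pair (L (fst z) ! snd z) (Pair (acc (fst z) (snd z)) (inp (fst z))))
      (\<lambda>z. acc (fst z) (Suc (snd z)))"
    and len: "poly_bounded D \<mu> (\<lambda>a. length (L a))"
  shows "poly_time D \<mu> inp (\<lambda>a. acc a (length (L a)))"
proof -
  obtain c k where c: "\<And>a i \<sigma>. a \<in> D \<Longrightarrow> i < length (L a) \<Longrightarrow>
      \<sigma> 0 = Pair (L a ! i) (Pair (acc a i) (inp a)) \<Longrightarrow>
      exec_within c \<sigma> ((\<mu> a + 2) ^ k) (\<sigma>(0 := acc a (Suc i)))"
  proof -
    obtain c b where 1: "poly_bounded {(a, i). a \<in> D \<and> i < length (L a)} (\<lambda>z. \<mu> (fst z)) b"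
      "\<And>z \<sigma>. z \<in> {(a, i). a \<in> D \<and> i < length (L a)} \<Longrightarrow>
        \<sigma> 0 = Pair (L (fst z) ! snd z) (Pair (acc (fst z) (snd z)) (inp (fst z))) \<Longrightarrow>
        exec_within c \<sigma> (b z) (\<sigma>(0 := acc (fst z) (Suc (snd z))))"
      using step by (rule poly_timeE) blast
    obtain k where 2: "\<And>z. z \<in> {(a, i). a \<in> D \<and> i < length (L a)} \<Longrightarrow> b z \<le> (\<mu> (fst z) + 2) ^ k"
      using 1(1) by (rule poly_boundedE) blast
    show thesis
      by (rule that[of c k], rule exec_within_mono, rule 1(2)[of "(_, _)", simplified])
        (use 2[of "(_, _)", simplified] in auto)
  qed
  \<comment> \<open>Variable \<open>0\<close> carries the remaining list, the accumulator and the
    input. The remaining list and the input are stacked in variable \<open>1\<close> because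
    \<open>c\<close> overwrites variable \<open>0\<close>.\<close>
  let ?body = "Seq (Assign 1 (EPair (EPair (ERight (ELeft (EVar 0))) (ERight (ERight (EVar 0)))) (EVar 1)))
    (Seq (Assign 0 (EPair (ELeft (ELeft (EVar 0))) (ERight (EVar 0))))
    (Seq c (Seq (Assign 0 (EPair (ELeft (ELeft (EVar 1))) (EPair (EVar 0) (ERight (ELeft (EVar 1))))))
      (Assign 1 (ERight (EVar 1))))))"
  let ?w = "While (ELeft (EVar 0)) ?body"
  let ?e = "\<lambda>a. 1 + 2 + (20 + (20 + ((\<mu> a + 2) ^ k + (20 + 20))))"
  have loop: "exec_within ?w \<sigma> (d * ?e a + (1 + 2)) (\<sigma>(0 := Pair Atom (Pair (acc a (length (L a))) (inp a))))"
    if a: "a \<in> D" and "\<sigma> 0 = Pair (list_data (drop i (L a))) (Pair (acc a i) (inp a))"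
      "i \<le> length (L a)" "d = length (L a) - i" for a \<sigma> i d
    using that(2-)
  proof (induction d arbitrary: i \<sigma>)
    case 0
    then have "i = length (L a)" by simp
    with 0 have s: "\<sigma> 0 = Pair Atom (Pair (acc a (length (L a))) (inp a))" by simp
    then have "\<sigma>(0 := Pair Atom (Pair (acc a (length (L a))) (inp a))) = \<sigma>" by auto
    then show ?case using exec_within_while_false[of "ELeft (EVar 0)" \<sigma> ?body] s by simp
  next
    case (Suc d)
    then have i: "i < length (L a)" by simp
    let ?l = "list_data (drop (Suc i) (L a))" and ?y = "L a ! i" and ?x = "inp a"
    have s: "\<sigma> 0 = Pair (Pair ?y ?l) (Pair (acc a i) ?x)"
      using Suc.prems(1) i by (simp add: Cons_nth_drop_Suc[symmetric])
    define s1 where "s1 = \<sigma>(1 := Pair (Pair ?l ?x) (\<sigma> 1))"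
    define s2 where "s2 = s1(0 := Pair ?y (Pair (acc a i) ?x))"
    define s3 where "s3 = s2(0 := acc a (Suc i))"
    define s4 where "s4 = s3(0 := Pair ?l (Pair (acc a (Suc i)) ?x))"
    define s5 where "s5 = \<sigma>(0 := Pair ?l (Pair (acc a (Suc i)) ?x))"
    note d = s1_def s2_def s3_def s4_def s5_def
    have "exec_within ?body \<sigma> (20 + (20 + ((\<mu> a + 2) ^ k + (20 + 20)))) s5"
    proof (intro exec_within_seq)
      show "exec_within (Assign 1 (EPair (EPair (ERight (ELeft (EVar 0))) (ERight (ERight (EVar 0)))) (EVar 1))) \<sigma> 20 s1"
        by (rule exec_within_assign) (simp_all add: d s)
      show "exec_within (Assign 0 (EPair (ELeft (ELeft (EVar 0))) (ERight (EVar 0)))) s1 20 s2"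
        by (rule exec_within_assign) (simp_all add: d s)
      show "exec_within c s2 ((\<mu> a + 2) ^ k) s3" unfolding s3_def
        by (rule c[OF a i]) (simp add: s2_def)
      show "exec_within (Assign 0 (EPair (ELeft (ELeft (EVar 1))) (EPair (EVar 0) (ERight (ELeft (EVar 1)))))) s3 20 s4"
        by (rule exec_within_assign) (simp_all add: d s)
      show "exec_within (Assign 1 (ERight (EVar 1))) s4 20 s5"
        by (rule exec_within_assign) (auto simp: d s fun_eq_iff)
    qed
    moreover have "exec_within ?w s5 (d * ?e a + (1 + 2)) (s5(0 := Pair Atom (Pair (acc a (length (L a))) (inp a))))"
      by (rule Suc.IH[of _ "Suc i"]) (use Suc.prems i in \<open>auto simp: s5_def\<close>)
    ultimately have "exec_within ?w \<sigma> (1 + expr_cost (ELeft (EVar 0)) + (20 + (20 + ((\<mu> a + 2) ^ k + (20 + 20)))) + (d * ?e a + (1 + 2)))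
       (s5(0 := Pair Atom (Pair (acc a (length (L a))) (inp a))))"
      by (intro exec_within_while_true) (simp_all add: s)
    then show ?case by (simp add: s5_def fun_upd_def cong: if_cong)
  qed
  have "poly_time D \<mu> (\<lambda>a. Pair (list_data (L a)) (Pair (acc a 0) (inp a))) (\<lambda>a. acc a (length (L a)))"
  proof (rule poly_timeI[where c = "Seq ?w (Assign 0 (ELeft (ERight (EVar 0))))"
        and b = "\<lambda>a. (length (L a) * ?e a + (1 + 2)) + 10"])
    show "poly_bounded D \<mu> (\<lambda>a. (length (L a) * ?e a + (1 + 2)) + 10)"
      by (intro poly_bounded_add poly_bounded_mult poly_bounded_const len poly_bounded_power poly_bounded_measure)
    fix a and \<sigma> :: store assume a: "a \<in> D" "\<sigma> 0 = Pair (list_data (L a)) (Pair (acc a 0) (inp a))"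
    show "exec_within (Seq ?w (Assign 0 (ELeft (ERight (EVar 0))))) \<sigma>
       ((length (L a) * ?e a + (1 + 2)) + 10) (\<sigma>(0 := acc a (length (L a))))"
      by (rule exec_within_seq, rule loop[of _ _ 0], use a in simp, use a in simp, simp, simp,
          rule exec_within_assign) auto
  qed
  then show ?thesis
    by (rule poly_time_comp[rotated]) (intro poly_time_pair L acc0 poly_time_id)
qed

section \<open>List programs\<close>

lemma poly_time_cong_inp:
  assumes "poly_time D \<mu> inp F" "\<And>a. a \<in> D \<Longrightarrow> inp a = inp' a" "\<And>a. a \<in> D \<Longrightarrow> F a = F' a"
  shows "poly_time D \<mu> inp' F'"
  using assms unfolding poly_time_def by metis

lemma poly_time_elem: "poly_time D \<mu> (\<lambda>z. Pair (H z) (R z)) H"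
  using poly_time_left[OF poly_time_id, of D \<mu> "\<lambda>z. Pair (H z) (R z)"] by simp

lemma poly_time_rest: "poly_time D \<mu> (\<lambda>z. Pair (H z) (R z)) R"
  using poly_time_right[OF poly_time_id, of D \<mu> "\<lambda>z. Pair (H z) (R z)"] by simp

lemma poly_time_subst:
  assumes "poly_time D' \<nu> inp' F" "poly_time D \<mu> inp (\<lambda>z. inp' (\<pi> z))"
    and "\<And>z. z \<in> D \<Longrightarrow> \<pi> z \<in> D'" "\<And>z. z \<in> D \<Longrightarrow> \<nu> (\<pi> z) \<le> \<mu> z"
  shows "poly_time D \<mu> inp (\<lambda>z. F (\<pi> z))"
  by (rule poly_time_call[OF assms(1-3)])
    (auto intro: poly_bounded_mono[OF poly_bounded_measure] assms(4))

text \<open>A loop body lives on a \<open>Sigma\<close> domain, with the code of the current element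
  paired in front of the input. What the outer input yields stays computable there, to any depth of
  nesting.\<close>

lemma poly_time_lift:
  assumes "poly_time D \<mu> inp F"
  shows "poly_time (Sigma D B) (\<lambda>z. \<mu> (fst z)) (\<lambda>z. Pair (H z) (inp (fst z))) (\<lambda>z. F (fst z))"
  by (rule poly_time_subst[OF assms poly_time_rest]) auto

lemma poly_bounded_lift:
  "poly_bounded D \<mu> f \<Longrightarrow> poly_bounded (Sigma D B) (\<lambda>z. \<mu> (fst z)) (\<lambda>z. f (fst z))"
  unfolding poly_bounded_def by auto

text \<open>The coding \<open>e\<close> allows \<open>L\<close> to be a list of abstract objects
  rather than trees.\<close>

lemma poly_time_fold_map:
  assumes L: "poly_time D \<mu> inp (\<lambda>a. list_data (map (e a) (L a)))"
    and acc0: "poly_time D \<mu> inp (\<lambda>a. acc a 0)"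
    and len: "poly_bounded D \<mu> (\<lambda>a. length (L a))"
    and step: "poly_time {z. fst z \<in> D \<and> snd z < length (L (fst z))} (\<lambda>z. \<mu> (fst z))
      (\<lambda>z. Pair (e (fst z) (L (fst z) ! snd z)) (Pair (acc (fst z) (snd z)) (inp (fst z))))
      (\<lambda>z. acc (fst z) (Suc (snd z)))"
  shows "poly_time D \<mu> inp (\<lambda>a. acc a (length (L a)))"
proof -
  have "poly_time D \<mu> inp (\<lambda>a. acc a (length (map (e a) (L a))))"
  proof (rule poly_time_fold[where acc = acc, OF L acc0])
    have "{(a, i). a \<in> D \<and> i < length (map (e a) (L a))} = {z. fst z \<in> D \<and> snd z < length (L (fst z))}"
      by auto
    then show "poly_time {(a, i). a \<in> D \<and> i < length (map (e a) (L a))} (\<lambda>z. \<mu> (fst z))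
      (\<lambda>z. Pair (map (e (fst z)) (L (fst z)) ! snd z) (Pair (acc (fst z) (snd z)) (inp (fst z))))
      (\<lambda>z. acc (fst z) (Suc (snd z)))"
      using poly_time_cong_inp[OF step] by simp
  qed (simp add: len)
  then show ?thesis by simp
qed

lemma poly_time_loop_acc:
  "poly_time D \<mu> (\<lambda>z. Pair (H z) (Pair (A z) (R z))) A"
  using poly_time_left[OF poly_time_right[OF poly_time_id], of D \<mu> "\<lambda>z. Pair (H z) (Pair (A z) (R z))"] by simp

lemma poly_time_loop_rest:
  "poly_time D \<mu> (\<lambda>z. Pair (H z) (Pair (A z) (R z))) R"
  using poly_time_right[OF poly_time_right[OF poly_time_id], of D \<mu> "\<lambda>z. Pair (H z) (Pair (A z) (R z))"] by simp

text \<open>Adapter from a body on a \<open>Sigma\<close> domain to the step format of folds: it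
  discards the accumulator and replaces the index by the element.\<close>

lemma poly_time_loop_body:
  assumes "poly_time (SIGMA a:D. set (L a)) (\<lambda>z. \<mu> (fst z)) (\<lambda>z. Pair (e (fst z) (snd z)) (inp (fst z)))
      (\<lambda>z. G (fst z) (snd z))"
  shows "poly_time {z. fst z \<in> D \<and> snd z < length (L (fst z))} (\<lambda>z. \<mu> (fst z))
      (\<lambda>z. Pair (e (fst z) (L (fst z) ! snd z)) (Pair (acc (fst z) (snd z)) (inp (fst z))))
      (\<lambda>z. G (fst z) (L (fst z) ! snd z))"
  using poly_time_subst[OF assms, where \<pi> = "\<lambda>z. (fst z, L (fst z) ! snd z)" and
      D = "{z. fst z \<in> D \<and> snd z < length (L (fst z))}" and \<mu> = "\<lambda>z. \<mu> (fst z)" and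
      inp = "\<lambda>z. Pair (e (fst z) (L (fst z) ! snd z)) (Pair (acc (fst z) (snd z)) (inp (fst z)))"]
  by (simp add: poly_time_pair poly_time_elem poly_time_loop_rest mem_Times_iff)

section \<open>Lists: reversal, concatenation, filtering and bounded quantifiers\<close>

lemma poly_time_rev:
  assumes "poly_time D \<mu> inp (\<lambda>a. list_data (L a))" "poly_bounded D \<mu> (\<lambda>a. length (L a))"
  shows "poly_time D \<mu> inp (\<lambda>a. list_data (rev (L a)))"
proof -
  have "poly_time D \<mu> inp (\<lambda>a. list_data (rev (take (length (L a)) (L a))))"
  proof (rule poly_time_fold_map[where e = "\<lambda>_ x. x" and acc = "\<lambda>a i. list_data (rev (take i (L a)))"])
    show "poly_time {z. fst z \<in> D \<and> snd z < length (L (fst z))} (\<lambda>z. \<mu> (fst z))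
     (\<lambda>z. Pair (L (fst z) ! snd z) (Pair (list_data (rev (take (snd z) (L (fst z))))) (inp (fst z))))
     (\<lambda>z. list_data (rev (take (Suc (snd z)) (L (fst z)))))"
      by (rule poly_time_cong[OF poly_time_pair[OF poly_time_elem poly_time_loop_acc]])
        (simp add: take_Suc_conv_app_nth)
  qed (simp_all add: assms poly_time_const)
  then show ?thesis by simp
qed

text \<open>The reversed first list is moved element by element onto the second, so \<open>M\<close>
  needs no length bound.\<close>

lemma poly_time_append:
  assumes "poly_time D \<mu> inp (\<lambda>a. list_data (L a))" "poly_time D \<mu> inp (\<lambda>a. list_data (M a))"
    "poly_bounded D \<mu> (\<lambda>a. length (L a))"
  shows "poly_time D \<mu> inp (\<lambda>a. list_data (L a @ M a))"
proof -
  have "poly_time D \<mu> inp (\<lambda>a. list_data (rev (take (length (rev (L a))) (rev (L a))) @ M a))"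
  proof (rule poly_time_fold_map[where e = "\<lambda>_ x. x" and L = "\<lambda>a. rev (L a)"
        and acc = "\<lambda>a i. list_data (rev (take i (rev (L a))) @ M a)"])
    show "poly_time {z. fst z \<in> D \<and> snd z < length (rev (L (fst z)))} (\<lambda>z. \<mu> (fst z))
     (\<lambda>z. Pair (rev (L (fst z)) ! snd z) (Pair (list_data (rev (take (snd z) (rev (L (fst z)))) @ M (fst z))) (inp (fst z))))
     (\<lambda>z. list_data (rev (take (Suc (snd z)) (rev (L (fst z)))) @ M (fst z)))"
      by (rule poly_time_cong[OF poly_time_pair[OF poly_time_elem poly_time_loop_acc]])
        (simp add: take_Suc_conv_app_nth del: rev_take)
  qed (simp_all add: assms poly_time_rev)
  then show ?thesis by simp
qed

text \<open>A fold that conses produces its result backwards; a final reversal restores the order,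
  as in \<open>poly_time_filter\<close>.\<close>

lemma poly_time_map:
  assumes L: "poly_time D \<mu> inp (\<lambda>a. list_data (map (e a) (L a)))"
    and G: "poly_time (SIGMA a:D. set (L a)) (\<lambda>z. \<mu> (fst z)) (\<lambda>z. Pair (e (fst z) (snd z)) (inp (fst z)))
      (\<lambda>z. G (fst z) (snd z))"
    and len: "poly_bounded D \<mu> (\<lambda>a. length (L a))"
  shows "poly_time D \<mu> inp (\<lambda>a. list_data (map (G a) (L a)))"
proof -
  have "poly_time D \<mu> inp (\<lambda>a. list_data (rev (map (G a) (take (length (L a)) (L a)))))"
  proof (rule poly_time_fold_map[OF L _ len, where acc = "\<lambda>a i. list_data (rev (map (G a) (take i (L a))))"])
    show "poly_time {z. fst z \<in> D \<and> snd z < length (L (fst z))} (\<lambda>z. \<mu> (fst z))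
     (\<lambda>z. Pair (e (fst z) (L (fst z) ! snd z))
       (Pair (list_data (rev (map (G (fst z)) (take (snd z) (L (fst z)))))) (inp (fst z))))
     (\<lambda>z. list_data (rev (map (G (fst z)) (take (Suc (snd z)) (L (fst z))))))"
      by (rule poly_time_cong[OF poly_time_pair[OF poly_time_loop_body[OF G] poly_time_loop_acc]])
        (simp add: take_Suc_conv_app_nth)
  qed (simp add: poly_time_const)
  from poly_time_rev[OF this] show ?thesis using len by simp
qed

lemma bool_data_eq_Atom [simp]: "bool_data b = Atom \<longleftrightarrow> \<not> b"
  by (simp add: bool_data_def)

lemma poly_time_if_bool:
  assumes "poly_time D \<mu> inp (\<lambda>a. bool_data (P a))"
    and "poly_time {a\<in>D. P a} \<mu> inp F" and "poly_time {a\<in>D. \<not> P a} \<mu> inp G"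
  shows "poly_time D \<mu> inp (\<lambda>a. if P a then F a else G a)"
proof -
  have "poly_time D \<mu> inp (\<lambda>a. if bool_data (P a) \<noteq> Atom then F a else G a)"
    by (rule poly_time_if[OF assms(1)]) (simp_all add: assms(2,3))
  then show ?thesis by simp
qed

lemma poly_time_subset: "poly_time D \<mu> inp F \<Longrightarrow> D' \<subseteq> D \<Longrightarrow> poly_time D' \<mu> inp F"
  unfolding poly_time_def poly_bounded_def by blast

lemma poly_time_if_simple:
  assumes "poly_time D \<mu> inp (\<lambda>a. bool_data (P a))" "poly_time D \<mu> inp F" "poly_time D \<mu> inp G"
  shows "poly_time D \<mu> inp (\<lambda>a. if P a then F a else G a)"
  by (rule poly_time_if_bool[OF assms(1)]) (auto intro: poly_time_subset assms)

lemma poly_time_not: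
  assumes "poly_time D \<mu> inp (\<lambda>a. bool_data (P a))"
  shows "poly_time D \<mu> inp (\<lambda>a. bool_data (\<not> P a))"
  by (rule poly_time_cong[OF poly_time_if_simple[OF assms
        poly_time_const[where d = "bool_data False"] poly_time_const[where d = "bool_data True"]]]) simp

lemma poly_time_conj:
  assumes "poly_time D \<mu> inp (\<lambda>a. bool_data (P a))" "poly_time D \<mu> inp (\<lambda>a. bool_data (Q a))"
  shows "poly_time D \<mu> inp (\<lambda>a. bool_data (P a \<and> Q a))"
  by (rule poly_time_cong[OF poly_time_if_simple[OF assms poly_time_const[where d = "bool_data False"]]]) simp

lemma poly_time_filter:
  assumes L: "poly_time D \<mu> inp (\<lambda>a. list_data (map (e a) (L a)))"
    and P: "poly_time (SIGMA a:D. set (L a)) (\<lambda>z. \<mu> (fst z)) (\<lambda>z. Pair (e (fst z) (snd z)) (inp (fst z)))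
      (\<lambda>z. bool_data (P (fst z) (snd z)))"
    and len: "poly_bounded D \<mu> (\<lambda>a. length (L a))"
  shows "poly_time D \<mu> inp (\<lambda>a. list_data (map (e a) (filter (P a) (L a))))"
proof -
  have "poly_time D \<mu> inp (\<lambda>a. list_data (rev (map (e a) (filter (P a) (take (length (L a)) (L a))))))"
  proof (rule poly_time_fold_map[OF L _ len, where acc = "\<lambda>a i. list_data (rev (map (e a) (filter (P a) (take i (L a)))))"])
    show "poly_time {z. fst z \<in> D \<and> snd z < length (L (fst z))} (\<lambda>z. \<mu> (fst z))
     (\<lambda>z. Pair (e (fst z) (L (fst z) ! snd z))
       (Pair (list_data (rev (map (e (fst z)) (filter (P (fst z)) (take (snd z) (L (fst z))))))) (inp (fst z))))
     (\<lambda>z. list_data (rev (map (e (fst z)) (filter (P (fst z)) (take (Suc (snd z)) (L (fst z)))))))"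
      by (rule poly_time_cong[OF poly_time_if_simple[OF poly_time_loop_body[OF P]
            poly_time_pair[OF poly_time_elem poly_time_loop_acc] poly_time_loop_acc]])
        (simp add: take_Suc_conv_app_nth)
  qed (simp add: poly_time_const)
  moreover have "poly_bounded D \<mu> (\<lambda>a. length (filter (P a) (L a)))"
    by (rule poly_bounded_mono[OF len]) simp
  ultimately show ?thesis using poly_time_rev[of D \<mu> inp "\<lambda>a. rev (map (e a) (filter (P a) (L a)))"] by simp
qed

text \<open>Traversing the list backwards puts each new piece in front of the accumulator, and by
  \<open>poly_time_append\<close> only the length of the piece then has to be bounded.\<close>

lemma poly_time_concat_map:
  assumes L: "poly_time D \<mu> inp (\<lambda>a. list_data (map (e a) (L a)))"
    and G: "poly_time (SIGMA a:D. set (L a)) (\<lambda>z. \<mu> (fst z)) (\<lambda>z. Pair (e (fst z) (snd z)) (inp (fst z)))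
      (\<lambda>z. list_data (G (fst z) (snd z)))"
    and len: "poly_bounded D \<mu> (\<lambda>a. length (L a))"
    and len': "poly_bounded (SIGMA a:D. set (L a)) (\<lambda>z. \<mu> (fst z)) (\<lambda>z. length (G (fst z) (snd z)))"
  shows "poly_time D \<mu> inp (\<lambda>a. list_data (concat (map (G a) (L a))))"
proof -
  let ?l = "\<lambda>a. rev (L a)"
  have L': "poly_time D \<mu> inp (\<lambda>a. list_data (map (e a) (?l a)))"
    using poly_time_rev[OF L] len by (simp add: rev_map)
  have G': "poly_time (SIGMA a:D. set (?l a)) (\<lambda>z. \<mu> (fst z)) (\<lambda>z. Pair (e (fst z) (snd z)) (inp (fst z)))
      (\<lambda>z. list_data (G (fst z) (snd z)))" using G by simp
  have "poly_time D \<mu> inp (\<lambda>a. list_data (concat (rev (map (G a) (take (length (?l a)) (?l a))))))"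
  proof (rule poly_time_fold_map[OF L', where acc = "\<lambda>a i. list_data (concat (rev (map (G a) (take i (?l a)))))"])
    let ?D = "{z. fst z \<in> D \<and> snd z < length (?l (fst z))}"
    have "poly_bounded ?D (\<lambda>z. \<mu> (fst z)) (\<lambda>z. length (G (fst z) (?l (fst z) ! snd z)))"
    proof (rule poly_bounded_subst[OF len', where \<pi> = "\<lambda>z. (fst z, ?l (fst z) ! snd z)", simplified fst_conv snd_conv])
      fix z assume "z \<in> ?D"
      then have "fst z \<in> D" "?l (fst z) ! snd z \<in> set (?l (fst z))" by (auto simp del: set_rev)
      then show "(fst z, ?l (fst z) ! snd z) \<in> (SIGMA a:D. set (L a))" by simp
    qed (rule poly_bounded_measure)
    then show "poly_time ?D (\<lambda>z. \<mu> (fst z))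
     (\<lambda>z. Pair (e (fst z) (?l (fst z) ! snd z))
       (Pair (list_data (concat (rev (map (G (fst z)) (take (snd z) (?l (fst z))))))) (inp (fst z))))
     (\<lambda>z. list_data (concat (rev (map (G (fst z)) (take (Suc (snd z)) (?l (fst z)))))))"
      by (intro poly_time_cong[OF poly_time_append[OF poly_time_loop_body[OF G'] poly_time_loop_acc]])
        (simp_all add: take_Suc_conv_app_nth del: rev_take)
  qed (simp_all add: poly_time_const len)
  then show ?thesis by (simp add: rev_map)
qed

lemma poly_time_bex:
  assumes L: "poly_time D \<mu> inp (\<lambda>a. list_data (map (e a) (L a)))"
    and P: "poly_time (SIGMA a:D. set (L a)) (\<lambda>z. \<mu> (fst z)) (\<lambda>z. Pair (e (fst z) (snd z)) (inp (fst z)))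
      (\<lambda>z. bool_data (P (fst z) (snd z)))"
    and len: "poly_bounded D \<mu> (\<lambda>a. length (L a))"
  shows "poly_time D \<mu> inp (\<lambda>a. bool_data (\<exists>x\<in>set (L a). P a x))"
proof -
  have "poly_time D \<mu> inp (\<lambda>a. bool_data (\<exists>x\<in>set (take (length (L a)) (L a)). P a x))"
  proof (rule poly_time_fold_map[OF L _ len, where acc = "\<lambda>a i. bool_data (\<exists>x\<in>set (take i (L a)). P a x)"])
    show "poly_time {z. fst z \<in> D \<and> snd z < length (L (fst z))} (\<lambda>z. \<mu> (fst z))
     (\<lambda>z. Pair (e (fst z) (L (fst z) ! snd z))
       (Pair (bool_data (\<exists>x\<in>set (take (snd z) (L (fst z))). P (fst z) x)) (inp (fst z))))
     (\<lambda>z. bool_data (\<exists>x\<in>set (take (Suc (snd z)) (L (fst z))). P (fst z) x))"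
      by (rule poly_time_cong[OF poly_time_if_simple[OF poly_time_loop_body[OF P]
            poly_time_const[where d = "bool_data True"] poly_time_loop_acc]])
        (auto simp add: take_Suc_conv_app_nth)
  qed (simp add: poly_time_const)
  then show ?thesis by simp
qed

lemma poly_time_ball:
  assumes L: "poly_time D \<mu> inp (\<lambda>a. list_data (map (e a) (L a)))"
    and P: "poly_time (SIGMA a:D. set (L a)) (\<lambda>z. \<mu> (fst z)) (\<lambda>z. Pair (e (fst z) (snd z)) (inp (fst z)))
      (\<lambda>z. bool_data (P (fst z) (snd z)))"
    and len: "poly_bounded D \<mu> (\<lambda>a. length (L a))"
  shows "poly_time D \<mu> inp (\<lambda>a. bool_data (\<forall>x\<in>set (L a). P a x))"
  using poly_time_not[OF poly_time_bex[OF L poly_time_not[OF P] len]] by simp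

section \<open>Unary arithmetic\<close>

definition un :: "nat \<Rightarrow> data" where
  "un k = list_data (replicate k Atom)"

lemma un_0 [simp]: "un 0 = Atom" and un_Suc [simp]: "un (Suc k) = Pair Atom (un k)"
  by (simp_all add: un_def)

lemma un_eq_Atom [simp]: "un k = Atom \<longleftrightarrow> k = 0"
  by (cases k) simp_all

lemma list_data_eq_Atom [simp]: "list_data l = Atom \<longleftrightarrow> l = []"
  by (cases l) simp_all

lemma right_list_data: "right (list_data l) = list_data (tl l)"
  by (cases l) simp_all

lemma map_const_Atom: "list_data (map (\<lambda>_. Atom) l) = un (length l)"
  by (induction l) simp_all

lemma poly_time_length:
  assumes "poly_time D \<mu> inp (\<lambda>a. list_data (map (e a) (L a)))" "poly_bounded D \<mu> (\<lambda>a. length (L a))"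
  shows "poly_time D \<mu> inp (\<lambda>a. un (length (L a)))"
  using poly_time_map[OF assms(1) poly_time_const[where d = Atom] assms(2)] by (simp add: map_const_Atom)

text \<open>One tree is both a unary number and a list of dummies, so a number can control a loop.
  Unary arithmetic is affordable because the numbers handled are polynomial in the measure.\<close>

lemma poly_time_un_list:
  assumes "poly_time D \<mu> inp (\<lambda>a. un (k a))"
  shows "poly_time D \<mu> inp (\<lambda>a. list_data (map (\<lambda>_. Atom) (replicate (k a) Atom)))"
  using assms by (simp add: un_def)

lemma poly_time_un_add:
  assumes "poly_time D \<mu> inp (\<lambda>a. un (i a))" "poly_time D \<mu> inp (\<lambda>a. un (j a))" "poly_bounded D \<mu> i"
  shows "poly_time D \<mu> inp (\<lambda>a. un (i a + j a))"
  using poly_time_append[OF assms(1,2)[unfolded un_def]] assms(3) by (simp add: un_def replicate_add)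

lemma poly_time_un_Suc:
  assumes "poly_time D \<mu> inp (\<lambda>a. un (i a))"
  shows "poly_time D \<mu> inp (\<lambda>a. un (Suc (i a)))"
  using poly_time_pair[OF poly_time_const[where d = Atom] assms] by simp

lemma poly_time_un_mult:
  assumes "poly_time D \<mu> inp (\<lambda>a. un (i a))" "poly_time D \<mu> inp (\<lambda>a. un (j a))"
    "poly_bounded D \<mu> i" "poly_bounded D \<mu> j"
  shows "poly_time D \<mu> inp (\<lambda>a. un (i a * j a))"
proof -
  have *: "concat (map (\<lambda>_. replicate k y) (replicate l x)) = replicate (l * k) y" for k l and x y :: data
    by (induction l) (simp_all add: replicate_add)
  have "poly_time D \<mu> inp (\<lambda>a. list_data (concat (map (\<lambda>_. replicate (j a) Atom) (replicate (i a) Atom))))"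
    by (rule poly_time_concat_map[OF poly_time_un_list[OF assms(1)] poly_time_lift[OF assms(2)[unfolded un_def]]])
      (use poly_bounded_lift[OF assms(4)] assms in simp_all)
  then show ?thesis by (simp only: * un_def)
qed

lemma poly_time_drop:
  assumes "poly_time D \<mu> inp (\<lambda>a. un (k a))" "poly_time D \<mu> inp (\<lambda>a. list_data (L a))" "poly_bounded D \<mu> k"
  shows "poly_time D \<mu> inp (\<lambda>a. list_data (drop (k a) (L a)))"
proof -
  have "poly_time D \<mu> inp (\<lambda>a. list_data (drop (length (replicate (k a) Atom)) (L a)))"
  proof (rule poly_time_fold_map[OF poly_time_un_list[OF assms(1)], where acc = "\<lambda>a i. list_data (drop i (L a))"])
    show "poly_time {z. fst z \<in> D \<and> snd z < length (replicate (k (fst z)) Atom)} (\<lambda>z. \<mu> (fst z))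
       (\<lambda>z. Pair Atom (Pair (list_data (drop (snd z) (L (fst z)))) (inp (fst z))))
       (\<lambda>z. list_data (drop (Suc (snd z)) (L (fst z))))"
      by (rule poly_time_cong[OF poly_time_right[OF poly_time_loop_acc]])
        (simp add: right_list_data drop_Suc tl_drop)
  qed (use assms in simp_all)
  then show ?thesis by simp
qed

lemma poly_time_nth:
  assumes "poly_time D \<mu> inp (\<lambda>a. un (k a))" "poly_time D \<mu> inp (\<lambda>a. list_data (map (e a) (L a)))"
    "poly_bounded D \<mu> k" "\<And>a. a \<in> D \<Longrightarrow> k a < length (L a)"
  shows "poly_time D \<mu> inp (\<lambda>a. e a (L a ! k a))"
  by (rule poly_time_cong[OF poly_time_left[OF poly_time_drop[OF assms(1-3)]]])
    (simp add: assms(4) Cons_nth_drop_Suc[symmetric])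

lemma poly_time_un_diff:
  assumes "poly_time D \<mu> inp (\<lambda>a. un (i a))" "poly_time D \<mu> inp (\<lambda>a. un (j a))" "poly_bounded D \<mu> j"
  shows "poly_time D \<mu> inp (\<lambda>a. un (i a - j a))"
  using poly_time_drop[OF assms(2) assms(1)[unfolded un_def] assms(3)] by (simp add: un_def)

lemma poly_time_un_less:
  assumes "poly_time D \<mu> inp (\<lambda>a. un (i a))" "poly_time D \<mu> inp (\<lambda>a. un (j a))" "poly_bounded D \<mu> i"
  shows "poly_time D \<mu> inp (\<lambda>a. bool_data (i a < j a))"
  by (rule poly_time_cong[OF poly_time_if[OF poly_time_un_diff[OF assms(2,1,3)]
     poly_time_const[where d = "bool_data True"] poly_time_const[where d = "bool_data False"]]]) simp

lemma poly_time_un_eq: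
  assumes "poly_time D \<mu> inp (\<lambda>a. un (i a))" "poly_time D \<mu> inp (\<lambda>a. un (j a))"
    "poly_bounded D \<mu> i" "poly_bounded D \<mu> j"
  shows "poly_time D \<mu> inp (\<lambda>a. bool_data (i a = j a))"
  by (rule poly_time_cong[OF poly_time_conj[OF poly_time_not[OF poly_time_un_less[OF assms(1-3)]]
     poly_time_not[OF poly_time_un_less[OF assms(2,1,4)]]]]) (auto simp: bool_data_def)

lemma poly_time_bool_eq:
  assumes "poly_time D \<mu> inp (\<lambda>a. bool_data (P a))" "poly_time D \<mu> inp (\<lambda>a. bool_data (Q a))"
  shows "poly_time D \<mu> inp (\<lambda>a. bool_data (P a = Q a))"
  by (rule poly_time_cong[OF poly_time_if_simple[OF assms(1) assms(2) poly_time_not[OF assms(2)]]]) simp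

lemma poly_time_upt:
  assumes "poly_time D \<mu> inp (\<lambda>a. un (k a))" "poly_bounded D \<mu> k"
  shows "poly_time D \<mu> inp (\<lambda>a. list_data (map un [0..<k a]))"
proof -
  have "poly_time D \<mu> inp (\<lambda>a. Pair (un (length (replicate (k a) Atom)))
     (list_data (rev (map un [0..<length (replicate (k a) Atom)]))))"
  proof (rule poly_time_fold_map[OF poly_time_un_list[OF assms(1)],
        where acc = "\<lambda>a i. Pair (un i) (list_data (rev (map un [0..<i])))"])
    show "poly_time {z. fst z \<in> D \<and> snd z < length (replicate (k (fst z)) Atom)} (\<lambda>z. \<mu> (fst z))
       (\<lambda>z. Pair Atom (Pair (Pair (un (snd z)) (list_data (rev (map un [0..<snd z])))) (inp (fst z))))
       (\<lambda>z. Pair (un (Suc (snd z))) (list_data (rev (map un [0..<Suc (snd z)]))))"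
      by (rule poly_time_cong[OF poly_time_pair[OF
              poly_time_pair[OF poly_time_const[where d = Atom] poly_time_left[OF poly_time_loop_acc]]
              poly_time_loop_acc]]) simp
  qed (simp_all add: assms poly_time_const)
  from poly_time_rev[OF poly_time_right[OF this, simplified right.simps]]
  show ?thesis using assms(2) by simp
qed

section \<open>Conversion between binary and unary numbers\<close>

fun bits :: "nat \<Rightarrow> bool list" where
  "bits n = (if n = 0 then [] else odd n # bits (n div 2))"

declare bits.simps [simp del]

lemma bits_0 [simp]: "bits 0 = []" by (simp add: bits.simps)

lemma nat_data_bits: "nat_data n = list_data (map bool_data (bits n))"
proof (induction n rule: bits.induct)
  case (1 n)
  then show ?case by (subst nat_data.simps, subst bits.simps) auto
qed

lemma left_nat_data: "left (nat_data n) = bool_data (odd n)"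
  by (subst nat_data.simps) (auto simp: bool_data_def)

lemma right_nat_data: "right (nat_data n) = nat_data (n div 2)"
  by (subst nat_data.simps) (auto simp: nat_data.simps)

lemma less_two_power_bits: "n < 2 ^ length (bits n)"
proof (induction n rule: bits.induct)
  case (1 n)
  then show ?case by (subst bits.simps) auto
qed

lemma two_power_bits_le: "i < length (bits n) \<Longrightarrow> 2 ^ i \<le> n"
proof (induction n arbitrary: i rule: bits.induct)
  case (1 n)
  then have n: "n \<noteq> 0" by (cases "n = 0") simp_all
  show ?case
  proof (cases i)
    case (Suc j)
    with 1(2) n have "j < length (bits (n div 2))" by (simp add: bits.simps[of n])
    from 1(1)[OF n this] Suc show ?thesis by (simp add: less_eq_div_iff_mult_less_eq)
  qed (use n in simp)
qed

lemma nth_bits: "i < length (bits n) \<Longrightarrow> bits n ! i = odd (n div 2 ^ i)"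
proof (induction n arbitrary: i rule: bits.induct)
  case (1 n)
  then have n: "n \<noteq> 0" by (cases "n = 0") simp_all
  show ?case
  proof (cases i)
    case (Suc j)
    with 1(2) n have "j < length (bits (n div 2))" by (simp add: bits.simps[of n])
    from 1(1)[OF n this] Suc n show ?thesis
      by (simp add: bits.simps[of n] div_mult2_eq)
  qed (use n in \<open>simp add: bits.simps[of n]\<close>)
qed

lemma length_bits_le: "length (bits n) \<le> n"
proof (cases "length (bits n)")
  case (Suc l)
  then have "2 ^ l \<le> n" by (intro two_power_bits_le) simp
  moreover have "l < 2 ^ l" by simp
  ultimately show ?thesis using Suc by linarith
qed simp

lemma bits_two_power_mult: "0 < s \<Longrightarrow> bits (2 ^ z * s) = replicate z False @ bits s"
proof (induction z)
  case (Suc z)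
  then have "bits (2 * (2 ^ z * s)) = False # replicate z False @ bits s"
    by (subst bits.simps) simp
  then show ?case by (simp add: mult.assoc)
qed simp

text \<open>Reads the bits from the least significant one and keeps the value read so far together
  with the next power of two.\<close>

lemma poly_time_un_of_binary:
  assumes "poly_time D \<mu> inp (\<lambda>a. nat_data (n a))" "poly_bounded D \<mu> n"
  shows "poly_time D \<mu> inp (\<lambda>a. un (n a))"
proof -
  let ?L = "\<lambda>a. bits (n a)"
  have len: "poly_bounded D \<mu> (\<lambda>a. length (?L a))"
    by (rule poly_bounded_mono[OF assms(2)]) (rule length_bits_le)
  have "poly_time D \<mu> inp (\<lambda>a. Pair (un (n a mod 2 ^ length (?L a))) (un (2 ^ length (?L a))))"
  proof (rule poly_time_fold_map[where e = "\<lambda>_. bool_data" and acc = "\<lambda>a i. Pair (un (n a mod 2 ^ i)) (un (2 ^ i))", OF _ _ len])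
    show "poly_time D \<mu> inp (\<lambda>a. list_data (map bool_data (?L a)))"
      using assms by (simp add: nat_data_bits)
    show "poly_time D \<mu> inp (\<lambda>a. Pair (un (n a mod 2 ^ 0)) (un (2 ^ 0)))"
      by (simp add: poly_time_const)
    let ?D = "{z. fst z \<in> D \<and> snd z < length (?L (fst z))}"
    let ?i = "\<lambda>z. Pair (bool_data (?L (fst z) ! snd z)) (Pair (Pair (un (n (fst z) mod 2 ^ snd z)) (un (2 ^ snd z))) (inp (fst z)))"
    \<comment> \<open>While a bit is left, \<open>2 ^ i\<close> is at most the number itself, so the
      unary power never grows beyond a polynomial.\<close>
    have pb: "poly_bounded ?D (\<lambda>z. \<mu> (fst z)) (\<lambda>z. 2 ^ snd z)"
      by (rule poly_bounded_mono[where g = "\<lambda>z. n (fst z)"])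
        (use assms(2) two_power_bits_le in \<open>auto simp: poly_bounded_def\<close>)
    have val: "poly_time ?D (\<lambda>z. \<mu> (fst z)) ?i (\<lambda>z. un (n (fst z) mod 2 ^ snd z))"
      using poly_time_left[OF poly_time_loop_acc] by (rule poly_time_cong) simp
    have pow: "poly_time ?D (\<lambda>z. \<mu> (fst z)) ?i (\<lambda>z. un (2 ^ snd z))"
      using poly_time_right[OF poly_time_loop_acc] by (rule poly_time_cong) simp
    have "(if odd (m div 2 ^ i) then 2 ^ i + m mod 2 ^ i else m mod 2 ^ i) = m mod (2 ^ i * 2)" for m i :: nat
      by (auto simp: mod_mult2_eq mod2_eq_if)
    then show "poly_time ?D (\<lambda>z. \<mu> (fst z)) ?i (\<lambda>z. Pair (un (n (fst z) mod 2 ^ Suc (snd z))) (un (2 ^ Suc (snd z))))"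
      by (intro poly_time_cong[OF poly_time_pair[OF
          poly_time_if_simple[OF poly_time_elem poly_time_un_add[OF pow val pb] val]
          poly_time_un_add[OF pow pow pb]]])
        (auto simp: nth_bits mult.commute mult_2 simp del: un_Suc simp flip: if_distrib[of un])
  qed
  from poly_time_left[OF this] show ?thesis by (simp add: less_two_power_bits)
qed

definition inc_step :: "nat \<times> nat \<Rightarrow> nat \<times> nat" where
  "inc_step p = (if odd (snd p) then (Suc (fst p), snd p div 2) else p)"

text \<open>Incrementing turns the trailing ones \<open>z\<close> of a binary number into zeros; \<open>inc_step\<close> moves
  them one by one from the number to a counter.\<close>

lemma inc_steps:
  defines "s \<equiv> \<lambda>n i. (inc_step ^^ i) (0, n)"
  shows "2 ^ fst (s n i) * Suc (snd (s n i)) = Suc n" (is ?A)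
    and "even (snd (s n i)) \<or> fst (s n i) = i" (is ?B)
proof -
  have "?A \<and> ?B"
  proof (induction i)
    case (Suc i)
    have half: "2 * Suc (r div 2) = Suc r" if "odd r" for r :: nat using that by (auto elim: oddE)
    have "2 ^ Suc z * Suc (r div 2) = 2 ^ z * (2 * Suc (r div 2))" for z r :: nat
      by (simp only: power_Suc mult.assoc mult.left_commute)
    then have *: "2 ^ Suc z * Suc (r div 2) = 2 ^ z * Suc r" if "odd r" for z r :: nat
      using half[OF that] by metis
    show ?case using Suc *[of "snd (s n i)" "fst (s n i)"]
      by (cases "odd (snd (s n i))") (simp_all add: s_def inc_step_def del: power_Suc mult_Suc_right)
  qed (simp add: s_def)
  then show ?A ?B by blast+
qed

lemma poly_time_binary_Suc:
  assumes "poly_time D \<mu> inp (\<lambda>a. nat_data (n a))" "poly_bounded D \<mu> n"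
  shows "poly_time D \<mu> inp (\<lambda>a. nat_data (Suc (n a)))"
proof -
  let ?L = "\<lambda>a. bits (n a)"
  let ?s = "\<lambda>a i. (inc_step ^^ i) (0, n a)"
  let ?acc = "\<lambda>a i. Pair (un (fst (?s a i))) (nat_data (snd (?s a i)))"
  have len: "poly_bounded D \<mu> (\<lambda>a. length (?L a))"
    by (rule poly_bounded_mono[OF assms(2)]) (rule length_bits_le)
  have fold: "poly_time D \<mu> inp (\<lambda>a. ?acc a (length (?L a)))"
  proof (rule poly_time_fold_map[where e = "\<lambda>_. bool_data" and acc = ?acc, OF _ _ len])
    show "poly_time D \<mu> inp (\<lambda>a. list_data (map bool_data (?L a)))"
      using assms by (simp add: nat_data_bits)
    show "poly_time D \<mu> inp (\<lambda>a. ?acc a 0)"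
      by (simp add: poly_time_const poly_time_pair assms)
    let ?D = "{z. fst z \<in> D \<and> snd z < length (?L (fst z))}"
    let ?i = "\<lambda>z. Pair (bool_data (?L (fst z) ! snd z)) (Pair (?acc (fst z) (snd z)) (inp (fst z)))"
    have A: "poly_time ?D (\<lambda>z. \<mu> (fst z)) ?i (\<lambda>z. un (fst (?s (fst z) (snd z))))"
      using poly_time_left[OF poly_time_loop_acc] by (rule poly_time_cong) simp
    have B: "poly_time ?D (\<lambda>z. \<mu> (fst z)) ?i (\<lambda>z. nat_data (snd (?s (fst z) (snd z))))"
      using poly_time_right[OF poly_time_loop_acc] by (rule poly_time_cong) simp
    show "poly_time ?D (\<lambda>z. \<mu> (fst z)) ?i (\<lambda>z. ?acc (fst z) (Suc (snd z)))"
      by (rule poly_time_cong[OF poly_time_if[OF poly_time_left[OF B]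
          poly_time_pair[OF poly_time_un_Suc[OF poly_time_subset[OF A]] poly_time_right[OF poly_time_subset[OF B]]]
          poly_time_subset[OF poly_time_loop_acc]]])
        (auto simp: left_nat_data right_nat_data inc_step_def bool_data_def)
  qed
  let ?z = "\<lambda>a. fst (?s a (length (?L a)))" and ?r = "\<lambda>a. snd (?s a (length (?L a)))"
  \<comment> \<open>If the rest were still odd, every round would have moved a one, and
    \<open>n a + 1\<close> would be at least twice \<open>2 ^ length (bits (n a))\<close>, which is
    too large.\<close>
  have even: "even (?r a)" for a
  proof (rule ccontr)
    assume "odd (?r a)"
    then have z: "?z a = length (?L a)" using inc_steps(2) by blast
    have "2 ^ length (?L a) * Suc (?r a) = Suc (n a)" using inc_steps(1)[of "length (?L a)" "n a"] z by simp
    moreover have "2 ^ length (?L a) * 2 \<le> 2 ^ length (?L a) * Suc (?r a)"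
      using \<open>odd (?r a)\<close> by (intro mult_left_mono) (auto elim: oddE)
    moreover have "n a < 2 ^ length (?L a)" by (rule less_two_power_bits)
    ultimately show False by linarith
  qed
  \<comment> \<open>\<open>2 ^ ?z a\<close> divides \<open>n a + 1\<close>.\<close>
  have "poly_bounded D \<mu> ?z"
  proof (rule poly_bounded_mono)
    show "poly_bounded D \<mu> (\<lambda>a. n a + 1)" by (intro poly_bounded_add assms poly_bounded_const)
    fix a
    have "?z a < 2 ^ ?z a" by simp
    also have "\<dots> \<le> 2 ^ ?z a * Suc (?r a)" by simp
    also have "\<dots> = n a + 1" using inc_steps(1) by simp
    finally show "?z a \<le> n a + 1" by simp
  qed
  moreover have "poly_time D \<mu> inp (\<lambda>a. list_data (replicate (?z a) Atom))"
    using poly_time_left[OF fold] by (simp add: un_def)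
  moreover have "poly_time D \<mu> inp (\<lambda>a. list_data (bool_data True # map bool_data (bits (?r a div 2))))"
    using poly_time_pair[OF poly_time_const[where d = "bool_data True"] poly_time_right[OF poly_time_right[OF fold]]]
    by (simp add: right_nat_data flip: nat_data_bits)
  ultimately have "poly_time D \<mu> inp (\<lambda>a. list_data (replicate (?z a) Atom @ bool_data True # map bool_data (bits (?r a div 2))))"
    by (intro poly_time_append) simp_all
  then show ?thesis
  proof (rule poly_time_cong)
    fix a
    have "bits (Suc (?r a)) = True # bits (?r a div 2)" using even[of a] by (simp add: bits.simps[of "Suc _"])
    then have "bits (Suc (n a)) = replicate (?z a) False @ True # bits (?r a div 2)"
      using bits_two_power_mult[of "Suc (?r a)" "?z a"] inc_steps(1)[of "length (?L a)" "n a"] by simp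
    then show "list_data (replicate (?z a) Atom @ bool_data True # map bool_data (bits (?r a div 2))) = nat_data (Suc (n a))"
      by (simp add: nat_data_bits bool_data_def)
  qed
qed

text \<open>Counts upwards with the binary successor. The BNSL input names nodes in binary, while
  the programs compute the names in unary.\<close>

lemma poly_time_binary_of_un:
  assumes "poly_time D \<mu> inp (\<lambda>a. un (n a))" "poly_bounded D \<mu> n"
  shows "poly_time D \<mu> inp (\<lambda>a. nat_data (n a))"
proof -
  have "poly_time D \<mu> inp (\<lambda>a. nat_data (length (replicate (n a) Atom)))"
  proof (rule poly_time_fold_map[OF poly_time_un_list[OF assms(1)], where acc = "\<lambda>_. nat_data"])
    let ?D = "{z. fst z \<in> D \<and> snd z < length (replicate (n (fst z)) Atom)}"
    have "poly_bounded ?D (\<lambda>z. \<mu> (fst z)) snd"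
      by (rule poly_bounded_mono[where g = "\<lambda>z. n (fst z)"]) (use assms(2) in \<open>auto simp: poly_bounded_def\<close>)
    then show "poly_time ?D (\<lambda>z. \<mu> (fst z)) (\<lambda>z. Pair Atom (Pair (nat_data (snd z)) (inp (fst z)))) (\<lambda>z. nat_data (Suc (snd z)))"
      by (intro poly_time_binary_Suc poly_time_loop_acc)
  qed (simp_all add: assms poly_time_const)
  then show ?thesis by simp
qed

section \<open>The gadget\<close>

lemma score_eq:
  assumes "\<And>i. i < n \<Longrightarrow> parents A i \<in> C i"
  shows "score n C s A = ereal (real_of_rat (\<Sum>i<n. s i (parents A i)))"
proof -
  have "score n C s A = (\<Sum>i<n. ereal (real_of_rat (s i (parents A i))))"
    unfolding score_def by (rule sum.cong) (simp_all add: local_score_def assms)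
  then show ?thesis by (simp add: of_rat_sum)
qed

text \<open>In \<open>ereal\<close> a summand \<infinity> would absorb the -\<infinity>, so the
  other local scores must be seen to differ from \<infinity>.\<close>

lemma score_eq_MInfty:
  assumes "i < n" "parents A i \<notin> C i"
  shows "score n C s A = -\<infinity>"
  unfolding score_def
proof -
  have "local_score C s j P \<noteq> \<infinity>" for j P by (simp add: local_score_def)
  then have "(\<Sum>j\<in>{..<n} - {i}. local_score C s j (parents A j)) \<noteq> \<infinity>" by (simp add: sum_Pinfty)
  then show "(\<Sum>j<n. local_score C s j (parents A j)) = -\<infinity>"
    using assms by (simp add: sum.remove[of "{..<n}" i] local_score_def)
qed

lemma acyclic_by_rank:
  fixes r :: "'a \<Rightarrow> nat"
  assumes "\<And>x y. (x, y) \<in> A \<Longrightarrow> r x < r y"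
  shows "acyclic A"
  by (rule acyclic_subset[OF wf_acyclic[OF wf_measure[of r]]]) (use assms in auto)

text \<open>Every conflict in the gadget is between two nodes that would be parents of each other,
  so this is all that is drawn from the acyclicity of an optimal DAG.\<close>

lemma acyclic_no_2_cycle: "acyclic A \<Longrightarrow> (x, y) \<in> A \<Longrightarrow> (y, x) \<notin> A"
  unfolding acyclic_def by (meson r_into_trancl trancl_into_trancl)

text \<open>The combinatorial core without formulas: \<open>g\<close> groups with blocks of
  \<open>2 * h\<close> nodes, \<open>Q\<close> assignments per group, \<open>t\<close> checkers and
  \<open>p\<close> padding nodes. \<open>nd j c\<close> is the codeword of assignment
  \<open>c\<close> to group \<open>j\<close>, \<open>T l\<close> the set of groups seen by checker
  \<open>l\<close>, and \<open>good l\<close> its acceptance condition, which may depend only on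
  these groups.\<close>

locale gadget =
  fixes g h Q t p :: nat and nd :: "nat \<Rightarrow> nat \<Rightarrow> nat set" and T :: "nat \<Rightarrow> nat set"
    and good :: "nat \<Rightarrow> (nat \<Rightarrow> nat) \<Rightarrow> bool"
  assumes Q: "0 < Q" and t: "0 < t"
    and nd: "\<And>j c. j < g \<Longrightarrow> c < Q \<Longrightarrow> nd j c \<subseteq> {j * (2 * h)..<j * (2 * h) + 2 * h} \<and> card (nd j c) = h"
    and nd_inj: "\<And>j c c'. j < g \<Longrightarrow> c < Q \<Longrightarrow> c' < Q \<Longrightarrow> nd j c = nd j c' \<Longrightarrow> c = c'"
    and T: "\<And>l. l < t \<Longrightarrow> T l \<subseteq> {..<g}"
    and T_cover: "\<And>j. j < g \<Longrightarrow> \<exists>l<t. j \<in> T l"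
    and good_cong: "\<And>l \<sigma> \<tau>. l < t \<Longrightarrow> (\<And>j. j \<in> T l \<Longrightarrow> \<sigma> j = \<tau> j) \<Longrightarrow> good l \<sigma> = good l \<tau>"
begin

text \<open>Node layout: \<open>0\<close>, then the \<open>g\<close> blocks, the checkers, and the
  padding. Codewords count positions from the first block; the \<open>Suc\<close> in
  \<open>J\<close> skips node \<open>0\<close>.\<close>

definition first_checker :: nat where "first_checker = 1 + g * (2 * h)"
definition nodes :: nat where "nodes = first_checker + t + p"
definition U :: "nat set" where "U = {first_checker..<first_checker + t}"
definition J :: "nat \<Rightarrow> (nat \<Rightarrow> nat) \<Rightarrow> nat set" where "J l \<sigma> = Suc ` (\<Union>j\<in>T l. nd j (\<sigma> j))"
definition valid :: "nat \<Rightarrow> (nat \<Rightarrow> nat) \<Rightarrow> bool" where "valid l \<sigma> \<longleftrightarrow> (\<forall>j\<in>T l. \<sigma> j < Q)"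

definition C :: "nat \<Rightarrow> nat set set" where
  "C i = (if i < first_checker then {{}, U}
     else if i < first_checker + t then
       J (i - first_checker) ` {\<sigma>. valid (i - first_checker) \<sigma> \<and> good (i - first_checker) \<sigma>} \<union>
       (insert 0 \<circ> J (i - first_checker)) ` {\<sigma>. valid (i - first_checker) \<sigma>}
     else {{}})"

definition sc :: "nat \<Rightarrow> nat set \<Rightarrow> rat" where
  "sc i P = (if i = 0 then (if P = {} then 0 else 1)
     else if i < first_checker then (if P = {} then -1 else 1) else 0)"

lemma U_nonempty: "U \<noteq> {}"
  using t by (simp add: U_def)

lemma J_subset: "l < t \<Longrightarrow> valid l \<sigma> \<Longrightarrow> J l \<sigma> \<subseteq> {1..<first_checker}"
proof -
  assume l: "l < t" "valid l \<sigma>"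
  have "nd j (\<sigma> j) \<subseteq> {..<g * (2 * h)}" if "j \<in> T l" for j
  proof -
    have j: "j < g" "\<sigma> j < Q" using that l T by (auto simp: valid_def)
    then have "(j + 1) * (2 * h) \<le> g * (2 * h)" by (intro mult_right_mono) auto
    then have "j * (2 * h) + 2 * h \<le> g * (2 * h)" by (simp add: algebra_simps)
    then show ?thesis using nd[OF j] by fastforce
  qed
  then show ?thesis by (fastforce simp: J_def first_checker_def)
qed

lemma bnsl_instance: "bnsl_instance nodes C"
  unfolding bnsl_instance_def
proof (intro allI impI subsetI)
  fix i P assume i: "i < nodes" and P: "P \<in> C i"
  consider "i < first_checker" | l where "l < t" "i = first_checker + l" | "first_checker + t \<le> i"
    by (metis le_add_diff_inverse linorder_not_less nat_add_left_cancel_less)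
  then show "P \<in> Pow ({..<nodes} - {i})"
  proof cases
    case 2
    then obtain \<sigma> where "valid l \<sigma>" "P \<subseteq> insert 0 (J l \<sigma>)"
      using P by (auto simp: C_def split: if_splits)
    then show ?thesis using J_subset[OF \<open>l < t\<close>, of \<sigma>] 2 by (fastforce simp: nodes_def first_checker_def)
  qed (use P in \<open>auto simp: C_def U_def nodes_def\<close>)
qed

text \<open>Each block has \<open>2 h\<close> nodes and each of them contributes \<open>-1\<close> or \<open>1\<close>, so the score is zero on
  a block where exactly \<open>h\<close> nodes have no parents.\<close>

lemma sum_sc:
  "(\<Sum>i<nodes. sc i (P i)) = (if P 0 = {} then 0 else 1) +
     (\<Sum>j<g. 2 * of_nat h - 2 * of_nat (card {i\<in>{j * (2 * h)..<j * (2 * h) + 2 * h}. P (Suc i) = {}}))"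
proof -
  have "(\<Sum>i<nodes. sc i (P i)) = (\<Sum>i<first_checker. sc i (P i))"
    by (rule sum.mono_neutral_right) (auto simp: sc_def nodes_def first_checker_def)
  also have "\<dots> = sc 0 (P 0) + (\<Sum>i<g * (2 * h). sc (Suc i) (P (Suc i)))"
    by (simp add: first_checker_def sum.lessThan_Suc_shift del: sum.lessThan_Suc)
  also have "(\<Sum>i<g * (2 * h). sc (Suc i) (P (Suc i))) = (\<Sum>i<g * (2 * h). if P (Suc i) = {} then -1 else 1)"
    by (rule sum.cong) (auto simp: sc_def first_checker_def)
  also have "\<dots> = (\<Sum>j<g. \<Sum>i\<in>{j * (2 * h)..<j * (2 * h) + 2 * h}. if P (Suc i) = {} then -1 else 1)"
    by (rule sum.nat_group[symmetric])
  also have "\<dots> = (\<Sum>j<g. 2 * of_nat h - 2 * of_nat (card {i\<in>{j * (2 * h)..<j * (2 * h) + 2 * h}. P (Suc i) = {}}))"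
  proof (rule sum.cong)
    fix j
    let ?B = "{j * (2 * h)..<j * (2 * h) + 2 * h}"
    have "(\<Sum>i\<in>?B. if P (Suc i) = {} then -1 else 1 :: rat) = (\<Sum>i\<in>?B. 1 - 2 * (if P (Suc i) = {} then 1 else 0))"
      by (rule sum.cong) auto
    also have "\<dots> = of_nat (card ?B) - 2 * (\<Sum>i\<in>?B. if P (Suc i) = {} then 1 else 0)"
      by (simp add: sum_subtractf flip: sum_distrib_left)
    also have "(\<Sum>i\<in>?B. if P (Suc i) = {} then 1 else 0 :: rat) = of_nat (card {i\<in>?B. P (Suc i) = {}})"
      by (simp add: sum.If_cases Int_def conj_commute)
    finally show "(\<Sum>i\<in>?B. if P (Suc i) = {} then -1 else 1 :: rat) =
        2 * of_nat h - 2 * of_nat (card {i\<in>?B. P (Suc i) = {}})" by simp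
  qed simp
  finally show ?thesis by (simp add: sc_def first_checker_def)
qed

text \<open>\<open>w\<close> says whether node \<open>0\<close> takes the checkers as parents.
  Without it no acceptance is required, so this also provides the feasible DAG of score 0 that
  exists in every instance.\<close>

lemma exists_dag:
  assumes \<sigma>: "\<And>j. j < g \<Longrightarrow> \<sigma> j < Q" and w: "w \<Longrightarrow> (\<And>l. l < t \<Longrightarrow> good l \<sigma>)"
  shows "\<exists>A. dag nodes A \<and> score nodes C sc A = ereal (if w then 1 else 0)"
proof -
  define D where "D = (\<Union>j<g. nd j (\<sigma> j))"
  define P where "P i = (if i = 0 then (if w then U else {}) else if i < first_checker then
      (if i - 1 \<in> D then {} else U)
     else if i < first_checker + t then (if w then J (i - first_checker) \<sigma> else insert 0 (J (i - first_checker) \<sigma>))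
     else {})" for i
  \<comment> \<open>A topological order in three levels: the selected group nodes at level 0, the
    checkers at level 1, the other group nodes at level 2. Node \<open>0\<close> is first if it is a
    parent of the checkers and last if it is their child.\<close>
  define r where "r i = (if i = 0 then (if w then 2 else 0) else if i < first_checker then
      (if i - 1 \<in> D then 0 else 2) else if i < first_checker + t then 1 else (0::nat))" for i
  define A where "A = {(j, i). i < nodes \<and> j \<in> P i}"
  have valid: "valid l \<sigma>" if "l < t" for l using T[OF that] \<sigma> by (auto simp: valid_def)
  have JD: "J l \<sigma> \<subseteq> Suc ` D" if "l < t" for l using T[OF that] by (auto simp: J_def D_def)
  have PC: "P i \<in> C i" if "i < nodes" for i
  proof (cases "first_checker \<le> i \<and> i < first_checker + t")
    case True
    then have "i - first_checker < t" by auto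
    with w[OF _ this] valid[OF this] True show ?thesis
      by (cases w) (auto simp: P_def C_def first_checker_def)
  qed (auto simp: P_def C_def first_checker_def)
  have rank: "r j < r i" if "i < nodes" "j \<in> P i" for i j
  proof (cases "first_checker \<le> i \<and> i < first_checker + t")
    case True
    then have l: "i - first_checker < t" by auto
    have "j \<in> J (i - first_checker) \<sigma> \<or> (\<not> w \<and> j = 0)" using True that by (auto simp: P_def first_checker_def split: if_splits)
    then have "r j = 0"
    proof
      assume j: "j \<in> J (i - first_checker) \<sigma>"
      then have "j - 1 \<in> D" "j \<in> {1..<first_checker}" using JD[OF l] J_subset[OF l valid[OF l]] by auto
      then show ?thesis by (auto simp: r_def)
    qed (auto simp: r_def)
    then show ?thesis using True by (auto simp: r_def first_checker_def)
  next
    case False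
    then show ?thesis using that by (auto simp: P_def r_def U_def first_checker_def split: if_splits)
  qed
  have "dag nodes A"
  proof -
    have "A \<subseteq> {..<nodes} \<times> {..<nodes}"
      using bnsl_instance PC unfolding bnsl_instance_def A_def by blast
    moreover have "acyclic A" by (rule acyclic_by_rank[of A r]) (auto simp: A_def rank)
    ultimately show ?thesis by (simp add: dag_def)
  qed
  moreover have "score nodes C sc A = ereal (if w then 1 else 0)"
  proof -
    have par: "parents A i = P i" if "i < nodes" for i using that by (auto simp: parents_def A_def)
    have "card {i\<in>{j * (2 * h)..<j * (2 * h) + 2 * h}. P (Suc i) = {}} = h" if j: "j < g" for j
    proof -
      have "{i\<in>{j * (2 * h)..<j * (2 * h) + 2 * h}. P (Suc i) = {}} = {i\<in>{j * (2 * h)..<j * (2 * h) + 2 * h}. i \<in> D}"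
      proof -
        have "(j + 1) * (2 * h) \<le> g * (2 * h)" using j by (intro mult_right_mono) auto
        then have "i < g * (2 * h)" if "i < j * (2 * h) + 2 * h" for i using that by (simp add: algebra_simps)
        then have "P (Suc i) = {} \<longleftrightarrow> i \<in> D" if "i < j * (2 * h) + 2 * h" for i
          using that U_nonempty by (simp add: P_def first_checker_def)
        then show ?thesis by auto
      qed
      also have "\<dots> = nd j (\<sigma> j)"
      proof
        show "nd j (\<sigma> j) \<subseteq> {i\<in>{j * (2 * h)..<j * (2 * h) + 2 * h}. i \<in> D}"
          using nd[OF j \<sigma>[OF j]] j by (auto simp: D_def)
        \<comment> \<open>Blocks are disjoint: division by \<open>2 * h\<close> recovers the group,
          so no other codeword contributes to this block.\<close>
        have "j' = j" if "i \<in> {j * (2 * h)..<j * (2 * h) + 2 * h}" "i \<in> nd j' (\<sigma> j')" "j' < g" for i j'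
        proof -
          have "i \<in> {j' * (2 * h)..<j' * (2 * h) + 2 * h}" using nd[OF that(3) \<sigma>[OF that(3)]] that(2) by blast
          then have "i div (2 * h) = j'" by (intro div_nat_eqI) (auto simp: algebra_simps)
          moreover have "i div (2 * h) = j" using that(1) by (intro div_nat_eqI) (auto simp: algebra_simps)
          ultimately show ?thesis by simp
        qed
        then show "{i\<in>{j * (2 * h)..<j * (2 * h) + 2 * h}. i \<in> D} \<subseteq> nd j (\<sigma> j)"
          unfolding D_def by blast
      qed
      finally show ?thesis using nd[OF j \<sigma>[OF j]] by simp
    qed
    then have "(\<Sum>i<nodes. sc i (P i)) = (if P 0 = {} then 0 else 1)" by (subst sum_sc) simp
    also have "\<dots> = (if w then 1 else 0)" using U_nonempty by (simp add: P_def)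
    finally have "(\<Sum>i<nodes. sc i (parents A i)) = (if w then 1 else 0)" by (simp add: par)
    then show ?thesis using PC par by (subst score_eq) auto
  qed
  ultimately show ?thesis by blast
qed

text \<open>The score of an optimal DAG is the gain at node \<open>0\<close> minus
  \<open>2 * e\<close>, where \<open>e\<close> counts the parentless group nodes in excess of
  \<open>h\<close> per block. Score 0 is always available, so the gain of 1 cannot coexist with
  \<open>e > 0\<close>. An assignment accepted by all checkers offers score 1, which is out of reach
  without the gain.\<close>

lemma optimal_dag_parents_0:
  assumes opt: "optimal_dag nodes C sc A"
  shows "parents A 0 \<noteq> {} \<longleftrightarrow> (\<exists>\<sigma>. (\<forall>j<g. \<sigma> j < Q) \<and> (\<forall>l<t. good l \<sigma>))"
proof -
  have "dag nodes A" using opt by (simp add: optimal_dag_def)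
  then have acyc: "acyclic A" by (simp add: dag_def)
  \<comment> \<open>Any assignment will do here; the point is that the optimum is not -\<infinity>,
    so \<open>A\<close> uses only listed parent sets.\<close>
  obtain A0 where "dag nodes A0" "score nodes C sc A0 = 0"
    using exists_dag[of "\<lambda>_. 0" False] Q by (auto simp: zero_ereal_def)
  then have nonneg: "0 \<le> score nodes C sc A" using opt by (metis optimal_dag_def)
  have PC: "parents A i \<in> C i" if "i < nodes" for i
  proof (rule ccontr)
    assume "parents A i \<notin> C i"
    with score_eq_MInfty[of i nodes A C sc] that nonneg show False by simp
  qed
  define B where "B j = {i\<in>{j * (2 * h)..<j * (2 * h) + 2 * h}. parents A (Suc i) = {}}" for j
  have \<sigma>: "\<exists>\<sigma>. valid l \<sigma> \<and> J l \<sigma> \<subseteq> parents A (first_checker + l) \<and> (parents A 0 \<noteq> {} \<longrightarrow> good l \<sigma>)"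
    if l: "l < t" for l
  proof -
    have "parents A (first_checker + l) \<in> C (first_checker + l)" using l by (intro PC) (simp add: nodes_def)
    then consider \<sigma> where "valid l \<sigma>" "good l \<sigma>" "parents A (first_checker + l) = J l \<sigma>" |
      \<sigma> where "valid l \<sigma>" "parents A (first_checker + l) = insert 0 (J l \<sigma>)"
      using l by (auto simp: C_def)
    then show ?thesis
    proof cases
      case 2
      \<comment> \<open>Once node \<open>0\<close> has parents they are all of \<open>U\<close>,
        including this checker, which in turn has \<open>0\<close> as a parent.\<close>
      have "parents A 0 = {}"
      proof (rule ccontr)
        assume "parents A 0 \<noteq> {}"
        then have "parents A 0 = U" using PC[of 0] by (auto simp: C_def nodes_def first_checker_def)
        then have "first_checker + l \<in> parents A 0" using l by (simp add: U_def)
        then have "(first_checker + l, 0) \<in> A" by (simp add: parents_def)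
        moreover have "(0, first_checker + l) \<in> A" using 2 by (auto simp: parents_def)
        ultimately show False using acyclic_no_2_cycle[OF acyc] by blast
      qed
      then show ?thesis using 2 by auto
    qed auto
  qed
  define \<sigma> where "\<sigma> l = (SOME \<sigma>. valid l \<sigma> \<and> J l \<sigma> \<subseteq> parents A (first_checker + l) \<and> (parents A 0 \<noteq> {} \<longrightarrow> good l \<sigma>))" for l
  have "valid l (\<sigma> l) \<and> J l (\<sigma> l) \<subseteq> parents A (first_checker + l) \<and> (parents A 0 \<noteq> {} \<longrightarrow> good l (\<sigma> l))"
    if "l < t" for l unfolding \<sigma>_def by (rule someI_ex[OF \<sigma>[OF that]])
  then have \<sigma>: "valid l (\<sigma> l)" "J l (\<sigma> l) \<subseteq> parents A (first_checker + l)"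
    "parents A 0 \<noteq> {} \<Longrightarrow> good l (\<sigma> l)" if "l < t" for l using that by blast+
  have sub: "nd j (\<sigma> l j) \<subseteq> B j" if l: "l < t" and j: "j \<in> T l" for l j
  proof
    fix i assume i: "i \<in> nd j (\<sigma> l j)"
    have jg: "j < g" "\<sigma> l j < Q" using T[OF l] j \<sigma>(1)[OF l] by (auto simp: valid_def)
    have "Suc i \<in> J l (\<sigma> l)" using i j by (auto simp: J_def)
    then have 1: "(Suc i, first_checker + l) \<in> A" and i': "Suc i < first_checker"
      using \<sigma>(2)[OF l] J_subset[OF l \<sigma>(1)[OF l]] by (auto simp: parents_def)
    \<comment> \<open>A selected node with parents would have this checker among them, again a cycle
      of length 2.\<close>
    have "parents A (Suc i) = {}"
    proof (rule ccontr)
      assume "parents A (Suc i) \<noteq> {}"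
      then have "parents A (Suc i) = U" using PC[of "Suc i"] i' by (auto simp: C_def nodes_def)
      then have "first_checker + l \<in> parents A (Suc i)" using l by (simp add: U_def)
      then have "(first_checker + l, Suc i) \<in> A" by (simp add: parents_def)
      with 1 show False using acyclic_no_2_cycle[OF acyc] by blast
    qed
    then show "i \<in> B j" using nd[OF jg] i by (auto simp: B_def)
  qed
  have fin: "finite (B j)" for j by (simp add: B_def)
  have ge: "h \<le> card (B j)" if j: "j < g" for j
  proof -
    obtain l where l: "l < t" "j \<in> T l" using T_cover[OF j] by blast
    then have "\<sigma> l j < Q" using \<sigma>(1) by (auto simp: valid_def)
    then show ?thesis using card_mono[OF fin sub[OF l]] nd[OF j] by simp
  qed
  \<comment> \<open>The truncated subtraction is harmless because of \<open>ge\<close>.\<close>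
  define e where "e = (\<Sum>j<g. card (B j) - h)"
  have "(\<Sum>i<nodes. sc i (parents A i)) = (if parents A 0 = {} then 0 else 1) - 2 * of_nat e"
  proof -
    have "(\<Sum>j<g. 2 * of_nat h - 2 * of_nat (card (B j)) :: rat) = (\<Sum>j<g. - 2 * of_nat (card (B j) - h))"
      by (rule sum.cong) (simp_all add: of_nat_diff ge)
    moreover have "(\<Sum>i<nodes. sc i (parents A i)) = (if parents A 0 = {} then 0 else 1) +
        (\<Sum>j<g. 2 * of_nat h - 2 * of_nat (card (B j)))" by (simp only: sum_sc B_def)
    ultimately show ?thesis by (simp add: e_def sum_distrib_left sum_negf)
  qed
  then have score: "score nodes C sc A = ereal ((if parents A 0 = {} then 0 else 1) - 2 * real e)"
    by (subst score_eq) (auto simp: PC of_rat_diff of_rat_mult)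
  show ?thesis
  proof
    assume ne: "parents A 0 \<noteq> {}"
    with score nonneg have "e = 0" by (auto simp: zero_ereal_def)
    then have "card (B j) = h" if "j < g" for j using ge[OF that] that by (auto simp: e_def intro: antisym)
    \<comment> \<open>A codeword of size \<open>h\<close> inside a set of size \<open>h\<close>
      fills it, so all checkers that see group \<open>j\<close> have chosen the same
      codeword.\<close>
    then have eq: "nd j (\<sigma> l j) = B j" if "l < t" "j \<in> T l" for l j
      using sub[OF that] nd[of j "\<sigma> l j"] T[OF that(1)] \<sigma>(1)[OF that(1)] that(2)
      by (intro card_subset_eq[OF fin]) (auto simp: valid_def)
    \<comment> \<open>The global assignment is read off from one arbitrary checker per group; by
      \<open>eq\<close> and injectivity of the code the choice does not matter.\<close>
    obtain k where k: "\<And>j. j < g \<Longrightarrow> k j < t \<and> j \<in> T (k j)" using T_cover by metis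
    define \<tau> where "\<tau> j = \<sigma> (k j) j" for j
    have \<tau>: "\<tau> j < Q" if "j < g" for j using k[OF that] \<sigma>(1) by (auto simp: valid_def \<tau>_def)
    moreover have "good l \<tau>" if l: "l < t" for l
    proof -
      have "\<tau> j = \<sigma> l j" if j: "j \<in> T l" for j
      proof (rule nd_inj)
        show "j < g" using j T[OF l] by auto
        then show "\<tau> j < Q" "nd j (\<tau> j) = nd j (\<sigma> l j)" using \<tau> k eq l j by (auto simp: \<tau>_def)
        show "\<sigma> l j < Q" using \<sigma>(1)[OF l] j by (auto simp: valid_def)
      qed
      then show ?thesis using \<sigma>(3)[OF l ne] good_cong[OF l] by blast
    qed
    ultimately show "\<exists>\<sigma>. (\<forall>j<g. \<sigma> j < Q) \<and> (\<forall>l<t. good l \<sigma>)" by blast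
  next
    assume "\<exists>\<sigma>. (\<forall>j<g. \<sigma> j < Q) \<and> (\<forall>l<t. good l \<sigma>)"
    then obtain \<sigma> where "\<And>j. j < g \<Longrightarrow> \<sigma> j < Q" "\<And>l. l < t \<Longrightarrow> good l \<sigma>" by blast
    then obtain A1 where "dag nodes A1" "score nodes C sc A1 = 1"
      using exists_dag[of \<sigma> True] by (auto simp: one_ereal_def)
    then have "1 \<le> score nodes C sc A" using opt by (metis optimal_dag_def)
    with score show "parents A 0 \<noteq> {}" by (auto simp: one_ereal_def)
  qed
qed

end

section \<open>The reduction\<close>

fun bitstrings :: "nat \<Rightarrow> bool list list" where
  "bitstrings 0 = [[]]"
| "bitstrings (Suc k) = map ((#) True) (bitstrings k) @ map ((#) False) (bitstrings k)"

lemma set_bitstrings: "set (bitstrings k) = {bs. length bs = k}"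
proof (induction k)
  case (Suc k)
  have "bs \<in> set (bitstrings (Suc k)) \<longleftrightarrow> length bs = Suc k" for bs
    by (cases bs; cases "hd bs") (auto simp: Suc)
  then show ?case by blast
qed auto

lemma distinct_bitstrings: "distinct (bitstrings k)"
  by (induction k) (auto simp: distinct_map)

lemma length_bitstrings [simp]: "length (bitstrings k) = 2 ^ k"
  by (induction k) simp_all

lemma length_filter_bitstrings:
  "length (filter (\<lambda>bs. length (filter id bs) = w) (bitstrings k)) = k choose w"
proof (induction k arbitrary: w)
  case 0
  show ?case by (cases w) auto
next
  case (Suc k)
  have "length (filter (\<lambda>bs. Suc (length (filter id bs)) = w) (bitstrings k)) + (k choose w) = Suc k choose w"
    by (cases w) (simp_all add: Suc)
  then show ?case by (simp add: comp_def Suc[unfolded id_def] id_def)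
qed

text \<open>The bit length is an integer logarithm that a program can read off the binary
  input.\<close>

definition num_groups :: "nat \<Rightarrow> nat" where
  "num_groups n = length (bits n)"

text \<open>This is \<open>n / (2 * num_groups n)\<close> rounded up, written as a count so that a
  filter computes it without division.\<close>

definition half_size :: "nat \<Rightarrow> nat" where
  "half_size n = length (filter (\<lambda>i. i * (2 * num_groups n) < n) [0..<n])"

text \<open>Even, so that the number of assignments is \<open>4 ^ half_size n\<close>, directly
  comparable with a central binomial coefficient.\<close>

definition group_vars :: "nat \<Rightarrow> nat" where
  "group_vars n = 2 * half_size n"

text \<open>The central binomial coefficient for \<open>w\<close> is at least
  \<open>4 ^ w / (2 * w)\<close>. The summand \<open>num_groups n + 2\<close> pays for this
  denominator, since \<open>2 * weight n \<le> 4 ^ (num_groups n + 2)\<close>.\<close>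

definition weight :: "nat \<Rightarrow> nat" where
  "weight n = half_size n + num_groups n + 2"

definition balanced :: "nat \<Rightarrow> bool list list" where
  "balanced n = filter (\<lambda>bs. length (filter id bs) = weight n) (bitstrings (2 * weight n))"

lemma num_groups_eq_0_iff: "num_groups n = 0 \<longleftrightarrow> n = 0"
  by (auto simp: num_groups_def bits.simps[of n])

lemma half_size_card: "half_size n = card {i. i < n \<and> i * (2 * num_groups n) < n}"
  unfolding half_size_def by (subst distinct_card[symmetric]) (auto intro: arg_cong[where f = card])

lemma half_size_ge: "n \<le> half_size n * (2 * num_groups n)"
proof (rule ccontr)
  assume "\<not> n \<le> half_size n * (2 * num_groups n)"
  then have less: "half_size n * (2 * num_groups n) < n" by simp
  have "i < n \<and> i * (2 * num_groups n) < n" if "i \<le> half_size n" for i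
  proof -
    have "i * 1 \<le> i * (2 * num_groups n)"
      using less num_groups_eq_0_iff[of n] by (intro mult_left_mono) auto
    moreover have "i * (2 * num_groups n) \<le> half_size n * (2 * num_groups n)"
      using that by (intro mult_right_mono) auto
    ultimately show ?thesis using less by linarith
  qed
  then have "{..half_size n} \<subseteq> {i. i < n \<and> i * (2 * num_groups n) < n}" by blast
  from card_mono[OF _ this] show False by (simp flip: half_size_card)
qed

lemma half_size_le: "half_size n \<le> n div (2 * num_groups n) + 1"
proof (cases "num_groups n = 0")
  case False
  then have "{i. i < n \<and> i * (2 * num_groups n) < n} \<subseteq> {..n div (2 * num_groups n)}"
    by (auto simp: less_eq_div_iff_mult_less_eq)
  from card_mono[OF _ this] show ?thesis by (simp add: half_size_card)
qed (simp add: half_size_def num_groups_eq_0_iff)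

lemma half_size_le_self: "half_size n \<le> n"
  unfolding half_size_def by (rule order_trans[OF length_filter_le]) simp

lemma num_vars_le: "n \<le> num_groups n * group_vars n"
  using half_size_ge[of n] by (simp add: group_vars_def algebra_simps)

lemma length_balanced_ge: "2 ^ group_vars n \<le> length (balanced n)"
proof -
  let ?w = "weight n" and ?L = "num_groups n"
  have "n < 2 ^ ?L" unfolding num_groups_def by (rule less_two_power_bits)
  then have "half_size n < 2 ^ ?L" using half_size_le_self[of n] by simp
  moreover have "?L < 2 ^ ?L" by simp
  moreover have "1 \<le> (2::nat) ^ ?L" by simp
  ultimately have "2 * (half_size n + ?L + 2) \<le> 8 * 2 ^ ?L" by (simp only: distrib_left)
  then have "2 * ?w \<le> 8 * 2 ^ ?L" by (simp only: weight_def)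
  also have "\<dots> \<le> 16 * 4 ^ ?L" by (intro mult_mono power_mono) auto
  also have "\<dots> = 4 ^ (?L + 2)" by (simp add: power_add)
  finally have "real (2 * ?w) \<le> real (4 ^ (?L + 2))" by (rule of_nat_mono)
  then have w: "2 * real ?w \<le> 4 ^ (?L + 2)" by simp
  have "4 ^ half_size n * (2 * real ?w) \<le> 4 ^ half_size n * 4 ^ (?L + 2)"
    by (intro mult_left_mono w) simp
  also have "\<dots> = 4 ^ ?w" by (simp add: weight_def power_add)
  finally have "4 ^ half_size n \<le> 4 ^ ?w / (2 * real ?w)"
    by (simp add: weight_def pos_le_divide_eq)
  also have "\<dots> \<le> real ((2 * ?w) choose ?w)"
    by (rule central_binomial_lower_bound) (simp add: weight_def)
  finally have "real (4 ^ half_size n) \<le> real ((2 * ?w) choose ?w)" by simp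
  then have "4 ^ half_size n \<le> (2 * ?w) choose ?w" by (simp only: of_nat_le_iff)
  then show ?thesis
    by (simp add: balanced_def length_filter_bitstrings group_vars_def power_mult)
qed

lemma distinct_balanced: "distinct (balanced n)"
  by (simp add: balanced_def distinct_bitstrings)

lemma in_set_balanced: "bs \<in> set (balanced n) \<Longrightarrow> length bs = 2 * weight n \<and> length (filter id bs) = weight n"
  by (simp add: balanced_def set_bitstrings)

text \<open>Group \<open>j\<close> stands for the variables \<open>j * group_vars n + i\<close> and owns the nodes
  \<open>Suc (j * (2 * weight n) + i)\<close>; its assignment number \<open>c\<close> is represented by the balanced
  set of nodes number \<open>c\<close>.  A list of pairs \<open>(j, c)\<close> is an assignment to several groups.\<close>

definition literals :: "nat \<Rightarrow> nat \<Rightarrow> nat \<Rightarrow> (nat \<times> bool) list" where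
  "literals n j c = map (\<lambda>i. (j * group_vars n + i, bitstrings (group_vars n) ! c ! i)) [0..<group_vars n]"

definition codeword :: "nat \<Rightarrow> nat \<Rightarrow> nat \<Rightarrow> nat list" where
  "codeword n j c = map (\<lambda>i. Suc (j * (2 * weight n) + i)) (filter (\<lambda>i. balanced n ! c ! i) [0..<2 * weight n])"

definition sel_literals :: "nat \<Rightarrow> (nat \<times> nat) list \<Rightarrow> (nat \<times> bool) list" where
  "sel_literals n s = concat (map (\<lambda>x. literals n (fst x) (snd x)) s)"

definition sel_nodes :: "nat \<Rightarrow> (nat \<times> nat) list \<Rightarrow> nat list" where
  "sel_nodes n s = concat (map (\<lambda>x. codeword n (fst x) (snd x)) s)"

text \<open>A clause counts as falsified only if the selection contradicts each of its literals; a
  clause with an unassigned variable is left to checkers that see all its groups. The empty clause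
  is always falsified.\<close>

definition consistent :: "nat \<Rightarrow> (nat \<times> bool) list list \<Rightarrow> (nat \<times> nat) list \<Rightarrow> bool" where
  "consistent n Fl s \<longleftrightarrow> \<not> (\<exists>cl\<in>set Fl. \<forall>l\<in>set cl. \<exists>x\<in>set (sel_literals n s). fst x = fst l \<and> snd x = (\<not> snd l))"

text \<open>The fold conses, so the groups appear in reverse order in a selection; this is the
  origin of \<open>rev T\<close> below.\<close>

definition selections :: "nat \<Rightarrow> nat list \<Rightarrow> (nat \<times> nat) list list" where
  "selections Q T = fold (\<lambda>j acc. concat (map (\<lambda>s. map (\<lambda>c. (j, c) # s) [0..<Q]) acc)) T [[]]"

text \<open>Each set of at most \<open>K\<close> groups appears as its decreasing list. The
  recursion keeps \<open>K\<close> fixed and filters by length, so a single loop over the groups can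
  compute it.\<close>

fun tuples :: "nat \<Rightarrow> nat \<Rightarrow> nat list list" where
  "tuples K 0 = [[]]"
| "tuples K (Suc g) = tuples K g @ map ((#) g) (filter (\<lambda>t. length t < K) (tuples K g))"

definition checkers :: "nat \<Rightarrow> nat \<Rightarrow> nat list" where
  "checkers K n = map (\<lambda>i. Suc (num_groups n * (2 * weight n) + i)) [0..<length (tuples K (num_groups n))]"

definition checker_candidates :: "nat \<Rightarrow> (nat \<times> bool) list list \<Rightarrow> nat list \<Rightarrow> (nat list \<times> rat) list" where
  "checker_candidates n Fl T =
     map (\<lambda>s. (sel_nodes n s, 0)) (filter (consistent n Fl) (selections (2 ^ group_vars n) T)) @
     map (\<lambda>s. (0 # sel_nodes n s, 0)) (selections (2 ^ group_vars n) T)"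

definition candidates :: "nat \<Rightarrow> nat \<Rightarrow> nat \<Rightarrow> (nat \<times> bool) list list \<Rightarrow> (nat list \<times> rat) list list" where
  "candidates K p n Fl = [([], 0), (checkers K n, 1)] #
     replicate (num_groups n * (2 * weight n)) [([], -1), (checkers K n, 1)] @
     map (checker_candidates n Fl) (tuples K (num_groups n)) @ replicate p [([], 0)]"

definition candidates_data :: "(nat list \<times> rat) list \<Rightarrow> data" where
  "candidates_data cs = list_data (map (\<lambda>x. Pair (list_data (map nat_data (fst x))) (rat_data (snd x))) cs)"

definition num_nodes :: "nat \<Rightarrow> nat \<Rightarrow> nat \<Rightarrow> nat" where
  "num_nodes K p n = 1 + num_groups n * (2 * weight n) + length (tuples K (num_groups n)) + p"

section \<open>Enumeration of selections and of small sets of groups\<close>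

lemma set_selections: "set (selections Q T) = {s. map fst s = rev T \<and> (\<forall>x\<in>set s. snd x < Q)}"
proof -
  have "set (fold (\<lambda>j acc. concat (map (\<lambda>s. map (\<lambda>c. (j, c) # s) [0..<Q]) acc)) T A) =
      {s. \<exists>u\<in>set A. \<exists>v. s = v @ u \<and> map fst v = rev T \<and> (\<forall>x\<in>set v. snd x < Q)}" for A
  proof (induction T arbitrary: A)
    case (Cons j T)
    have "(\<exists>u\<in>set (concat (map (\<lambda>s. map (\<lambda>c. (j, c) # s) [0..<Q]) A)). \<exists>v. s = v @ u \<and> map fst v = rev T \<and> (\<forall>x\<in>set v. snd x < Q))
      \<longleftrightarrow> (\<exists>u\<in>set A. \<exists>v. s = v @ u \<and> map fst v = rev (j # T) \<and> (\<forall>x\<in>set v. snd x < Q))" (is "?l \<longleftrightarrow> ?r") for s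
    proof
      assume ?l
      then obtain u c v where "u \<in> set A" "c < Q" "s = v @ (j, c) # u" "map fst v = rev T" "\<forall>x\<in>set v. snd x < Q"
        by auto
      then show ?r by (intro bexI[of _ u] exI[of _ "v @ [(j, c)]"]) auto
    next
      assume ?r
      then obtain u v where *: "u \<in> set A" "s = v @ u" "map fst v = rev T @ [j]" "\<forall>x\<in>set v. snd x < Q"
        by auto
      then obtain v' y where v: "v = v' @ [y]" by (cases v rule: rev_cases) auto
      with * have "fst y = j" "map fst v' = rev T" by auto
      with * v show ?l by (intro bexI[of _ "y # u"] exI[of _ v']) (auto intro!: bexI[of _ u] image_eqI[of _ _ "snd y"])
    qed
    then show ?case unfolding fold_simps comp_def Cons by simp
  qed simp
  from this[of "[[]]"] show ?thesis by (simp add: selections_def)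
qed

lemma length_selections: "length (selections Q T) = Q ^ length T"
proof -
  have "length (fold (\<lambda>j acc. concat (map (\<lambda>s. map (\<lambda>c. (j, c) # s) [0..<Q]) acc)) T A) = Q ^ length T * length A" for A
    by (induction T arbitrary: A) (simp_all add: length_concat comp_def sum_list_triv)
  from this[of "[[]]"] show ?thesis by (simp add: selections_def)
qed

lemma distinct_selections: "distinct (selections Q T)"
proof -
  have "distinct (fold (\<lambda>j acc. concat (map (\<lambda>s. map (\<lambda>c. (j, c) # s) [0..<Q]) acc)) T A)" if "distinct A" for A
    using that
  proof (induction T arbitrary: A)
    case (Cons j T)
    have "distinct (concat (map (\<lambda>s. map (\<lambda>c. (j, c) # s) [0..<Q]) A))"
      using Cons.prems by (induction A) (auto simp: distinct_map inj_on_def)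
    from Cons.IH[OF this] show ?case by simp
  qed simp
  from this[of "[[]]"] show ?thesis by (simp add: selections_def)
qed

lemma in_tuples: "T \<in> set (tuples K g) \<Longrightarrow> distinct T \<and> set T \<subseteq> {..<g} \<and> length T \<le> K"
proof (induction g arbitrary: T)
  case (Suc g)
  then show ?case by (fastforce simp: less_Suc_eq)
qed simp

lemma tuples_complete: "S \<subseteq> {..<g} \<Longrightarrow> card S \<le> K \<Longrightarrow> \<exists>T\<in>set (tuples K g). set T = S"
proof (induction g arbitrary: S)
  case (Suc g)
  show ?case
  proof (cases "g \<in> S")
    case True
    have fin: "finite S" using Suc.prems(1) finite_subset by blast
    then have card: "card S = Suc (card (S - {g}))" using True by (simp only: card_Suc_Diff1)
    have "S - {g} \<subseteq> {..<g}" using Suc.prems(1) by (auto simp: less_Suc_eq)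
    with Suc.IH[of "S - {g}"] card Suc.prems(2) obtain T where T: "T \<in> set (tuples K g)" "set T = S - {g}" by auto
    then have "length T < K" using in_tuples[OF T(1)] card Suc.prems(2) by (metis Suc_le_lessD distinct_card)
    with T True show ?thesis by (intro bexI[of _ "g # T"]) auto
  next
    case False
    then have "S \<subseteq> {..<g}" using Suc.prems(1) by (auto simp: less_Suc_eq)
    with Suc.IH[of S] Suc.prems(2) show ?thesis by auto
  qed
qed simp

text \<open>Recovers the recursion of Pascal, in which \<open>K\<close> decreases, for counting the
  tuples.\<close>

lemma filter_tuples_Suc: "filter (\<lambda>t. length t \<le> K) (tuples (Suc K) g) = tuples K g"
proof (induction g)
  case (Suc g)
  have "filter (\<lambda>t. length t < K) (tuples K g) = filter (\<lambda>t. length t < K) (filter (\<lambda>t. length t \<le> K) (tuples (Suc K) g))"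
    by (simp add: Suc)
  also have "\<dots> = filter (\<lambda>t. Suc (length t) \<le> K) (filter (\<lambda>t. length t < Suc K) (tuples (Suc K) g))"
    by (auto simp: intro: filter_cong)
  finally show ?case by (simp add: Suc filter_map comp_def)
qed simp

lemma length_tuples_le: "length (tuples K g) \<le> (g + 1) ^ K"
proof (induction g arbitrary: K)
  case (Suc g)
  show ?case
  proof (cases K)
    case 0
    then show ?thesis using Suc[of 0] by simp
  next
    case (Suc k)
    have "length (tuples K (Suc g)) = length (tuples K g) + length (tuples k g)"
      using Suc by (simp add: less_Suc_eq_le filter_tuples_Suc)
    also have "\<dots> \<le> (g + 1) ^ Suc k + (g + 1) ^ k" using Suc.IH[of K] Suc.IH[of k] Suc by (simp del: power_Suc)
    also have "\<dots> = (g + 2) * (g + 1) ^ k" by (simp add: algebra_simps)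
    also have "\<dots> \<le> (g + 2) * (g + 2) ^ k" by (intro mult_left_mono power_mono) auto
    finally show ?thesis using Suc by simp
  qed
qed simp

lemma tuples_nonempty: "tuples K g \<noteq> []"
  by (induction g) auto

lemma codeword_nth: "c < 2 ^ group_vars n \<Longrightarrow> length (balanced n ! c) = 2 * weight n \<and> length (filter id (balanced n ! c)) = weight n"
  using length_balanced_ge[of n] by (intro in_set_balanced nth_mem) simp

section \<open>The instance built from a formula\<close>

context
  fixes K p n :: nat and Fl :: "(nat \<times> bool) list list"
  assumes K: "0 < K" and Fl: "\<And>cl. cl \<in> set Fl \<Longrightarrow> length cl \<le> K \<and> fst ` set cl \<subseteq> {..<n}"
begin

definition codeword_positions :: "nat \<Rightarrow> nat \<Rightarrow> nat set" where
  "codeword_positions j c = (\<lambda>i. j * (2 * weight n) + i) ` {i. i < 2 * weight n \<and> balanced n ! c ! i}"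

text \<open>\<open>rev\<close> matches the order of groups in \<open>selections\<close>, so that
  restricted assignments and listed selections are equal as lists.\<close>

definition tuple_consistent :: "nat \<Rightarrow> (nat \<Rightarrow> nat) \<Rightarrow> bool" where
  "tuple_consistent l \<sigma> = consistent n Fl (map (\<lambda>j. (j, \<sigma> j)) (rev (tuples K (num_groups n) ! l)))"

text \<open>Injectivity of the code holds because there are at least \<open>2 ^ group_vars n\<close>
  balanced strings, all distinct. Every group is seen by some checker because \<open>K > 0\<close>
  admits singletons.\<close>

lemma gadget: "gadget (num_groups n) (weight n) (2 ^ group_vars n) (length (tuples K (num_groups n))) codeword_positions (\<lambda>l. set (tuples K (num_groups n) ! l)) tuple_consistent"
proof
  show "codeword_positions j c \<subseteq> {j * (2 * weight n)..<j * (2 * weight n) + 2 * weight n} \<and> card (codeword_positions j c) = weight n" if "c < 2 ^ group_vars n" for j c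
  proof -
    have "card (codeword_positions j c) = card {i. i < 2 * weight n \<and> balanced n ! c ! i}"
      unfolding codeword_positions_def by (rule card_image) (simp add: inj_on_def)
    also have "\<dots> = weight n"
      using conjunct2[OF codeword_nth[OF that]]
      unfolding length_filter_conv_card conjunct1[OF codeword_nth[OF that]] by simp
    finally show ?thesis by (auto simp: codeword_positions_def)
  qed
  show "c = c'" if "c < 2 ^ group_vars n" "c' < 2 ^ group_vars n" "codeword_positions j c = codeword_positions j c'" for j c c'
  proof -
    have "{i. i < 2 * weight n \<and> balanced n ! c ! i} = {i. i < 2 * weight n \<and> balanced n ! c' ! i}"
      using that(3) unfolding codeword_positions_def by (subst (asm) inj_image_eq_iff) (auto simp: inj_def)
    then have "balanced n ! c = balanced n ! c'"
      using codeword_nth[OF that(1)] codeword_nth[OF that(2)] by (intro nth_equalityI) auto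
    then show ?thesis
      using that length_balanced_ge[of n] distinct_balanced[of n] by (simp add: nth_eq_iff_index_eq)
  qed
  show "set (tuples K (num_groups n) ! l) \<subseteq> {..<num_groups n}" if "l < length (tuples K (num_groups n))" for l using in_tuples that nth_mem by blast
  show "\<exists>l<length (tuples K (num_groups n)). j \<in> set (tuples K (num_groups n) ! l)" if j: "j < num_groups n" for j
  proof -
    obtain T where "T \<in> set (tuples K (num_groups n))" "set T = {j}" using tuples_complete[of "{j}" "num_groups n" K] K j by auto
    then show ?thesis by (metis in_set_conv_nth insertI1)
  qed
  show "tuple_consistent l \<sigma> = tuple_consistent l \<tau>" if "\<And>j. j \<in> set (tuples K (num_groups n) ! l) \<Longrightarrow> \<sigma> j = \<tau> j" for l \<sigma> \<tau>
    using that unfolding tuple_consistent_def by (auto intro!: arg_cong[where f = "consistent n Fl"])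
qed (simp_all add: tuples_nonempty)

interpretation gadget "num_groups n" "weight n" "2 ^ group_vars n" "length (tuples K (num_groups n))" p codeword_positions "\<lambda>l. set (tuples K (num_groups n) ! l)" tuple_consistent
  by (rule gadget)

lemma set_sel_literals:
  "set (sel_literals n s) = {(j * group_vars n + i, bitstrings (group_vars n) ! c ! i) | j c i. (j, c) \<in> set s \<and> i < group_vars n}"
proof (intro equalityI subsetI)
  fix x assume "x \<in> set (sel_literals n s)"
  then obtain y i where "y \<in> set s" "i < group_vars n" "x = (fst y * group_vars n + i, bitstrings (group_vars n) ! snd y ! i)"
    by (auto simp: sel_literals_def literals_def)
  then show "x \<in> {(j * group_vars n + i, bitstrings (group_vars n) ! c ! i) | j c i. (j, c) \<in> set s \<and> i < group_vars n}"
    by (intro CollectI exI[of _ "fst y"] exI[of _ "snd y"] exI[of _ i]) simp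
next
  fix x assume "x \<in> {(j * group_vars n + i, bitstrings (group_vars n) ! c ! i) | j c i. (j, c) \<in> set s \<and> i < group_vars n}"
  then obtain j c i where "(j, c) \<in> set s" "i < group_vars n" "x = (j * group_vars n + i, bitstrings (group_vars n) ! c ! i)" by blast
  then show "x \<in> set (sel_literals n s)"
    unfolding sel_literals_def literals_def by (auto intro!: bexI[of _ "(j, c)"])
qed

text \<open>A clause with at most \<open>K\<close> literals touches at most \<open>K\<close> groups,
  so the checker for exactly these groups decides it.\<close>

lemma satisfiable_iff:
  "(\<exists>\<sigma>. (\<forall>j<num_groups n. \<sigma> j < 2 ^ group_vars n) \<and> (\<forall>l<length (tuples K (num_groups n)). tuple_consistent l \<sigma>)) \<longleftrightarrow> satisfiable (set ` set Fl)"
proof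
  assume "\<exists>\<sigma>. (\<forall>j<num_groups n. \<sigma> j < 2 ^ group_vars n) \<and> (\<forall>l<length (tuples K (num_groups n)). tuple_consistent l \<sigma>)"
  then obtain \<sigma> where \<sigma>: "\<And>j. j < num_groups n \<Longrightarrow> \<sigma> j < 2 ^ group_vars n" "\<And>l. l < length (tuples K (num_groups n)) \<Longrightarrow> tuple_consistent l \<sigma>" by blast
  define \<alpha> where "\<alpha> v = bitstrings (group_vars n) ! \<sigma> (v div group_vars n) ! (v mod group_vars n)" for v
  have "\<exists>(v, b)\<in>set cl. \<alpha> v = b" if cl: "cl \<in> set Fl" for cl
  proof -
    \<comment> \<open>The groups cover all \<open>n\<close> variables; surplus variables at the end
      occur in no clause.\<close>
    have m: "v div group_vars n < num_groups n \<and> v mod group_vars n < group_vars n" if "v < n" for v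
    proof -
      have "v < num_groups n * group_vars n" using that num_vars_le[of n] by simp
      moreover from this have "0 < group_vars n" by (cases "group_vars n") auto
      ultimately show ?thesis by (simp add: less_mult_imp_div_less)
    qed
    let ?S = "(\<lambda>l. fst l div group_vars n) ` set cl"
    have "?S \<subseteq> {..<num_groups n}" using Fl[OF cl] m by auto
    moreover have "card ?S \<le> K"
      using card_image_le[of "set cl" "\<lambda>l. fst l div group_vars n"] card_length[of cl] Fl[OF cl] by simp
    ultimately obtain l where l: "l < length (tuples K (num_groups n))" "set (tuples K (num_groups n) ! l) = ?S"
      using tuples_complete by (metis in_set_conv_nth)
    \<comment> \<open>This checker assigns all variables of \<open>cl\<close>, so a literal that it
      does not contradict is one that it satisfies.\<close>
    from \<sigma>(2)[OF l(1)] cl obtain v b where v: "(v, b) \<in> set cl"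
      "(v, \<not> b) \<notin> set (sel_literals n (map (\<lambda>j. (j, \<sigma> j)) (rev (tuples K (num_groups n) ! l))))"
      unfolding tuple_consistent_def consistent_def by fastforce
    have "v < n" using Fl[OF cl] v by auto
    moreover have "(v div group_vars n, \<sigma> (v div group_vars n)) \<in> set (map (\<lambda>j. (j, \<sigma> j)) (rev (tuples K (num_groups n) ! l)))"
      using l(2) v(1) by force
    ultimately have "(v, \<alpha> v) \<in> set (sel_literals n (map (\<lambda>j. (j, \<sigma> j)) (rev (tuples K (num_groups n) ! l))))"
      unfolding set_sel_literals using m[of v]
      by (intro CollectI exI[of _ "v div group_vars n"] exI[of _ "\<sigma> (v div group_vars n)"] exI[of _ "v mod group_vars n"]) (simp add: \<alpha>_def)
    with v(2) have "\<alpha> v = b" by (cases b; cases "\<alpha> v") auto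
    with v(1) show ?thesis by blast
  qed
  then show "satisfiable (set ` set Fl)" by (auto simp: satisfiable_def)
next
  assume "satisfiable (set ` set Fl)"
  then obtain \<alpha> where \<alpha>: "\<And>cl. cl \<in> set Fl \<Longrightarrow> \<exists>(v, b)\<in>set cl. \<alpha> v = b" by (auto simp: satisfiable_def)
  have "\<exists>c<2 ^ group_vars n. bitstrings (group_vars n) ! c = map (\<lambda>i. \<alpha> (j * group_vars n + i)) [0..<group_vars n]" for j
  proof -
    have "map (\<lambda>i. \<alpha> (j * group_vars n + i)) [0..<group_vars n] \<in> set (bitstrings (group_vars n))" by (simp add: set_bitstrings)
    then show ?thesis by (metis in_set_conv_nth length_bitstrings)
  qed
  then obtain \<sigma> where \<sigma>: "\<And>j. \<sigma> j < 2 ^ group_vars n" "\<And>j. bitstrings (group_vars n) ! \<sigma> j = map (\<lambda>i. \<alpha> (j * group_vars n + i)) [0..<group_vars n]" by metis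
  have "tuple_consistent l \<sigma>" for l
    unfolding tuple_consistent_def consistent_def
  proof
    let ?lits = "set (sel_literals n (map (\<lambda>j. (j, \<sigma> j)) (rev (tuples K (num_groups n) ! l))))"
    assume "\<exists>cl\<in>set Fl. \<forall>l\<in>set cl. \<exists>x\<in>?lits. fst x = fst l \<and> snd x = (\<not> snd l)"
    then obtain cl where cl: "cl \<in> set Fl" "\<And>l. l \<in> set cl \<Longrightarrow> \<exists>x\<in>?lits. fst x = fst l \<and> snd x = (\<not> snd l)" by blast
    from \<alpha>[OF cl(1)] obtain v where "(v, \<alpha> v) \<in> set cl" by auto
    with cl(2) have "(v, \<not> \<alpha> v) \<in> ?lits" by force
    then show False by (auto simp: set_sel_literals \<sigma>(2))
  qed
  with \<sigma>(1) show "\<exists>\<sigma>. (\<forall>j<num_groups n. \<sigma> j < 2 ^ group_vars n) \<and> (\<forall>l<length (tuples K (num_groups n)). tuple_consistent l \<sigma>)" by blast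
qed

lemma length_candidates: "length (candidates K p n Fl) = nodes"
  by (simp add: candidates_def nodes_def first_checker_def)

lemma set_checkers: "set (checkers K n) = U"
proof -
  have "set (checkers K n) = (+) first_checker ` {0..<length (tuples K (num_groups n))}"
    by (simp add: checkers_def first_checker_def image_comp[symmetric] comp_def)
  then show ?thesis by (simp add: U_def add.commute)
qed

lemma set_codeword: "set (codeword n j c) = Suc ` codeword_positions j c"
  by (auto simp: codeword_def codeword_positions_def)

lemma set_sel_nodes: "set (sel_nodes n s) = Suc ` (\<Union>x\<in>set s. codeword_positions (fst x) (snd x))"
  by (auto simp: sel_nodes_def set_codeword)

text \<open>Bridge from the listed selections of the program to the functions of the gadget; since
  \<open>T\<close> has no repetitions, a selection is the graph of a function.\<close>

lemma selection_as_function: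
  assumes T: "distinct T"
  shows "set (selections Q T) = (\<lambda>\<sigma>. map (\<lambda>j. (j, \<sigma> j)) (rev T)) ` {\<sigma>. \<forall>j\<in>set T. \<sigma> j < Q}"
proof (intro equalityI subsetI)
  fix s assume "s \<in> set (selections Q T)"
  then have s: "map fst s = rev T" "\<forall>x\<in>set s. snd x < Q" by (auto simp: set_selections)
  then have d: "distinct (map fst s)" using T by simp
  let ?\<sigma> = "\<lambda>j. the (map_of s j)"
  have *: "?\<sigma> (fst x) = snd x" if "x \<in> set s" for x using map_of_is_SomeI[OF d, of "fst x" "snd x"] that by simp
  then have "map (\<lambda>j. (j, ?\<sigma> j)) (map fst s) = s" by (simp add: map_idI)
  moreover have "?\<sigma> j < Q" if j: "j \<in> set T" for j
  proof -
    have "j \<in> fst ` set s" using s(1) j by (metis set_map set_rev)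
    then show ?thesis using * s(2) by auto
  qed
  ultimately show "s \<in> (\<lambda>\<sigma>. map (\<lambda>j. (j, \<sigma> j)) (rev T)) ` {\<sigma>. \<forall>j\<in>set T. \<sigma> j < Q}" using s(1) by force
qed (auto simp: set_selections comp_def rev_map[symmetric])

lemma codeword_positions_div: "i \<in> codeword_positions j c \<Longrightarrow> i div (2 * weight n) = j"
  by (intro div_nat_eqI) (auto simp: codeword_positions_def algebra_simps)

text \<open>Intersecting with a block recovers the codeword of its group, and codewords determine
  assignments. Injectivity is wanted because \<open>set_code\<close> forbids listing a parent set
  twice.\<close>

lemma inj_sel_nodes:
  assumes T: "T \<in> set (tuples K (num_groups n))"
  shows "inj_on (\<lambda>s. set (sel_nodes n s)) (set (selections (2 ^ group_vars n) T))"
proof (rule inj_onI)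
  fix s s' assume "s \<in> set (selections (2 ^ group_vars n) T)" "s' \<in> set (selections (2 ^ group_vars n) T)"
    and eq: "set (sel_nodes n s) = set (sel_nodes n s')"
  then have "s \<in> (\<lambda>\<sigma>. map (\<lambda>j. (j, \<sigma> j)) (rev T)) ` {\<sigma>. \<forall>j\<in>set T. \<sigma> j < 2 ^ group_vars n}"
     "s' \<in> (\<lambda>\<sigma>. map (\<lambda>j. (j, \<sigma> j)) (rev T)) ` {\<sigma>. \<forall>j\<in>set T. \<sigma> j < 2 ^ group_vars n}"
    using selection_as_function[of T] in_tuples[OF T] by auto
  then obtain \<sigma> \<tau> where s: "s = map (\<lambda>j. (j, \<sigma> j)) (rev T)" "\<And>j. j \<in> set T \<Longrightarrow> \<sigma> j < 2 ^ group_vars n"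
    and s': "s' = map (\<lambda>j. (j, \<tau> j)) (rev T)" "\<And>j. j \<in> set T \<Longrightarrow> \<tau> j < 2 ^ group_vars n" by auto
  have eq': "(\<Union>j\<in>set T. codeword_positions j (\<sigma> j)) = (\<Union>j\<in>set T. codeword_positions j (\<tau> j))"
    using eq by (simp add: set_sel_nodes s s' inj_image_eq_iff)
  have block: "codeword_positions j (\<rho> j) = {i\<in>\<Union>k\<in>set T. codeword_positions k (\<rho> k). i div (2 * weight n) = j}" if "j \<in> set T" for j \<rho>
    using that by (auto simp: codeword_positions_div)
  have "\<sigma> j = \<tau> j" if j: "j \<in> set T" for j
  proof (rule nd_inj)
    show "codeword_positions j (\<sigma> j) = codeword_positions j (\<tau> j)" using block[OF j, of \<sigma>] block[OF j, of \<tau>] eq' by simp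
  qed (use j s s' in_tuples[OF T] in auto)
  then show "s = s'" by (simp add: s s')
qed

lemma distinct_sel_nodes:
  assumes T: "T \<in> set (tuples K (num_groups n))" and s: "s \<in> set (selections (2 ^ group_vars n) T)"
  shows "distinct (sel_nodes n s)"
proof -
  have "distinct (map fst s)" using s in_tuples[OF T] by (simp add: set_selections)
  then show ?thesis
  proof (induction s)
    case (Cons x s)
    have "distinct (codeword n (fst x) (snd x))" by (auto simp: codeword_def distinct_map inj_on_def)
    moreover have "set (codeword n (fst x) (snd x)) \<inter> set (sel_nodes n s) = {}"
    proof (rule equals0I)
      fix v assume "v \<in> set (codeword n (fst x) (snd x)) \<inter> set (sel_nodes n s)"
      then obtain i y where "i \<in> codeword_positions (fst x) (snd x)" "y \<in> set s" "i \<in> codeword_positions (fst y) (snd y)"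
        by (auto simp: set_codeword set_sel_nodes)
      moreover from this have "fst x = fst y" using codeword_positions_div by metis
      ultimately show False using Cons.prems by simp
    qed
    ultimately show ?case using Cons by (simp add: sel_nodes_def)
  qed (simp add: sel_nodes_def)
qed

text \<open>The two halves of the list cannot collide because only the second contains node
  \<open>0\<close>. The last claim covers the other level of \<open>set_code\<close>, repetitions
  inside a parent set.\<close>

lemma checker_candidates:
  assumes l: "l < length (tuples K (num_groups n))"
  defines "cs \<equiv> map (\<lambda>x. (set (fst x), snd x)) (checker_candidates n Fl (tuples K (num_groups n) ! l))"
  shows "distinct cs" and "set cs = (\<lambda>P. (P, sc (first_checker + l) P)) ` C (first_checker + l)"
    and "\<And>x. x \<in> set (checker_candidates n Fl (tuples K (num_groups n) ! l)) \<Longrightarrow> distinct (fst x)"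
proof -
  let ?S = "selections (2 ^ group_vars n) (tuples K (num_groups n) ! l)"
  have T: "(tuples K (num_groups n)) ! l \<in> set (tuples K (num_groups n))" using l by simp
  have inj: "inj_on (\<lambda>s. set (sel_nodes n s)) (set ?S)" by (rule inj_sel_nodes[OF T])
  have no0: "0 \<notin> set (sel_nodes n s)" for s by (auto simp: set_sel_nodes)
  have inj0: "inj_on (\<lambda>s. insert 0 (set (sel_nodes n s))) (set ?S)"
    using inj no0 unfolding inj_on_def by (metis insert_ident)
  have "distinct (map (\<lambda>s. (set (sel_nodes n s), 0)) (filter (consistent n Fl) ?S))"
    using inj by (auto simp: distinct_map distinct_selections inj_on_def)
  moreover have "distinct (map (\<lambda>s. (insert 0 (set (sel_nodes n s)), 0)) ?S)"
    using inj0 by (auto simp: distinct_map distinct_selections inj_on_def)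
  ultimately show "distinct cs" using no0 by (auto simp: cs_def checker_candidates_def comp_def)
  have J: "set (sel_nodes n (map (\<lambda>j. (j, \<sigma> j)) (rev (tuples K (num_groups n) ! l)))) = J l \<sigma>" for \<sigma>
    by (simp add: set_sel_nodes J_def)
  have S: "set ?S = (\<lambda>\<sigma>. map (\<lambda>j. (j, \<sigma> j)) (rev (tuples K (num_groups n) ! l))) ` {\<sigma>. valid l \<sigma>}"
    unfolding valid_def using selection_as_function in_tuples[OF T] by blast
  have "set cs = (\<lambda>P. (P, 0)) ` ((\<lambda>s. set (sel_nodes n s)) ` {s \<in> set ?S. consistent n Fl s} \<union>
      (\<lambda>s. insert 0 (set (sel_nodes n s))) ` set ?S)"
    by (simp add: cs_def checker_candidates_def comp_def image_Un image_image)
  also have "(\<lambda>s. set (sel_nodes n s)) ` {s \<in> set ?S. consistent n Fl s} = J l ` {\<sigma>. valid l \<sigma> \<and> tuple_consistent l \<sigma>}"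
    unfolding S tuple_consistent_def J[symmetric] by (auto simp: image_iff)
  also have "(\<lambda>s. insert 0 (set (sel_nodes n s))) ` set ?S = (insert 0 \<circ> J l) ` {\<sigma>. valid l \<sigma>}"
    unfolding S comp_def J[symmetric] by (auto simp: image_iff)
  finally show "set cs = (\<lambda>P. (P, sc (first_checker + l) P)) ` C (first_checker + l)"
    using l by (simp add: C_def sc_def first_checker_def)
  show "distinct (fst x)" if "x \<in> set (checker_candidates n Fl (tuples K (num_groups n) ! l))" for x
    using that distinct_sel_nodes[OF T] no0 by (auto simp: checker_candidates_def)
qed

lemma candidates_nth:
  assumes i: "i < nodes"
  defines "cs \<equiv> map (\<lambda>x. (set (fst x), snd x)) (candidates K p n Fl ! i)"
  shows "distinct cs" and "set cs = (\<lambda>P. (P, sc i P)) ` C i"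
    and "\<And>x. x \<in> set (candidates K p n Fl ! i) \<Longrightarrow> distinct (fst x)"
proof -
  have dU: "distinct (checkers K n)" by (auto simp: checkers_def distinct_map inj_on_def)
  have "distinct cs \<and> set cs = (\<lambda>P. (P, sc i P)) ` C i \<and> (\<forall>x\<in>set (candidates K p n Fl ! i). distinct (fst x))"
  proof -
    consider "i = 0" | k where "i = Suc k" "k < num_groups n * (2 * weight n)" | l where "i = first_checker + l" "l < length (tuples K (num_groups n))"
      | "first_checker + length (tuples K (num_groups n)) \<le> i"
    proof -
      have "i - 1 < num_groups n * (2 * weight n)" if "i \<noteq> 0" "i < first_checker" using that by (auto simp: first_checker_def)
      moreover have "i - first_checker < length (tuples K (num_groups n))" if "first_checker \<le> i" "i < first_checker + length (tuples K (num_groups n))"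
        using that by auto
      ultimately show ?thesis using that(1) that(2)[of "i - 1"] that(3)[of "i - first_checker"] that(4)
        by (metis Suc_pred' le_add_diff_inverse not_gr_zero not_le diff_Suc_1 One_nat_def)
    qed
    then show ?thesis
    proof cases
      case 1
      then show ?thesis using U_nonempty dU
        by (auto simp: cs_def candidates_def C_def sc_def first_checker_def set_checkers)
    next
      case 2
      then have "candidates K p n Fl ! i = [([], -1), (checkers K n, 1)]"
        by (simp add: candidates_def nth_append)
      then show ?thesis using 2 U_nonempty dU
        by (auto simp: cs_def C_def sc_def first_checker_def set_checkers)
    next
      case 3
      then have "candidates K p n Fl ! i = checker_candidates n Fl (tuples K (num_groups n) ! l)"
        by (simp add: candidates_def nth_append first_checker_def)
      then show ?thesis using checker_candidates[OF 3(2)] unfolding cs_def 3(1) by metis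
    next
      case 4
      then have "candidates K p n Fl ! i = [([], 0)]"
        using i by (auto simp: candidates_def nth_append first_checker_def nodes_def nth_Cons')
      then show ?thesis using 4
        by (auto simp: cs_def C_def sc_def first_checker_def)
    qed
  qed
  then show "distinct cs" "set cs = (\<lambda>P. (P, sc i P)) ` C i"
    "\<And>x. x \<in> set (candidates K p n Fl ! i) \<Longrightarrow> distinct (fst x)" by blast+
qed

lemma bnsl_code: "bnsl_code nodes C sc (list_data (map candidates_data (candidates K p n Fl)))"
  unfolding bnsl_code_def
proof (intro exI conjI allI impI)
  let ?code = "\<lambda>x. Pair (list_data (map nat_data (fst x))) (rat_data (snd x))"
  let ?xs = "map candidates_data (candidates K p n Fl)"
  show "length ?xs = nodes" by (simp add: length_candidates)
  show "list_data ?xs = list_data ?xs" ..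
  fix i assume i: "i < nodes"
  let ?cs = "candidates K p n Fl ! i"
  have "list_all2 (pair_code (set_code nat_code) rat_code) (map (\<lambda>x. (set (fst x), snd x)) ?cs) (map ?code ?cs)"
    unfolding list_all2_map1 list_all2_map2
  proof (rule list.rel_refl_strong)
    fix x assume "x \<in> set ?cs"
    then have "distinct (fst x)" by (rule candidates_nth(3)[OF i])
    then have "set_code nat_code (set (fst x)) (list_data (map nat_data (fst x)))"
      unfolding set_code_def by (intro exI[of _ "fst x"] exI[of _ "map nat_data (fst x)"])
        (simp add: list_all2_map2 nat_code_def list.rel_refl_strong)
    then show "pair_code (set_code nat_code) rat_code (set (fst x), snd x) (?code x)"
      by (simp add: pair_code_def rat_code_def)
  qed
  then show "set_code (pair_code (set_code nat_code) rat_code) ((\<lambda>J. (J, sc i J)) ` C i) (?xs ! i)"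
    unfolding set_code_def using candidates_nth(1,2)[OF i] i
    by (intro exI[of _ "map (\<lambda>x. (set (fst x), snd x)) ?cs"] exI[of _ "map ?code ?cs"]) (simp add: length_candidates candidates_data_def)
qed

lemma num_parent_sets_le:
  "num_parent_sets nodes C \<le> 2 + num_groups n * (2 * weight n) * 2 + (num_groups n + 1) ^ K * (2 * (2 ^ group_vars n) ^ K) + p"
proof -
  have "card (C i) \<le> length (candidates K p n Fl ! i)" if "i < nodes" for i
  proof -
    have "card (C i) = card ((\<lambda>P. (P, sc i P)) ` C i)" by (rule card_image[symmetric]) (simp add: inj_on_def)
    also have "\<dots> = card (set (map (\<lambda>x. (set (fst x), snd x)) (candidates K p n Fl ! i)))"
      by (simp only: candidates_nth(2)[OF that])
    also have "\<dots> \<le> length (candidates K p n Fl ! i)" by (rule order_trans[OF card_length]) simp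
    finally show ?thesis .
  qed
  then have "num_parent_sets nodes C \<le> (\<Sum>i<nodes. length (candidates K p n Fl ! i))"
    unfolding num_parent_sets_def by (intro sum_mono) simp
  also have "\<dots> = sum_list (map length (candidates K p n Fl))"
    by (simp add: sum_list_sum_nth length_candidates atLeast0LessThan)
  also have "\<dots> = 2 + num_groups n * (2 * weight n) * 2 + sum_list (map (\<lambda>T. length (checker_candidates n Fl T)) (tuples K (num_groups n))) + p"
    by (simp add: candidates_def comp_def sum_list_replicate)
  also have "sum_list (map (\<lambda>T. length (checker_candidates n Fl T)) (tuples K (num_groups n))) \<le> sum_list (map (\<lambda>T. 2 * (2 ^ group_vars n) ^ K) (tuples K (num_groups n)))"
  proof (rule sum_list_mono)
    fix T assume "T \<in> set (tuples K (num_groups n))"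
    then have "length T \<le> K" using in_tuples by blast
    then have "length (selections (2 ^ group_vars n) T) \<le> (2 ^ group_vars n) ^ K"
      by (simp add: length_selections power_increasing)
    moreover have "length (filter (consistent n Fl) (selections (2 ^ group_vars n) T)) \<le> length (selections (2 ^ group_vars n) T)" by simp
    ultimately show "length (checker_candidates n Fl T) \<le> 2 * (2 ^ group_vars n) ^ K"
      unfolding checker_candidates_def length_append length_map by linarith
  qed
  also have "\<dots> \<le> (num_groups n + 1) ^ K * (2 * (2 ^ group_vars n) ^ K)"
    using length_tuples_le[of K "num_groups n"] by (simp add: sum_list_triv)
  finally show ?thesis by simp
qed

text \<open>\<open>A_ok\<close> hides optimality and exports what decoding uses: arcs between
  existing nodes, and an answer that is visible at node \<open>0\<close>.\<close>

lemma bnsl_candidates: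
  assumes b: "\<And>N. 1 \<le> b N"
    and f: "real (2 + num_groups n * (2 * weight n) * 2 + (num_groups n + 1) ^ K * (2 * (2 ^ group_vars n) ^ K) + p) \<le> 2 powr f (num_nodes K p n)"
  obtains A_ok where "bnsl b f (num_nodes K p n) (list_data (map candidates_data (candidates K p n Fl))) A_ok"
    and "\<And>y. A_ok y \<Longrightarrow> \<exists>A. set_code (pair_code nat_code nat_code) A y \<and>
        A \<subseteq> {..<num_nodes K p n} \<times> {..<num_nodes K p n} \<and>
        ((\<exists>j. (j, 0) \<in> A) \<longleftrightarrow> satisfiable (set ` set Fl))"
proof
  have nodes: "num_nodes K p n = nodes" by (simp add: num_nodes_def nodes_def first_checker_def)
  let ?Q = "\<lambda>y. \<exists>A. set_code (pair_code nat_code nat_code) A y \<and> optimal_dag nodes C sc A"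
  have "rat_bits_le (b nodes) (sc i P)" for i P
  proof -
    \<comment> \<open>The scores are -1, 0 and 1, whose numerators and denominators fit into one
      bit.\<close>
    have "(2::int) ^ 1 \<le> 2 ^ b nodes" by (rule power_increasing[OF b]) simp
    then show ?thesis by (auto simp: sc_def rat_bits_le_def)
  qed
  moreover have "real (num_parent_sets nodes C) \<le> 2 powr f nodes"
    using order_trans[OF of_nat_mono[OF num_parent_sets_le] f] by (simp add: nodes)
  ultimately show "bnsl b f (num_nodes K p n) (list_data (map candidates_data (candidates K p n Fl))) ?Q"
    unfolding bnsl_def nodes using bnsl_instance bnsl_code by blast
  show "\<exists>A. set_code (pair_code nat_code nat_code) A y \<and> 
        A \<subseteq> {..<num_nodes K p n} \<times> {..<num_nodes K p n} \<and>
        ((\<exists>j. (j, 0) \<in> A) \<longleftrightarrow> satisfiable (set ` set Fl))" if "?Q y" for y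
  proof -
    from that obtain A where A: "set_code (pair_code nat_code nat_code) A y" "optimal_dag nodes C sc A" by blast
    have "(\<exists>j. (j, 0) \<in> A) \<longleftrightarrow> parents A 0 \<noteq> {}" by (auto simp: parents_def)
    then show ?thesis using A optimal_dag_parents_0[OF A(2)] satisfiable_iff
      unfolding nodes by (auto simp: optimal_dag_def dag_def)
  qed
qed

end

section \<open>The reduction as a program\<close>

definition literal_data :: "nat \<times> bool \<Rightarrow> data" where
  "literal_data l = Pair (nat_data (fst l)) (bool_data (snd l))"

definition clause_data :: "(nat \<times> bool) list \<Rightarrow> data" where
  "clause_data cl = list_data (map literal_data cl)"

definition formula_data :: "nat \<times> (nat \<times> bool) list list \<Rightarrow> data" where
  "formula_data a = Pair (nat_data (fst a)) (list_data (map clause_data (snd a)))"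

text \<open>Since time is measured in \<open>n\<close> alone, the number of clauses needs a bound in
  \<open>n\<close>. An input without repeated clauses meets this one, by
  \<open>k_cnf_card_le\<close>.\<close>

definition formulas :: "nat \<Rightarrow> (nat \<times> (nat \<times> bool) list list) set" where
  "formulas K = {a. length (snd a) \<le> (2 * fst a + 1) ^ K \<and>
     (\<forall>cl\<in>set (snd a). length cl \<le> K \<and> fst ` set cl \<subseteq> {..<fst a})}"

text \<open>The codewords are found by filtering all bitstrings of length
  \<open>2 * weight n\<close>, so this number bounds the costliest list. It dominates the other
  parameters up to polynomials, and its exponent is \<open>o(n)\<close>, so polynomial time in it is
  \<open>2 ^ o(n)\<close>.\<close>

definition formula_measure :: "nat \<times> (nat \<times> bool) list list \<Rightarrow> nat" where
  "formula_measure a = 2 ^ (2 * weight (fst a))"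

text \<open>Inside nested loops the formula is buried in the input of \<open>z\<close>; this says
  that it can be extracted as \<pi> \<open>z\<close>, within the measure.\<close>

definition reads ::
  "nat \<Rightarrow> 'a set \<Rightarrow> ('a \<Rightarrow> nat) \<Rightarrow> ('a \<Rightarrow> data) \<Rightarrow> ('a \<Rightarrow> nat \<times> (nat \<times> bool) list list) \<Rightarrow> bool" where
  "reads K D \<mu> inp \<pi> \<longleftrightarrow> poly_time D \<mu> inp (\<lambda>z. formula_data (\<pi> z)) \<and>
     (\<forall>z\<in>D. \<pi> z \<in> formulas K \<and> formula_measure (\<pi> z) \<le> \<mu> z)"

lemma reads_self: "reads K (formulas K) formula_measure formula_data (\<lambda>a. a)"
  by (simp add: reads_def poly_time_id)

lemma reads_lift:
  "reads K D \<mu> inp \<pi> \<Longrightarrow>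
   reads K (Sigma D B) (\<lambda>z. \<mu> (fst z)) (\<lambda>z. Pair (H z) (inp (fst z))) (\<lambda>z. \<pi> (fst z))"
  by (auto simp: reads_def intro: poly_time_lift)

lemma poly_time_reads:
  "poly_time (formulas K) formula_measure formula_data F \<Longrightarrow> reads K D \<mu> inp \<pi> \<Longrightarrow>
   poly_time D \<mu> inp (\<lambda>z. F (\<pi> z))"
  by (erule poly_time_subst) (auto simp: reads_def)

lemma poly_bounded_reads:
  "poly_bounded (formulas K) formula_measure f \<Longrightarrow> reads K D \<mu> inp \<pi> \<Longrightarrow>
   poly_bounded D \<mu> (\<lambda>z. f (\<pi> z))"
  by (erule poly_bounded_subst) (auto simp: reads_def intro: poly_bounded_mono[OF poly_bounded_measure])

lemma poly_bounded_snd_upt: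
  "poly_bounded D \<mu> k \<Longrightarrow> poly_bounded (SIGMA a:D. set [0..<k a]) (\<lambda>z. \<mu> (fst z)) snd"
  by (rule poly_bounded_mono[OF poly_bounded_lift]) auto

context
  fixes K :: nat
begin

abbreviation (input) "pb \<equiv> poly_bounded (formulas K) formula_measure"
abbreviation (input) "pt \<equiv> poly_time (formulas K) formula_measure formula_data"

section \<open>Bounds on the parameters\<close>

lemma bounded_n: "pb fst"
proof (rule poly_bounded_mono[OF poly_bounded_measure])
  fix a :: "nat \<times> (nat \<times> bool) list list"
  have "fst a < 2 ^ num_groups (fst a)" unfolding num_groups_def by (rule less_two_power_bits)
  also have "\<dots> \<le> formula_measure a" unfolding formula_measure_def weight_def by (rule power_increasing) auto
  finally show "fst a \<le> formula_measure a" by simp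
qed

lemma bounded_num_groups: "pb (\<lambda>a. num_groups (fst a))"
  by (rule poly_bounded_mono[OF bounded_n]) (simp add: num_groups_def length_bits_le)

lemma bounded_half_size: "pb (\<lambda>a. half_size (fst a))"
  by (rule poly_bounded_mono[OF bounded_n]) (rule half_size_le_self)

lemma bounded_group_vars: "pb (\<lambda>a. group_vars (fst a))"
  unfolding group_vars_def by (intro poly_bounded_mult poly_bounded_const bounded_half_size)

lemma bounded_weight: "pb (\<lambda>a. weight (fst a))"
  unfolding weight_def by (intro poly_bounded_add poly_bounded_const bounded_half_size bounded_num_groups)

lemma bounded_group_nodes: "pb (\<lambda>a. 2 * weight (fst a))"
  by (intro poly_bounded_mult poly_bounded_const bounded_weight)

lemma bounded_all_nodes: "pb (\<lambda>a. num_groups (fst a) * (2 * weight (fst a)))"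
  by (intro poly_bounded_mult bounded_group_nodes bounded_num_groups)

lemma bounded_two_power_group_nodes: "pb (\<lambda>a. 2 ^ (2 * weight (fst a)))"
  by (rule poly_bounded_mono[OF poly_bounded_measure]) (simp add: formula_measure_def)

lemma bounded_two_power_group_vars: "pb (\<lambda>a. 2 ^ group_vars (fst a))"
  by (rule poly_bounded_mono[OF bounded_two_power_group_nodes]) (unfold group_vars_def weight_def, rule power_increasing, auto)

lemma bounded_tuples: "pb (\<lambda>a. length (tuples K (num_groups (fst a))))"
  by (rule poly_bounded_mono[where g = "\<lambda>a. (num_groups (fst a) + 1) ^ K"])
    (intro poly_bounded_power poly_bounded_add poly_bounded_const bounded_num_groups, rule length_tuples_le)

lemma bounded_clauses: "pb (\<lambda>a. length (snd a))"
  by (rule poly_bounded_mono[where g = "\<lambda>a. (2 * fst a + 1) ^ K"])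
    (intro poly_bounded_power poly_bounded_add poly_bounded_mult poly_bounded_const bounded_n, simp add: formulas_def)

section \<open>Computing the parameters, the code and the sets of groups\<close>

lemma poly_time_n: "pt (\<lambda>a. un (fst a))"
proof (rule poly_time_un_of_binary[OF _ bounded_n])
  show "pt (\<lambda>a. nat_data (fst a))" unfolding formula_data_def by (rule poly_time_elem)
qed

lemma poly_time_clauses: "pt (\<lambda>a. list_data (map clause_data (snd a)))"
  unfolding formula_data_def by (rule poly_time_rest)

lemma poly_time_num_groups: "pt (\<lambda>a. un (num_groups (fst a)))"
  unfolding num_groups_def
proof (rule poly_time_length[where e = "\<lambda>_. bool_data"])
  show "pt (\<lambda>a. list_data (map bool_data (bits (fst a))))"
    unfolding nat_data_bits[symmetric] formula_data_def by (rule poly_time_elem)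
  show "pb (\<lambda>a. length (bits (fst a)))" using bounded_num_groups by (simp add: num_groups_def)
qed

lemma poly_time_half_size: "pt (\<lambda>a. un (half_size (fst a)))"
  unfolding half_size_def
proof (rule poly_time_length[where e = "\<lambda>_. un", OF poly_time_filter])
  show "pt (\<lambda>a. list_data (map un [0..<fst a]))" by (intro poly_time_upt poly_time_n bounded_n)
  show "pb (\<lambda>a. length [0..<fst a])" by (simp add: bounded_n)
  show "pb (\<lambda>a. length (filter (\<lambda>i. i * (2 * num_groups (fst a)) < fst a) [0..<fst a]))"
    by (rule poly_bounded_mono[OF bounded_n]) (rule order_trans[OF length_filter_le], simp)
  show "poly_time (SIGMA a:formulas K. set [0..<fst a]) (\<lambda>z. formula_measure (fst z))
    (\<lambda>z. Pair (un (snd z)) (formula_data (fst z)))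
    (\<lambda>z. bool_data (snd z * (2 * num_groups (fst (fst z))) < fst (fst z)))"
    by (intro poly_time_un_less poly_time_un_mult poly_time_elem poly_time_const
        poly_time_lift[OF poly_time_n] poly_time_lift[OF poly_time_num_groups]
        poly_bounded_mult poly_bounded_snd_upt poly_bounded_const bounded_n
        poly_bounded_lift[OF bounded_num_groups])
qed

lemma poly_time_group_vars: "pt (\<lambda>a. un (group_vars (fst a)))"
  unfolding group_vars_def
  by (intro poly_time_un_mult poly_time_const poly_time_half_size poly_bounded_const bounded_half_size)

lemma poly_time_weight: "pt (\<lambda>a. un (weight (fst a)))"
  unfolding weight_def
  by (intro poly_time_un_add poly_time_const poly_time_half_size poly_time_num_groups
      poly_bounded_add bounded_half_size bounded_num_groups)

lemma poly_time_group_nodes: "pt (\<lambda>a. un (2 * weight (fst a)))"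
  by (intro poly_time_un_mult poly_time_const poly_time_weight poly_bounded_const bounded_weight)

lemma poly_time_all_nodes: "pt (\<lambda>a. un (num_groups (fst a) * (2 * weight (fst a))))"
  by (intro poly_time_un_mult poly_time_num_groups poly_time_group_nodes bounded_num_groups bounded_group_nodes)

lemma poly_time_bitstrings:
  assumes "poly_time D \<mu> inp (\<lambda>a. un (k a))" "poly_bounded D \<mu> (\<lambda>a. 2 ^ k a)"
  shows "poly_time D \<mu> inp (\<lambda>a. list_data (map (\<lambda>bs. list_data (map bool_data bs)) (bitstrings (k a))))"
proof -
  let ?e = "\<lambda>bs. list_data (map bool_data bs)"
  have "poly_time D \<mu> inp (\<lambda>a. list_data (map ?e (bitstrings (length (replicate (k a) Atom)))))"
  proof (rule poly_time_fold_map[OF poly_time_un_list[OF assms(1)],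
        where acc = "\<lambda>a i. list_data (map ?e (bitstrings i))"])
    show "poly_bounded D \<mu> (\<lambda>a. length (replicate (k a) Atom))"
      by (rule poly_bounded_mono[OF assms(2)]) (simp add: less_imp_le)
    let ?D = "{z. fst z \<in> D \<and> snd z < length (replicate (k (fst z)) Atom)}"
    let ?i = "\<lambda>z. Pair Atom (Pair (list_data (map ?e (bitstrings (snd z)))) (inp (fst z)))"
    have len: "poly_bounded ?D (\<lambda>z. \<mu> (fst z)) (\<lambda>z. length (bitstrings (snd z)))"
    proof (rule poly_bounded_mono[where g = "\<lambda>z. 2 ^ k (fst z)"])
      show "poly_bounded ?D (\<lambda>z. \<mu> (fst z)) (\<lambda>z. 2 ^ k (fst z))"
        using assms(2) unfolding poly_bounded_def by auto
    qed (auto intro: power_increasing)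
    have "poly_time ?D (\<lambda>z. \<mu> (fst z)) ?i (\<lambda>z. list_data (map (\<lambda>bs. ?e (c # bs)) (bitstrings (snd z))))" for c
      by (rule poly_time_map[where e = "\<lambda>_. ?e", OF poly_time_loop_acc _ len])
        (simp, intro poly_time_pair poly_time_const poly_time_elem)
    from poly_time_append[OF this[of True] this[of False]] len
    show "poly_time ?D (\<lambda>z. \<mu> (fst z)) ?i (\<lambda>z. list_data (map ?e (bitstrings (Suc (snd z)))))"
      by (simp add: comp_def)
  qed (simp_all add: poly_time_const)
  then show ?thesis by simp
qed

lemma poly_time_two_power_group_vars: "pt (\<lambda>a. un (2 ^ group_vars (fst a)))"
  using poly_time_length[OF poly_time_bitstrings[OF poly_time_group_vars]] bounded_two_power_group_vars by simp

lemma poly_time_group_bitstrings: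
  "pt (\<lambda>a. list_data (map (\<lambda>bs. list_data (map bool_data bs)) (bitstrings (group_vars (fst a)))))"
  by (intro poly_time_bitstrings poly_time_group_vars bounded_two_power_group_vars)

lemma poly_time_balanced:
  "pt (\<lambda>a. list_data (map (\<lambda>bs. list_data (map bool_data bs)) (balanced (fst a))))"
  unfolding balanced_def
proof (rule poly_time_filter[OF poly_time_bitstrings[OF poly_time_group_nodes bounded_two_power_group_nodes]])
  show "pb (\<lambda>a. length (bitstrings (2 * weight (fst a))))" by (simp add: bounded_two_power_group_nodes)
  let ?D = "SIGMA a:formulas K. set (bitstrings (2 * weight (fst a)))"
  have len: "poly_bounded ?D (\<lambda>z. formula_measure (fst z)) (\<lambda>z. length (snd z))"
    by (rule poly_bounded_mono[OF poly_bounded_lift[OF bounded_group_nodes]]) (auto simp: set_bitstrings)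
  have len': "poly_bounded ?D (\<lambda>z. formula_measure (fst z)) (\<lambda>z. length (filter id (snd z)))"
    by (rule poly_bounded_mono[OF len]) simp
  show "poly_time ?D (\<lambda>z. formula_measure (fst z))
     (\<lambda>z. Pair (list_data (map bool_data (snd z))) (formula_data (fst z)))
     (\<lambda>z. bool_data (length (filter id (snd z)) = weight (fst (fst z))))"
  proof (rule poly_time_un_eq[OF poly_time_length[OF poly_time_filter[OF poly_time_elem _ len] len']])
    show "poly_time (SIGMA a:?D. set (snd a)) (\<lambda>z. formula_measure (fst (fst z)))
     (\<lambda>z. Pair (bool_data (snd z)) (Pair (list_data (map bool_data (snd (fst z)))) (formula_data (fst (fst z)))))
     (\<lambda>z. bool_data (id (snd z)))"
      unfolding id_apply by (rule poly_time_elem)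
  qed (intro poly_time_lift poly_time_weight poly_bounded_lift bounded_weight len')+
qed

definition tuple_data :: "nat list \<Rightarrow> data" where
  "tuple_data T = list_data (map un T)"

lemma poly_time_tuples: "pt (\<lambda>a. list_data (map tuple_data (tuples K (num_groups (fst a)))))"
proof -
  have "pt (\<lambda>a. list_data (map tuple_data (tuples K (length [0..<num_groups (fst a)]))))"
  proof (rule poly_time_fold_map[where e = "\<lambda>_. un" and acc = "\<lambda>a i. list_data (map tuple_data (tuples K i))"])
    show "pt (\<lambda>a. list_data (map un [0..<num_groups (fst a)]))"
      by (intro poly_time_upt poly_time_num_groups bounded_num_groups)
    show "pb (\<lambda>a. length [0..<num_groups (fst a)])" by (simp add: bounded_num_groups)
    show "pt (\<lambda>a. list_data (map tuple_data (tuples K 0)))" by (rule poly_time_const)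
    let ?D = "{z. fst z \<in> formulas K \<and> snd z < length [0..<num_groups (fst (fst z))]}"
    let ?i = "\<lambda>z. Pair (un ([0..<num_groups (fst (fst z))] ! snd z))
      (Pair (list_data (map tuple_data (tuples K (snd z)))) (formula_data (fst z)))"
    let ?\<mu> = "\<lambda>z. formula_measure (fst z)"
    have len: "poly_bounded ?D ?\<mu> (\<lambda>z. length (tuples K (snd z)))"
    proof (rule poly_bounded_mono[where g = "\<lambda>z. (num_groups (fst (fst z)) + 1) ^ K"])
      show "poly_bounded ?D ?\<mu> (\<lambda>z. (num_groups (fst (fst z)) + 1) ^ K)"
        by (intro poly_bounded_power poly_bounded_add poly_bounded_const poly_bounded_subst[OF bounded_num_groups])
          (auto simp: poly_bounded_measure)
      fix z assume "z \<in> ?D"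
      then show "length (tuples K (snd z)) \<le> (num_groups (fst (fst z)) + 1) ^ K"
        by (intro order_trans[OF length_tuples_le] power_mono) auto
    qed
    let ?f = "\<lambda>z. filter (\<lambda>t. length t < K) (tuples K (snd z))"
    have len': "poly_bounded ?D ?\<mu> (\<lambda>z. length (?f z))"
      by (rule poly_bounded_mono[OF len]) simp
    have tuple_len: "poly_bounded (SIGMA z:?D. set (tuples K (snd z))) (\<lambda>z. ?\<mu> (fst z)) (\<lambda>z. length (snd z))"
      by (rule poly_bounded_mono[OF poly_bounded_const[where c = K]]) (use in_tuples in fastforce)
    have filter: "poly_time ?D ?\<mu> ?i (\<lambda>z. list_data (map tuple_data (?f z)))"
    proof (rule poly_time_filter[OF poly_time_loop_acc _ len])
      show "poly_time (SIGMA z:?D. set (tuples K (snd z))) (\<lambda>z. ?\<mu> (fst z))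
        (\<lambda>z. Pair (tuple_data (snd z)) (?i (fst z))) (\<lambda>z. bool_data (length (snd z) < K))"
        by (rule poly_time_un_less[OF poly_time_length[where e = "\<lambda>_. un", OF _ tuple_len] poly_time_const tuple_len])
          (unfold tuple_data_def, rule poly_time_elem)
    qed
    have "poly_time ?D ?\<mu> ?i (\<lambda>z. list_data (map (\<lambda>T. tuple_data (snd z # T)) (?f z)))"
    proof (rule poly_time_map[OF filter _ len'])
      show "poly_time (SIGMA z:?D. set (?f z)) (\<lambda>z. ?\<mu> (fst z))
        (\<lambda>z. Pair (tuple_data (snd z)) (?i (fst z))) (\<lambda>z. tuple_data (snd (fst z) # snd z))"
        unfolding tuple_data_def list.map list_data.simps
        by (intro poly_time_pair poly_time_elem poly_time_cong[OF poly_time_left[OF poly_time_rest]]) auto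
    qed
    from poly_time_append[OF poly_time_loop_acc this] len
    show "poly_time ?D ?\<mu> ?i (\<lambda>z. list_data (map tuple_data (tuples K (Suc (snd z)))))"
      by (simp add: comp_def)
  qed
  then show ?thesis by simp
qed


section \<open>Computing selections, their literals and parent sets\<close>

definition pair_data :: "nat \<times> nat \<Rightarrow> data" where
  "pair_data x = Pair (un (fst x)) (un (snd x))"

definition sel_data :: "(nat \<times> nat) list \<Rightarrow> data" where
  "sel_data s = list_data (map pair_data s)"

text \<open>Literals made from selections have unary variables, those of the input
  (\<open>literal_data\<close>) binary ones; the latter are converted before comparison.\<close>

definition un_literal_data :: "nat \<times> bool \<Rightarrow> data" where
  "un_literal_data x = Pair (un (fst x)) (bool_data (snd x))"

text \<open>What the programs on selections rely on: indices inside the lists of codewords and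
  assignments, and bounded lengths.\<close>

definition valid_selection :: "nat \<Rightarrow> (nat \<times> nat) list \<Rightarrow> bool" where
  "valid_selection n s \<longleftrightarrow> length s \<le> K \<and> (\<forall>x\<in>set s. fst x < num_groups n \<and> snd x < 2 ^ group_vars n)"

lemma poly_time_codeword:
  assumes r: "reads K D \<mu> inp \<pi>"
    and j: "poly_time D \<mu> inp (\<lambda>z. un (j z))" and c: "poly_time D \<mu> inp (\<lambda>z. un (c z))"
    and jc: "\<And>z. z \<in> D \<Longrightarrow> j z < num_groups (fst (\<pi> z)) \<and> c z < 2 ^ group_vars (fst (\<pi> z))"
  shows "poly_time D \<mu> inp (\<lambda>z. list_data (map nat_data (codeword (fst (\<pi> z)) (j z) (c z))))"
proof -
  note nodes = poly_time_reads[OF poly_time_group_nodes r] poly_bounded_reads[OF bounded_group_nodes r]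
  have j': "poly_bounded D \<mu> j"
    by (rule poly_bounded_mono[OF poly_bounded_reads[OF bounded_num_groups r]]) (use jc in \<open>auto intro: less_imp_le\<close>)
  have c': "poly_bounded D \<mu> c"
    by (rule poly_bounded_mono[OF poly_bounded_reads[OF bounded_two_power_group_vars r]]) (use jc in \<open>auto intro: less_imp_le\<close>)
  let ?row = "\<lambda>z. balanced (fst (\<pi> z)) ! c z"
  have row: "poly_time D \<mu> inp (\<lambda>z. list_data (map bool_data (?row z)))"
    by (rule poly_time_nth[where e = "\<lambda>_ bs. list_data (map bool_data bs)", OF c poly_time_reads[OF poly_time_balanced r] c'])
      (use jc length_balanced_ge in \<open>fastforce intro: less_le_trans\<close>)
  let ?L = "\<lambda>z. filter (\<lambda>i. ?row z ! i) [0..<2 * weight (fst (\<pi> z))]"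
  have L: "poly_time D \<mu> inp (\<lambda>z. list_data (map un (?L z)))"
  proof (rule poly_time_filter[OF poly_time_upt[OF nodes]])
    show "poly_bounded D \<mu> (\<lambda>z. length [0..<2 * weight (fst (\<pi> z))])" using nodes(2) by simp
    show "poly_time (SIGMA z:D. set [0..<2 * weight (fst (\<pi> z))]) (\<lambda>z. \<mu> (fst z)) (\<lambda>z. Pair (un (snd z)) (inp (fst z)))
       (\<lambda>z. bool_data (?row (fst z) ! snd z))"
      by (rule poly_time_nth[where e = "\<lambda>_. bool_data", OF poly_time_elem poly_time_lift[OF row] poly_bounded_snd_upt[OF nodes(2)]])
        (use jc codeword_nth in auto)
  qed
  have "poly_time D \<mu> inp (\<lambda>z. list_data (map (\<lambda>i. nat_data (Suc (j z * (2 * weight (fst (\<pi> z))) + i))) (?L z)))"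
  proof (rule poly_time_map[OF L])
    show "poly_bounded D \<mu> (\<lambda>z. length (?L z))"
      by (rule poly_bounded_mono[OF nodes(2)]) (rule order_trans[OF length_filter_le], simp)
    have e: "poly_bounded (SIGMA z:D. set (?L z)) (\<lambda>z. \<mu> (fst z)) snd"
      by (rule poly_bounded_mono[OF poly_bounded_lift[OF nodes(2)]]) auto
    have s: "poly_bounded (SIGMA z:D. set (?L z)) (\<lambda>z. \<mu> (fst z)) (\<lambda>z. Suc (j (fst z) * (2 * weight (fst (\<pi> (fst z)))) + snd z))"
      unfolding Suc_eq_plus1
      by (intro poly_bounded_add poly_bounded_mult poly_bounded_const poly_bounded_lift[OF j'] e
          poly_bounded_lift[OF poly_bounded_reads[OF bounded_weight r]])
    show "poly_time (SIGMA z:D. set (?L z)) (\<lambda>z. \<mu> (fst z)) (\<lambda>z. Pair (un (snd z)) (inp (fst z)))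
       (\<lambda>z. nat_data (Suc (j (fst z) * (2 * weight (fst (\<pi> (fst z)))) + snd z)))"
      by (intro poly_time_binary_of_un poly_time_un_Suc poly_time_un_add[OF poly_time_un_mult] poly_time_elem
          poly_time_lift[OF j] poly_time_lift[OF nodes(1)] poly_bounded_lift[OF j'] poly_bounded_lift[OF nodes(2)]
          poly_bounded_mult[OF poly_bounded_lift[OF j'] poly_bounded_lift[OF nodes(2)]] s)
  qed
  then show ?thesis by (simp add: codeword_def comp_def)
qed

lemma poly_time_literals:
  assumes r: "reads K D \<mu> inp \<pi>"
    and j: "poly_time D \<mu> inp (\<lambda>z. un (j z))" and c: "poly_time D \<mu> inp (\<lambda>z. un (c z))"
    and jc: "\<And>z. z \<in> D \<Longrightarrow> j z < num_groups (fst (\<pi> z)) \<and> c z < 2 ^ group_vars (fst (\<pi> z))"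
  shows "poly_time D \<mu> inp (\<lambda>z. list_data (map un_literal_data (literals (fst (\<pi> z)) (j z) (c z))))"
proof -
  note vars = poly_time_reads[OF poly_time_group_vars r] poly_bounded_reads[OF bounded_group_vars r]
  have j': "poly_bounded D \<mu> j"
    by (rule poly_bounded_mono[OF poly_bounded_reads[OF bounded_num_groups r]]) (use jc in \<open>auto intro: less_imp_le\<close>)
  have c': "poly_bounded D \<mu> c"
    by (rule poly_bounded_mono[OF poly_bounded_reads[OF bounded_two_power_group_vars r]]) (use jc in \<open>auto intro: less_imp_le\<close>)
  let ?row = "\<lambda>z. bitstrings (group_vars (fst (\<pi> z))) ! c z"
  have row: "poly_time D \<mu> inp (\<lambda>z. list_data (map bool_data (?row z)))"
    by (rule poly_time_nth[where e = "\<lambda>_ bs. list_data (map bool_data bs)", OF c poly_time_reads[OF poly_time_group_bitstrings r] c'])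
      (use jc in auto)
  have len: "length (?row z) = group_vars (fst (\<pi> z))" if "z \<in> D" for z
    using nth_mem[of "c z" "bitstrings (group_vars (fst (\<pi> z)))"] jc[OF that] by (simp add: set_bitstrings)
  let ?L = "\<lambda>z. [0..<group_vars (fst (\<pi> z))]"
  have "poly_time D \<mu> inp (\<lambda>z. list_data (map (\<lambda>i. Pair (un (j z * group_vars (fst (\<pi> z)) + i)) (bool_data (?row z ! i))) (?L z)))"
  proof (rule poly_time_map[OF poly_time_upt[OF vars]])
    show "poly_bounded D \<mu> (\<lambda>z. length (?L z))" using vars(2) by simp
    have "poly_time (SIGMA z:D. set (?L z)) (\<lambda>z. \<mu> (fst z)) (\<lambda>z. Pair (un (snd z)) (inp (fst z)))
       (\<lambda>z. bool_data (?row (fst z) ! snd z))"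
      by (rule poly_time_nth[where e = "\<lambda>_. bool_data", OF poly_time_elem poly_time_lift[OF row] poly_bounded_snd_upt[OF vars(2)]])
        (use len in auto)
    then show "poly_time (SIGMA z:D. set (?L z)) (\<lambda>z. \<mu> (fst z)) (\<lambda>z. Pair (un (snd z)) (inp (fst z)))
       (\<lambda>z. Pair (un (j (fst z) * group_vars (fst (\<pi> (fst z))) + snd z)) (bool_data (?row (fst z) ! snd z)))"
      by (intro poly_time_pair poly_time_un_add[OF poly_time_un_mult] poly_time_elem
          poly_time_lift[OF j] poly_time_lift[OF vars(1)] poly_bounded_lift[OF j'] poly_bounded_lift[OF vars(2)]
          poly_bounded_mult[OF poly_bounded_lift[OF j'] poly_bounded_lift[OF vars(2)]])
  qed
  then show ?thesis by (simp add: literals_def un_literal_data_def comp_def)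
qed

lemma poly_time_fst_pair: "poly_time D \<mu> inp (\<lambda>z. pair_data (x z)) \<Longrightarrow> poly_time D \<mu> inp (\<lambda>z. un (fst (x z)))"
  unfolding pair_data_def using poly_time_left by fastforce

lemma poly_time_snd_pair: "poly_time D \<mu> inp (\<lambda>z. pair_data (x z)) \<Longrightarrow> poly_time D \<mu> inp (\<lambda>z. un (snd (x z)))"
  unfolding pair_data_def using poly_time_right by fastforce

lemma poly_time_sel_nodes:
  assumes r: "reads K D \<mu> inp \<pi>" and s: "poly_time D \<mu> inp (\<lambda>z. sel_data (s z))"
    and valid: "\<And>z. z \<in> D \<Longrightarrow> valid_selection (fst (\<pi> z)) (s z)"
  shows "poly_time D \<mu> inp (\<lambda>z. list_data (map nat_data (sel_nodes (fst (\<pi> z)) (s z))))"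
proof -
  have "poly_time D \<mu> inp (\<lambda>z. list_data (concat (map (\<lambda>x. map nat_data (codeword (fst (\<pi> z)) (fst x) (snd x))) (s z))))"
  proof (rule poly_time_concat_map[OF s[unfolded sel_data_def]])
    show "poly_bounded D \<mu> (\<lambda>z. length (s z))"
      by (rule poly_bounded_mono[OF poly_bounded_const[where c = K]]) (use valid in \<open>auto simp: valid_selection_def\<close>)
    show "poly_bounded (SIGMA z:D. set (s z)) (\<lambda>z. \<mu> (fst z))
        (\<lambda>z. length (map nat_data (codeword (fst (\<pi> (fst z))) (fst (snd z)) (snd (snd z)))))"
      by (rule poly_bounded_mono[OF poly_bounded_lift[OF poly_bounded_reads[OF bounded_group_nodes r]]])
        (simp add: codeword_def, rule order_trans[OF length_filter_le], simp)
    show "poly_time (SIGMA z:D. set (s z)) (\<lambda>z. \<mu> (fst z)) (\<lambda>z. Pair (pair_data (snd z)) (inp (fst z)))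
       (\<lambda>z. list_data (map nat_data (codeword (fst (\<pi> (fst z))) (fst (snd z)) (snd (snd z)))))"
      by (rule poly_time_codeword[OF reads_lift[OF r] poly_time_fst_pair[OF poly_time_elem] poly_time_snd_pair[OF poly_time_elem]])
        (use valid in \<open>fastforce simp: valid_selection_def\<close>)
  qed
  then show ?thesis by (simp add: sel_nodes_def map_concat comp_def)
qed

lemma length_sel_literals: "length (sel_literals n s) = length s * group_vars n"
  by (simp add: sel_literals_def literals_def length_concat comp_def sum_list_triv)

lemma poly_time_sel_literals:
  assumes r: "reads K D \<mu> inp \<pi>" and s: "poly_time D \<mu> inp (\<lambda>z. sel_data (s z))"
    and valid: "\<And>z. z \<in> D \<Longrightarrow> valid_selection (fst (\<pi> z)) (s z)"
  shows "poly_time D \<mu> inp (\<lambda>z. list_data (map un_literal_data (sel_literals (fst (\<pi> z)) (s z))))"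
proof -
  have "poly_time D \<mu> inp (\<lambda>z. list_data (concat (map (\<lambda>x. map un_literal_data (literals (fst (\<pi> z)) (fst x) (snd x))) (s z))))"
  proof (rule poly_time_concat_map[OF s[unfolded sel_data_def]])
    show "poly_bounded D \<mu> (\<lambda>z. length (s z))"
      by (rule poly_bounded_mono[OF poly_bounded_const[where c = K]]) (use valid in \<open>auto simp: valid_selection_def\<close>)
    show "poly_bounded (SIGMA z:D. set (s z)) (\<lambda>z. \<mu> (fst z))
        (\<lambda>z. length (map un_literal_data (literals (fst (\<pi> (fst z))) (fst (snd z)) (snd (snd z)))))"
      by (rule poly_bounded_mono[OF poly_bounded_lift[OF poly_bounded_reads[OF bounded_group_vars r]]])
        (simp add: literals_def)
    show "poly_time (SIGMA z:D. set (s z)) (\<lambda>z. \<mu> (fst z)) (\<lambda>z. Pair (pair_data (snd z)) (inp (fst z)))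
       (\<lambda>z. list_data (map un_literal_data (literals (fst (\<pi> (fst z))) (fst (snd z)) (snd (snd z)))))"
      by (rule poly_time_literals[OF reads_lift[OF r] poly_time_fst_pair[OF poly_time_elem] poly_time_snd_pair[OF poly_time_elem]])
        (use valid in \<open>fastforce simp: valid_selection_def\<close>)
  qed
  then show ?thesis by (simp add: sel_literals_def map_concat comp_def)
qed

text \<open>Keeps the unary variables polynomial. The bound exceeds \<open>n\<close> in general
  because of surplus variables.\<close>

lemma sel_literals_less:
  assumes "valid_selection n s" "x \<in> set (sel_literals n s)"
  shows "fst x < num_groups n * group_vars n"
proof -
  obtain y i where y: "y \<in> set s" "i < group_vars n" "fst x = fst y * group_vars n + i"
    using assms(2) by (auto simp: sel_literals_def literals_def)
  then have "fst y + 1 \<le> num_groups n" using assms(1) by (auto simp: valid_selection_def)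
  then have "(fst y + 1) * group_vars n \<le> num_groups n * group_vars n" by (rule mult_right_mono) simp
  with y show ?thesis by simp
qed

lemma poly_time_consistent:
  assumes r: "reads K D \<mu> inp \<pi>" and s: "poly_time D \<mu> inp (\<lambda>z. sel_data (s z))"
    and valid: "\<And>z. z \<in> D \<Longrightarrow> valid_selection (fst (\<pi> z)) (s z)"
  shows "poly_time D \<mu> inp (\<lambda>z. bool_data (consistent (fst (\<pi> z)) (snd (\<pi> z)) (s z)))"
  unfolding consistent_def
proof (intro poly_time_not poly_time_bex[where e = "\<lambda>_. clause_data"] poly_time_ball[where e = "\<lambda>_. literal_data"]
    poly_time_bex[where e = "\<lambda>_. un_literal_data"] poly_time_conj)
  show "poly_time D \<mu> inp (\<lambda>z. list_data (map clause_data (snd (\<pi> z))))"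
    by (rule poly_time_reads[OF poly_time_clauses r])
  show "poly_bounded D \<mu> (\<lambda>z. length (snd (\<pi> z)))"
    by (rule poly_bounded_reads[OF bounded_clauses r])
  \<comment> \<open>One \<open>Sigma\<close> layer per quantifier: clauses, their literals, and the
    literals of the selection.\<close>
  let ?D1 = "SIGMA z:D. set (snd (\<pi> z))"
  let ?i1 = "\<lambda>z. Pair (clause_data (snd z)) (inp (fst z))"
  have cl: "length cl \<le> K" "fst ` set cl \<subseteq> {..<fst (\<pi> z)}" if "z \<in> D" "cl \<in> set (snd (\<pi> z))" for z cl
    using r that unfolding reads_def formulas_def by blast+
  show "poly_time ?D1 (\<lambda>z. \<mu> (fst z)) ?i1 (\<lambda>z. list_data (map literal_data (snd z)))"
    unfolding clause_data_def by (rule poly_time_elem)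
  show "poly_bounded ?D1 (\<lambda>z. \<mu> (fst z)) (\<lambda>z. length (snd z))"
    by (rule poly_bounded_mono[OF poly_bounded_const[where c = K]]) (use cl in auto)
  let ?D2 = "SIGMA z:?D1. set (snd z)"
  let ?i2 = "\<lambda>z. Pair (literal_data (snd z)) (?i1 (fst z))"
  let ?lits = "\<lambda>z. sel_literals (fst (\<pi> (fst (fst z)))) (s (fst (fst z)))"
  show "poly_time ?D2 (\<lambda>z. \<mu> (fst (fst z))) ?i2 (\<lambda>z. list_data (map un_literal_data (?lits z)))"
    by (intro poly_time_lift poly_time_lift[where F = "\<lambda>z. list_data (map un_literal_data (sel_literals (fst (\<pi> z)) (s z)))"]
        poly_time_sel_literals[OF r s valid])
  have "poly_bounded D \<mu> (\<lambda>z. length (sel_literals (fst (\<pi> z)) (s z)))"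
    by (rule poly_bounded_mono[OF poly_bounded_mult[OF poly_bounded_const[where c = K] poly_bounded_reads[OF bounded_group_vars r]]])
      (use valid in \<open>auto simp: length_sel_literals valid_selection_def\<close>)
  from poly_bounded_lift[OF poly_bounded_lift[OF this]]
  show "poly_bounded ?D2 (\<lambda>z. \<mu> (fst (fst z))) (\<lambda>z. length (?lits z))" .
  let ?D3 = "SIGMA z:?D2. set (?lits z)"
  let ?i3 = "\<lambda>z. Pair (un_literal_data (snd z)) (?i2 (fst z))"
  let ?\<mu> = "\<lambda>z. \<mu> (fst (fst (fst z)))"
  have n3: "poly_bounded ?D3 ?\<mu> (\<lambda>z. fst (\<pi> (fst (fst (fst z)))))"
    by (intro poly_bounded_lift poly_bounded_lift[where f = "\<lambda>z. fst (\<pi> (fst (fst z)))"] poly_bounded_lift[where f = "\<lambda>z. fst (\<pi> (fst z))"]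
      poly_bounded_lift[where f = "\<lambda>z. fst (\<pi> z)"] poly_bounded_reads[OF bounded_n r])
  have "poly_bounded D \<mu> (\<lambda>z. num_groups (fst (\<pi> z)) * group_vars (fst (\<pi> z)))"
    by (intro poly_bounded_mult poly_bounded_reads[OF bounded_num_groups r] poly_bounded_reads[OF bounded_group_vars r])
  from poly_bounded_lift[OF poly_bounded_lift[OF poly_bounded_lift[OF this]]]
  have x: "poly_bounded ?D3 ?\<mu> (\<lambda>z. fst (snd z))"
    by (rule poly_bounded_mono) (use valid sel_literals_less in \<open>fastforce intro: less_imp_le\<close>)
  have l: "poly_bounded ?D3 ?\<mu> (\<lambda>z. fst (snd (fst z)))"
    by (rule poly_bounded_mono[OF n3]) (use cl(2) in \<open>force intro: less_imp_le\<close>)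
  have x1: "poly_time ?D3 ?\<mu> ?i3 (\<lambda>z. un (fst (snd z)))"
    using poly_time_left[OF poly_time_elem[where H = "\<lambda>z. un_literal_data (snd z)"]] by (simp add: un_literal_data_def)
  have x2: "poly_time ?D3 ?\<mu> ?i3 (\<lambda>z. bool_data (snd (snd z)))"
    using poly_time_right[OF poly_time_elem[where H = "\<lambda>z. un_literal_data (snd z)"]] by (simp add: un_literal_data_def)
  have lit: "poly_time ?D3 ?\<mu> ?i3 (\<lambda>z. literal_data (snd (fst z)))"
    by (rule poly_time_loop_acc)
  have l1: "poly_time ?D3 ?\<mu> ?i3 (\<lambda>z. un (fst (snd (fst z))))"
    by (rule poly_time_un_of_binary[OF _ l]) (use poly_time_left[OF lit] in \<open>simp add: literal_data_def\<close>)
  have l2: "poly_time ?D3 ?\<mu> ?i3 (\<lambda>z. bool_data (snd (snd (fst z))))"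
    using poly_time_right[OF lit] by (simp add: literal_data_def)
  show "poly_time ?D3 ?\<mu> ?i3 (\<lambda>z. bool_data (fst (snd z) = fst (snd (fst z))))"
    by (rule poly_time_un_eq[OF x1 l1 x l])
  show "poly_time ?D3 ?\<mu> ?i3 (\<lambda>z. bool_data (snd (snd z) = (\<not> snd (snd (fst z)))))"
    by (rule poly_time_bool_eq[OF x2 poly_time_not[OF l2]])
qed

text \<open>The recursion that matches a loop over \<open>T\<close> whose accumulator holds the
  selections of a prefix.\<close>

lemma selections_snoc:
  "selections Q (T @ [j]) = concat (map (\<lambda>s. map (\<lambda>c. (j, c) # s) [0..<Q]) (selections Q T))"
  by (simp add: selections_def)

lemma poly_time_selections:
  assumes r: "reads K D \<mu> inp \<pi>" and T: "poly_time D \<mu> inp (\<lambda>z. tuple_data (T z))"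
    and len: "\<And>z. z \<in> D \<Longrightarrow> length (T z) \<le> K"
  shows "poly_time D \<mu> inp (\<lambda>z. list_data (map sel_data (selections (2 ^ group_vars (fst (\<pi> z))) (T z))))"
proof -
  let ?Q = "\<lambda>z. 2 ^ group_vars (fst (\<pi> z))"
  have Q: "poly_time D \<mu> inp (\<lambda>z. un (?Q z))" "poly_bounded D \<mu> ?Q"
    by (rule poly_time_reads[OF poly_time_two_power_group_vars r], rule poly_bounded_reads[OF bounded_two_power_group_vars r])
  have "poly_time D \<mu> inp (\<lambda>z. list_data (map sel_data (selections (?Q z) (take (length (T z)) (T z)))))"
  proof (rule poly_time_fold_map[OF T[unfolded tuple_data_def], where acc = "\<lambda>z i. list_data (map sel_data (selections (?Q z) (take i (T z))))"])
    show "poly_time D \<mu> inp (\<lambda>z. list_data (map sel_data (selections (?Q z) (take 0 (T z)))))"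
      by (simp add: selections_def poly_time_const)
    show "poly_bounded D \<mu> (\<lambda>z. length (T z))"
      by (rule poly_bounded_mono[OF poly_bounded_const[where c = K]]) (use len in auto)
    let ?D = "{z. fst z \<in> D \<and> snd z < length (T (fst z))}"
    let ?S = "\<lambda>z. selections (?Q (fst z)) (take (snd z) (T (fst z)))"
    let ?i = "\<lambda>z. Pair (un (T (fst z) ! snd z)) (Pair (list_data (map sel_data (?S z))) (inp (fst z)))"
    let ?\<mu> = "\<lambda>z. \<mu> (fst z)"
    have Q': "poly_time ?D ?\<mu> ?i (\<lambda>z. un (?Q (fst z)))" "poly_bounded ?D ?\<mu> (\<lambda>z. ?Q (fst z))"
      by (rule poly_time_subst[OF Q(1) poly_time_loop_rest], simp, simp,
          rule poly_bounded_subst[OF Q(2)], simp, rule poly_bounded_measure)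
    have S: "poly_bounded ?D ?\<mu> (\<lambda>z. length (?S z))"
      by (rule poly_bounded_mono[OF poly_bounded_power[OF Q'(2), where c = K]])
        (use len in \<open>fastforce simp: length_selections intro: power_increasing\<close>)
    let ?G = "\<lambda>z s. map (\<lambda>c. sel_data ((T (fst z) ! snd z, c) # s)) [0..<?Q (fst z)]"
    have "poly_time ?D ?\<mu> ?i (\<lambda>z. list_data (concat (map (?G z) (?S z))))"
    proof (rule poly_time_concat_map[OF poly_time_loop_acc _ S])
      let ?D1 = "SIGMA z:?D. set (?S z)"
      let ?i1 = "\<lambda>z. Pair (sel_data (snd z)) (?i (fst z))"
      show "poly_bounded ?D1 (\<lambda>z. ?\<mu> (fst z)) (\<lambda>z. length (?G (fst z) (snd z)))"
        using poly_bounded_lift[OF Q'(2)] by simp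
      show "poly_time ?D1 (\<lambda>z. ?\<mu> (fst z)) ?i1 (\<lambda>z. list_data (?G (fst z) (snd z)))"
      proof (rule poly_time_map[OF poly_time_upt[OF poly_time_lift[OF Q'(1)] poly_bounded_lift[OF Q'(2)]]])
        let ?D2 = "SIGMA z:?D1. set [0..<?Q (fst (fst z))]"
        let ?i2 = "\<lambda>z. Pair (un (snd z)) (?i1 (fst z))"
        have "poly_time ?D2 (\<lambda>z. ?\<mu> (fst (fst z))) ?i2 (\<lambda>z. un (T (fst (fst (fst z))) ! snd (fst (fst z))))"
          by (rule poly_time_cong[OF poly_time_left[OF poly_time_loop_rest]]) simp
        moreover have "poly_time ?D2 (\<lambda>z. ?\<mu> (fst (fst z))) ?i2 (\<lambda>z. sel_data (snd (fst z)))"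
          by (rule poly_time_loop_acc)
        ultimately show "poly_time ?D2 (\<lambda>z. ?\<mu> (fst (fst z))) ?i2
            (\<lambda>z. sel_data ((T (fst (fst (fst z))) ! snd (fst (fst z)), snd z) # snd (fst z)))"
          using poly_time_elem[where H = "\<lambda>z. un (snd z)"]
          unfolding sel_data_def pair_data_def list.map list_data.simps fst_conv snd_conv by (intro poly_time_pair)
      qed (use poly_bounded_lift[OF Q'(2)] in simp)
    qed
    then show "poly_time ?D ?\<mu> ?i (\<lambda>z. list_data (map sel_data (selections (?Q (fst z)) (take (Suc (snd z)) (T (fst z))))))"
      by (rule poly_time_cong) (simp add: take_Suc_conv_app_nth selections_snoc map_concat comp_def)
  qed
  then show ?thesis by simp
qed

lemma poly_time_checker_candidates:
  assumes r: "reads K D \<mu> inp \<pi>" and T: "poly_time D \<mu> inp (\<lambda>z. tuple_data (T z))"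
    and tuple: "\<And>z. z \<in> D \<Longrightarrow> T z \<in> set (tuples K (num_groups (fst (\<pi> z))))"
  shows "poly_time D \<mu> inp (\<lambda>z. candidates_data (checker_candidates (fst (\<pi> z)) (snd (\<pi> z)) (T z)))"
proof -
  let ?S = "\<lambda>z. selections (2 ^ group_vars (fst (\<pi> z))) (T z)"
  let ?G = "\<lambda>z. filter (consistent (fst (\<pi> z)) (snd (\<pi> z))) (?S z)"
  have T_le: "length (T z) \<le> K" if "z \<in> D" for z using in_tuples[OF tuple[OF that]] by simp
  have S: "poly_time D \<mu> inp (\<lambda>z. list_data (map sel_data (?S z)))"
    by (rule poly_time_selections[OF r T T_le])
  have S': "poly_bounded D \<mu> (\<lambda>z. length (?S z))"
    by (rule poly_bounded_mono[OF poly_bounded_power[OF poly_bounded_reads[OF bounded_two_power_group_vars r], where c = K]])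
      (use T_le in \<open>fastforce simp: length_selections intro: power_increasing\<close>)
  have valid: "valid_selection (fst (\<pi> z)) s" if z: "z \<in> D" and s: "s \<in> set (?S z)" for z s
  proof -
    have T': "set (T z) \<subseteq> {..<num_groups (fst (\<pi> z))}" using in_tuples[OF tuple[OF z]] by simp
    have "map fst s = rev (T z)" using s by (simp add: set_selections)
    then have "length s = length (T z)" "fst ` set s = set (T z)" by (metis length_map length_rev, metis set_map set_rev)
    then show ?thesis using T_le[OF z] T' s by (auto simp: valid_selection_def set_selections)
  qed
  have G: "poly_time D \<mu> inp (\<lambda>z. list_data (map sel_data (?G z)))"
    by (rule poly_time_filter[OF S poly_time_consistent[OF reads_lift[OF r] poly_time_elem] S']) (use valid in auto)
  have G': "poly_bounded D \<mu> (\<lambda>z. length (?G z))"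
    by (rule poly_bounded_mono[OF S']) simp
  have "poly_time D \<mu> inp (\<lambda>z. list_data (map (\<lambda>s. Pair (list_data (map nat_data (sel_nodes (fst (\<pi> z)) s))) (rat_data 0)) (?G z)))"
    by (rule poly_time_map[OF G poly_time_pair[OF poly_time_sel_nodes[OF reads_lift[OF r] poly_time_elem] poly_time_const] G'])
      (use valid in auto)
  moreover have "poly_time D \<mu> inp (\<lambda>z. list_data (map (\<lambda>s. Pair (Pair (nat_data 0) (list_data (map nat_data (sel_nodes (fst (\<pi> z)) s)))) (rat_data 0)) (?S z)))"
    by (rule poly_time_map[OF S poly_time_pair[OF poly_time_pair[OF poly_time_const poly_time_sel_nodes[OF reads_lift[OF r] poly_time_elem]] poly_time_const] S'])
      (use valid in auto)
  ultimately have "poly_time D \<mu> inp (\<lambda>z. list_data (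
     map (\<lambda>s. Pair (list_data (map nat_data (sel_nodes (fst (\<pi> z)) s))) (rat_data 0)) (?G z) @
     map (\<lambda>s. Pair (Pair (nat_data 0) (list_data (map nat_data (sel_nodes (fst (\<pi> z)) s)))) (rat_data 0)) (?S z)))"
    by (intro poly_time_append) (use G' in simp_all)
  then show ?thesis by (simp add: candidates_data_def checker_candidates_def comp_def)
qed

lemma poly_time_checkers: "pt (\<lambda>a. list_data (map nat_data (checkers K (fst a))))"
proof -
  let ?L = "\<lambda>a. [0..<length (tuples K (num_groups (fst a)))]"
  have "pt (\<lambda>a. list_data (map (\<lambda>i. nat_data (Suc (num_groups (fst a) * (2 * weight (fst a)) + i))) (?L a)))"
  proof (rule poly_time_map[OF poly_time_upt[OF poly_time_length[where e = "\<lambda>_. tuple_data", OF poly_time_tuples bounded_tuples] bounded_tuples]])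
    show "pb (\<lambda>a. length (?L a))" by (simp add: bounded_tuples)
    have "poly_bounded (SIGMA a:formulas K. set (?L a)) (\<lambda>z. formula_measure (fst z))
        (\<lambda>z. Suc (num_groups (fst (fst z)) * (2 * weight (fst (fst z))) + snd z))"
      unfolding Suc_eq_plus1
      by (intro poly_bounded_add poly_bounded_lift[OF bounded_all_nodes] poly_bounded_snd_upt bounded_tuples poly_bounded_const)
    then show "poly_time (SIGMA a:formulas K. set (?L a)) (\<lambda>z. formula_measure (fst z))
        (\<lambda>z. Pair (un (snd z)) (formula_data (fst z)))
        (\<lambda>z. nat_data (Suc (num_groups (fst (fst z)) * (2 * weight (fst (fst z))) + snd z)))"
      by (intro poly_time_binary_of_un poly_time_un_Suc poly_time_un_add poly_time_elem
          poly_time_lift[OF poly_time_all_nodes] poly_bounded_lift[OF bounded_all_nodes])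
  qed
  then show ?thesis by (simp add: checkers_def comp_def)
qed

lemma poly_time_candidates:
  "pt (\<lambda>a. list_data (map candidates_data (candidates K p (fst a) (snd a))))"
proof -
  let ?U = "\<lambda>a. list_data (map nat_data (checkers K (fst a)))"
  let ?two = "\<lambda>a r. candidates_data [([], r), (checkers K (fst a), 1)]"
  have two: "pt (\<lambda>a. ?two a r)" for r
    unfolding candidates_data_def list.map list_data.simps fst_conv snd_conv
    by (intro poly_time_pair poly_time_const poly_time_checkers)
  have "pt (\<lambda>a. list_data (map (\<lambda>_. ?two a (-1)) (replicate (num_groups (fst a) * (2 * weight (fst a))) Atom)))"
    by (rule poly_time_map[OF poly_time_un_list[OF poly_time_all_nodes] poly_time_lift[OF two]])
      (simp add: bounded_all_nodes)
  then have groups: "pt (\<lambda>a. list_data (replicate (num_groups (fst a) * (2 * weight (fst a))) (?two a (-1))))"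
    by (simp add: map_replicate_const)
  have checkers: "pt (\<lambda>a. list_data (map (\<lambda>T. candidates_data (checker_candidates (fst a) (snd a) T)) (tuples K (num_groups (fst a)))))"
    by (rule poly_time_map[OF poly_time_tuples poly_time_checker_candidates[OF reads_lift[OF reads_self] poly_time_elem] bounded_tuples])
      auto
  have "pt (\<lambda>a. Pair (?two a 0) (list_data (replicate (num_groups (fst a) * (2 * weight (fst a))) (?two a (-1)) @
     map (\<lambda>T. candidates_data (checker_candidates (fst a) (snd a) T)) (tuples K (num_groups (fst a))) @
     replicate p (candidates_data [([], 0)]))))"
    by (intro poly_time_pair two poly_time_append[OF groups] poly_time_append[OF checkers] poly_time_const)
      (simp_all add: bounded_tuples bounded_all_nodes)
  then show ?thesis by (simp add: candidates_def comp_def)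
qed

end

definition arc_data :: "nat \<times> nat \<Rightarrow> data" where
  "arc_data x = Pair (nat_data (fst x)) (nat_data (snd x))"

text \<open>The first component is the number of nodes; it is not part of the input and serves only
  as measure, bounding the repetition-free arc list by its square. A head is compared with 0 by a
  single test, as \<open>nat_data 0\<close> is \<open>Atom\<close>.\<close>

lemma poly_time_arc_into_0:
  "poly_time {a. distinct (snd a) \<and> set (snd a) \<subseteq> {..<fst a} \<times> {..<fst a}} fst
     (\<lambda>a. list_data (map arc_data (snd a))) (\<lambda>a. bool_data (\<exists>x\<in>set (snd a). snd x = 0))"
proof (rule poly_time_bex[OF poly_time_id])
  let ?D = "{a. distinct (snd a) \<and> set (snd a) \<subseteq> {..<fst a} \<times> {..<fst a}}"
  show "poly_bounded ?D fst (\<lambda>a. length (snd a))"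
  proof (rule poly_bounded_mono[OF poly_bounded_mult[OF poly_bounded_measure poly_bounded_measure]])
    fix a :: "nat \<times> (nat \<times> nat) list" assume a: "a \<in> ?D"
    then have "length (snd a) = card (set (snd a))" by (simp add: distinct_card)
    also have "\<dots> \<le> card ({..<fst a} \<times> {..<fst a})" using a by (intro card_mono) auto
    finally show "length (snd a) \<le> fst a * fst a" by (simp add: card_cartesian_product)
  qed
  have "(if right (arc_data x) \<noteq> Atom then bool_data False else bool_data True) = bool_data (snd x = 0)" for x
    by (simp add: arc_data_def nat_data.simps)
  then show "poly_time (SIGMA a:?D. set (snd a)) (\<lambda>z. fst (fst z))
     (\<lambda>z. Pair (arc_data (snd z)) (list_data (map arc_data (snd (fst z))))) (\<lambda>z. bool_data (snd (snd z) = 0))"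
    by (intro poly_time_cong[OF poly_time_if[OF poly_time_right[OF poly_time_elem] poly_time_const poly_time_const]])
qed

section \<open>Solving satisfiability with a BNSL solver\<close>

text \<open>A subset with at most \<open>k\<close> elements is the content of a list of length
  exactly \<open>k\<close>, padded with \<open>None\<close>.\<close>

lemma card_bounded_subsets_le:
  assumes "finite A"
  shows "finite {S. S \<subseteq> A \<and> card S \<le> k} \<and> card {S. S \<subseteq> A \<and> card S \<le> k} \<le> (card A + 1) ^ k"
proof -
  let ?B = "insert None (Some ` A)"
  let ?l = "{l. set l \<subseteq> ?B \<and> length l = k}"
  have B: "finite ?B" "card ?B = card A + 1" using assms by (auto simp: card_image)
  have "{S. S \<subseteq> A \<and> card S \<le> k} \<subseteq> (\<lambda>l. {x. Some x \<in> set l}) ` ?l"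
  proof
    fix S assume S: "S \<in> {S. S \<subseteq> A \<and> card S \<le> k}"
    then have "finite S" using finite_subset[OF _ assms] by simp
    then obtain xs where xs: "set xs = S" "distinct xs" using finite_distinct_list by metis
    let ?l = "map Some xs @ replicate (k - length xs) None"
    have "length xs \<le> k" using S xs distinct_card by fastforce
    then show "S \<in> (\<lambda>l. {x. Some x \<in> set l}) ` {l. set l \<subseteq> ?B \<and> length l = k}"
      using S xs by (intro image_eqI[of _ _ ?l]) auto
  qed
  note sub = this
  have l: "finite ?l" by (rule finite_lists_length_eq[OF B(1)])
  have "card ?l = (card A + 1) ^ k" using card_lists_length_eq[OF B(1), of k] by (simp only: B(2))
  then show ?thesis
    using finite_subset[OF sub finite_imageI[OF l]] card_mono[OF finite_imageI[OF l] sub]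
      card_image_le[OF l, of "\<lambda>l. {x. Some x \<in> set l}"] by simp
qed

lemma k_cnf_card_le:
  assumes "k_cnf k n F"
  shows "card F \<le> (2 * n + 1) ^ k"
proof -
  let ?A = "{..<n} \<times> (UNIV :: bool set)"
  have "F \<subseteq> {S. S \<subseteq> ?A \<and> card S \<le> k}" using assms by (auto simp: k_cnf_def)
  then have "card F \<le> card {S. S \<subseteq> ?A \<and> card S \<le> k}"
    using card_bounded_subsets_le[of ?A k] by (intro card_mono) auto
  also have "\<dots> \<le> (card ?A + 1) ^ k" using card_bounded_subsets_le[of ?A k] by simp
  also have "card ?A = 2 * n" by (simp add: card_cartesian_product)
  finally show ?thesis by simp
qed

text \<open>Turns a relational encoding into a list of concrete objects that determine both the
  coded value and the tree.\<close>

lemma list_all2_functional: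
  assumes "\<And>a x. R a x \<Longrightarrow> \<exists>b. P b \<and> f b = a \<and> g b = x"
  shows "list_all2 R as xs \<Longrightarrow> \<exists>bs. (\<forall>b\<in>set bs. P b) \<and> map f bs = as \<and> map g bs = xs"
proof (induction rule: list_all2_induct)
  case (Cons a as x xs)
  obtain b where "P b" "f b = a" "g b = x" using assms[OF Cons.hyps(1)] by blast
  with Cons.IH show ?case by (metis list.simps(9) set_ConsD)
qed simp

text \<open>The arbitrary order in which the input lists clauses and literals is fixed as
  \<open>Fl\<close>, on which the reduction operates. \<open>K\<close> may exceed \<open>k\<close>
  so that it can be taken positive.\<close>

lemma k_cnf_sat_input:
  assumes "k_cnf_sat k n x Q" "k \<le> K"
  obtains Fl where "(n, Fl) \<in> formulas K" "x = formula_data (n, Fl)"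
    "Q = (\<lambda>y. y \<noteq> Atom \<longleftrightarrow> satisfiable (set ` set Fl))"
proof -
  from assms(1) obtain F where F: "k_cnf k n F"
    "pair_code nat_code (set_code (set_code (pair_code nat_code bool_code))) (n, F) x"
    "Q = (\<lambda>y. y \<noteq> Atom \<longleftrightarrow> satisfiable F)"
    unfolding k_cnf_sat_def by blast
  then obtain as xs where as: "distinct as" "set as = F" "x = Pair (nat_data n) (list_data xs)"
    "list_all2 (set_code (pair_code nat_code bool_code)) as xs"
    by (auto simp: pair_code_def nat_code_def set_code_def)
  have literal: "\<exists>b. True \<and> b = l \<and> literal_data b = y" if "pair_code nat_code bool_code l y" for l y
    using that by (auto simp: pair_code_def nat_code_def bool_code_def literal_data_def)
  have clause: "\<exists>cl. distinct cl \<and> set cl = c \<and> clause_data cl = y"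
    if "set_code (pair_code nat_code bool_code) c y" for c y
  proof -
    from that obtain ls ys where "distinct ls" "set ls = c" "list_all2 (pair_code nat_code bool_code) ls ys" "y = list_data ys"
      by (auto simp: set_code_def)
    moreover from this have "map literal_data ls = ys"
      using list_all2_functional[where f = "\<lambda>b. b" and g = literal_data, OF literal] by fastforce
    ultimately show ?thesis by (auto simp: clause_data_def)
  qed
  obtain Fl where Fl: "\<forall>cl\<in>set Fl. distinct cl" "map set Fl = as" "map clause_data Fl = xs"
    using list_all2_functional[where P = distinct, OF clause as(4)] by blast
  have F_eq: "F = set ` set Fl" using as(2) Fl(2) by auto
  have "length Fl = card F" using Fl(2) as(1,2) by (metis distinct_card length_map)
  also have "\<dots> \<le> (2 * n + 1) ^ k" by (rule k_cnf_card_le[OF F(1)])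
  also have "\<dots> \<le> (2 * n + 1) ^ K" using assms(2) by (intro power_increasing) auto
  finally have "length Fl \<le> (2 * n + 1) ^ K" .
  moreover have "length cl \<le> K \<and> fst ` set cl \<subseteq> {..<n}" if cl: "cl \<in> set Fl" for cl
  proof -
    have "set cl \<in> F" using cl F_eq by blast
    then have "set cl \<subseteq> {..<n} \<times> UNIV" "card (set cl) \<le> k" using F(1) by (auto simp: k_cnf_def)
    then show ?thesis using Fl(1) cl assms(2) by (auto simp: distinct_card)
  qed
  ultimately have "(n, Fl) \<in> formulas K" by (simp add: formulas_def)
  moreover have "x = formula_data (n, Fl)" using as(3) Fl(3) by (simp add: formula_data_def)
  ultimately show thesis using that F(3) F_eq by blast
qed

lemma arcs_output:
  assumes "set_code (pair_code nat_code nat_code) A y" "A \<subseteq> {..<N} \<times> {..<N}"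
  obtains as where "distinct as" "set as = A" "y = list_data (map arc_data as)"
proof -
  from assms(1) obtain as ys where as: "distinct as" "set as = A" "list_all2 (pair_code nat_code nat_code) as ys" "y = list_data ys"
    by (auto simp: set_code_def)
  have "\<exists>b. True \<and> b = l \<and> arc_data b = y" if "pair_code nat_code nat_code l y" for l y
    using that by (auto simp: pair_code_def nat_code_def arc_data_def)
  from list_all2_functional[where f = "\<lambda>b. b" and g = arc_data, OF this as(3)] have "map arc_data as = ys" by auto
  with as that show thesis by blast
qed

definition parent_sets_bound :: "nat \<Rightarrow> nat \<Rightarrow> nat" where
  "parent_sets_bound K n = 2 + num_groups n * (2 * weight n) * 2 +
     (num_groups n + 1) ^ K * (2 * (2 ^ group_vars n) ^ K)"

text \<open>The programs are simply concatenated. The solver is specified only for a clean store,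
  which it receives because \<open>c1\<close> restores everything but variable \<open>0\<close>; the
  final test tolerates whatever store the solver leaves behind.\<close>

lemma solves_k_cnf_sat:
  assumes c: "solves_within c (bnsl b f) T" and b: "\<And>n. 1 \<le> b n"
    and K: "0 < K" "k \<le> K"
    and bound: "\<And>n. real (parent_sets_bound K n + p) \<le> 2 powr f (num_nodes K p n)"
  obtains c' i j where "solves_within c' (k_cnf_sat k)
    (\<lambda>n. (2 ^ (2 * weight n) + 2) ^ i + T (num_nodes K p n) + (num_nodes K p n + 2) ^ j)"
proof -
  obtain c1 i where c1: "\<And>a \<sigma>. a \<in> formulas K \<Longrightarrow> \<sigma> 0 = formula_data a \<Longrightarrow>
      exec_within c1 \<sigma> ((formula_measure a + 2) ^ i) (\<sigma>(0 := list_data (map candidates_data (candidates K p (fst a) (snd a)))))"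
    using poly_time_candidates[of K p] by (elim poly_timeE poly_boundedE) (use exec_within_mono in blast)
  obtain c2 j where c2: "\<And>a \<sigma>. distinct (snd a) \<Longrightarrow> set (snd a) \<subseteq> {..<fst a} \<times> {..<fst a} \<Longrightarrow> \<sigma> 0 = list_data (map arc_data (snd a)) \<Longrightarrow>
      exec_within c2 \<sigma> ((fst a + 2) ^ j) (\<sigma>(0 := bool_data (\<exists>x\<in>set (snd a). snd x = 0)))"
    using poly_time_arc_into_0 by (elim poly_timeE poly_boundedE) (use exec_within_mono in blast)
  let ?T = "\<lambda>n. (2 ^ (2 * weight n) + 2) ^ i + T (num_nodes K p n) + (num_nodes K p n + 2) ^ j"
  have "solves_within (Seq c1 (Seq c c2)) (k_cnf_sat k) ?T"
    unfolding solves_within_def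
  proof (intro allI impI)
    fix n x Q assume "k_cnf_sat k n x Q"
    then obtain Fl where Fl: "(n, Fl) \<in> formulas K" "x = formula_data (n, Fl)"
      "Q = (\<lambda>y. y \<noteq> Atom \<longleftrightarrow> satisfiable (set ` set Fl))"
      using k_cnf_sat_input[OF _ K(2)] by metis
    let ?N = "num_nodes K p n"
    let ?r = "list_data (map candidates_data (candidates K p n Fl))"
    have "length cl \<le> K \<and> fst ` set cl \<subseteq> {..<n}" if "cl \<in> set Fl" for cl
      using Fl(1) that by (auto simp: formulas_def)
    from bnsl_candidates[where b = b and f = f and K = K and p = p and n = n and Fl = Fl,
        OF K(1) this b bound[of n, unfolded parent_sets_bound_def]]
    obtain ok where ok: "bnsl b f ?N ?r ok"
      "\<And>y. ok y \<Longrightarrow> \<exists>A. set_code (pair_code nat_code nat_code) A y \<and> A \<subseteq> {..<?N} \<times> {..<?N} \<and>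
        ((\<exists>j. (j, 0) \<in> A) \<longleftrightarrow> satisfiable (set ` set Fl))" by metis
    let ?\<sigma> = "\<lambda>x. (\<lambda>_. Atom)(0 := x) :: store"
    have e1: "exec_within c1 (?\<sigma> x) ((2 ^ (2 * weight n) + 2) ^ i) (?\<sigma> ?r)"
      using c1[OF Fl(1), of "?\<sigma> x"] Fl(2) by (simp add: formula_measure_def)
    from c ok(1) obtain t y where y: "runs c ?r t y" "t \<le> T ?N" "ok y"
      unfolding solves_within_def by blast
    then obtain \<tau> where \<tau>: "exec c (?\<sigma> ?r) t \<tau>" "\<tau> 0 = y" unfolding runs_def by blast
    with y(2) have e: "exec_within c (?\<sigma> ?r) (T ?N) \<tau>" unfolding exec_within_def by blast
    from ok(2)[OF y(3)] obtain A where A: "set_code (pair_code nat_code nat_code) A y" "A \<subseteq> {..<?N} \<times> {..<?N}"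
      "(\<exists>j. (j, 0) \<in> A) \<longleftrightarrow> satisfiable (set ` set Fl)" by blast
    from arcs_output[OF A(1,2)] obtain as where as: "distinct as" "set as = A" "y = list_data (map arc_data as)" .
    have e2: "exec_within c2 \<tau> ((?N + 2) ^ j) (\<tau>(0 := bool_data (\<exists>x\<in>A. snd x = 0)))"
      using c2[of "(?N, as)" \<tau>] as A(2) \<tau>(2) by simp
    have "exec_within (Seq c1 (Seq c c2)) (?\<sigma> x) (?T n) (\<tau>(0 := bool_data (\<exists>x\<in>A. snd x = 0)))"
      using exec_within_seq[OF e1 exec_within_seq[OF e e2]] by (simp add: add.assoc)
    then obtain t' where t': "t' \<le> ?T n" "exec (Seq c1 (Seq c c2)) (?\<sigma> x) t' (\<tau>(0 := bool_data (\<exists>x\<in>A. snd x = 0)))"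
      unfolding exec_within_def by blast
    then have "runs (Seq c1 (Seq c c2)) x t' (bool_data (\<exists>x\<in>A. snd x = 0))"
      unfolding runs_def
      by (intro exI[of _ "\<tau>(0 := bool_data (\<exists>x\<in>A. snd x = 0))"] conjI t'(2)) simp
    moreover have "Q (bool_data (\<exists>x\<in>A. snd x = 0))" using A(3) by (force simp: Fl(3))
    ultimately show "\<exists>t y. runs (Seq c1 (Seq c c2)) x t y \<and> t \<le> ?T n \<and> Q y" using t'(1) by blast
  qed
  then show thesis by (rule that)
qed

section \<open>Asymptotics\<close>

lemma num_groups_real:
  assumes "2 \<le> n"
  shows "log 2 (real n) \<le> real (num_groups n)" "real (num_groups n) \<le> log 2 (real n) + 1"
proof -
  have "real n \<le> real (2 ^ num_groups n)"
    using less_two_power_bits[of n] unfolding num_groups_def of_nat_le_iff by simp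
  then have "real n \<le> 2 powr real (num_groups n)" by (simp add: powr_realpow)
  then show "log 2 (real n) \<le> real (num_groups n)" using assms by (simp add: log_le_iff)
  have "num_groups n \<noteq> 0" using assms num_groups_eq_0_iff by auto
  then have "2 ^ (num_groups n - 1) \<le> n" unfolding num_groups_def by (intro two_power_bits_le) auto
  then have "real (2 ^ (num_groups n - 1)) \<le> real n" by (rule of_nat_mono)
  then have "2 powr real (num_groups n - 1) \<le> real n" by (simp add: powr_realpow)
  then have "real (num_groups n - 1) \<le> log 2 (real n)" using assms by (simp add: le_log_iff)
  then show "real (num_groups n) \<le> log 2 (real n) + 1" using \<open>num_groups n \<noteq> 0\<close> by (simp add: of_nat_diff)
qed

lemma weight_real:
  assumes "2 \<le> n"
  shows "real (num_groups n) * real (2 * weight n) \<le> n + 2 * real (num_groups n) ^ 2 + 6 * real (num_groups n)"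
    and "real (2 * weight n) \<le> n / log 2 n + 2 * log 2 n + 8"
proof -
  let ?L = "real (num_groups n)" and ?x = "log 2 (real n)"
  have x: "1 \<le> ?x" "?x \<le> ?L" "?L \<le> ?x + 1" using num_groups_real[OF assms] assms by simp_all
  have "real (half_size n) \<le> real (n div (2 * num_groups n) + 1)" by (rule of_nat_mono[OF half_size_le])
  also have "\<dots> \<le> n / (2 * ?L) + 1" using of_nat_div_le_of_nat[of n "2 * num_groups n", where 'a = real] by simp
  finally have w: "real (2 * weight n) \<le> n / ?L + 2 * ?L + 6" by (simp add: weight_def)
  then have "?L * real (2 * weight n) \<le> ?L * (n / ?L + 2 * ?L + 6)" using x by (intro mult_left_mono) auto
  also have "\<dots> = n + 2 * ?L ^ 2 + 6 * ?L" using x by (simp add: field_simps power2_eq_square)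
  finally show "?L * real (2 * weight n) \<le> n + 2 * ?L ^ 2 + 6 * ?L" .
  have "n / ?L \<le> n / ?x" using x by (intro divide_left_mono mult_pos_pos) auto
  with w x show "real (2 * weight n) \<le> n / ?x + 2 * ?x + 8" by linarith
qed

text \<open>Bound on the nodes in excess of \<open>n\<close>, polylogarithmic since groups are
  logarithmic and checkers polynomial in them.\<close>

definition overhead :: "nat \<Rightarrow> nat \<Rightarrow> nat \<Rightarrow> real" where
  "overhead K p n = 1 + 2 * (log 2 (real n) + 1) ^ 2 + 6 * (log 2 (real n) + 1) + (log 2 (real n) + 2) ^ K + real p"

lemma num_nodes_le:
  assumes "2 \<le> n"
  shows "real (num_nodes K p n) \<le> n + overhead K p n"
proof -
  let ?L = "real (num_groups n)" and ?x = "log 2 (real n)"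
  have x: "1 \<le> ?x" "?x \<le> ?L" "?L \<le> ?x + 1" using num_groups_real[OF assms] assms by simp_all
  have "real (length (tuples K (num_groups n))) \<le> (?L + 1) ^ K"
    using of_nat_mono[OF length_tuples_le[of K "num_groups n"], where 'a = real] by (simp add: add.commute)
  also have "\<dots> \<le> (?x + 2) ^ K" using x by (intro power_mono) auto
  finally have "real (length (tuples K (num_groups n))) \<le> (?x + 2) ^ K" .
  moreover have "?L ^ 2 \<le> (?x + 1) ^ 2" using x by (intro power_mono) auto
  moreover have "real (num_nodes K p n) = 1 + ?L * real (2 * weight n) + real (length (tuples K (num_groups n))) + p"
    by (simp add: num_nodes_def)
  moreover have "N \<le> n + (1 + 2 * B + 6 * (?x + 1) + C + p)"
    if "t \<le> C" "A \<le> B" "N = 1 + W + t + p" "W \<le> n + 2 * A + 6 * ?L" for t A B C N W :: real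
  proof -
    have "6 * ?L \<le> 6 * (?x + 1)" using x(3) by simp
    then show ?thesis using that by linarith
  qed
  ultimately show ?thesis using weight_real(1)[OF assms] unfolding overhead_def by blast
qed

lemma num_nodes_ge: "n + p \<le> num_nodes K p n"
proof -
  have "num_groups n * group_vars n \<le> num_groups n * (2 * weight n)"
    by (intro mult_left_mono) (simp_all add: group_vars_def weight_def)
  then show ?thesis using num_vars_le[of n] unfolding num_nodes_def by linarith
qed

lemma overhead_smallo: "overhead K p \<in> o(\<lambda>n. real n)"
proof -
  have "(\<lambda>n. 1 + 2 * (log 2 (real n) + 1) ^ 2 + 6 * (log 2 (real n) + 1)) \<in> o(\<lambda>n. real n)"
    by real_asymp
  moreover have "(\<lambda>n. (log 2 (real n) + 2) ^ K) \<in> o(\<lambda>n. real n)" by real_asymp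
  moreover have "(\<lambda>n. real p) \<in> o(\<lambda>n. real n)" by real_asymp
  ultimately show ?thesis unfolding overhead_def[abs_def] using sum_in_smallo(1) by blast
qed

lemma eventually_smallo_le:
  fixes g h :: "nat \<Rightarrow> real"
  assumes "g \<in> o(h)" "0 < c" "\<And>n. 0 \<le> h n"
  shows "\<forall>\<^sub>F n in sequentially. g n \<le> c * h n"
  using landau_o.smallD[OF assms(1,2)] by eventually_elim (use assms(3) in \<open>simp add: abs_le_iff\<close>)

text \<open>Below \<open>n\<close> and above every constant multiple of \<open>n / log n\<close>, so
  that one choice suits all clause widths. The \<open>3\<close> keeps the logarithm at least 1, also
  for small arguments.\<close>

definition exponent :: "nat \<Rightarrow> real" where
  "exponent n = real n / sqrt (ln (real n + 3))"

lemma exponent_smallo: "exponent \<in> o(\<lambda>n. real n)"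
  unfolding exponent_def by real_asymp

lemma exponent_nonneg: "0 \<le> exponent n"
  unfolding exponent_def by simp

text \<open>Transfers bounds at \<open>n\<close> and at \<open>p\<close> to the number of nodes,
  which is at least \<open>n + p\<close>.\<close>

lemma exponent_mono:
  assumes "n \<le> n'"
  shows "exponent n \<le> exponent n'"
proof -
  have deriv: "\<exists>d. ((\<lambda>x. x / sqrt (ln (x + 3))) has_real_derivative d) (at x) \<and> 0 \<le> d" if "0 \<le> x" for x :: real
  proof -
    define l where "l = ln (x + 3)"
    have "exp 1 \<le> (3::real)" using exp_le by simp
    then have "1 \<le> ln (3::real)" by (subst ln_ge_iff) auto
    also have "\<dots> \<le> l" using that by (simp add: l_def)
    finally have l: "1 \<le> l" .
    let ?d = "(sqrt l - x * (inverse (sqrt l) / 2 * (1 / (x + 3)))) / (sqrt l * sqrt l)"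
    have "((\<lambda>x. x / sqrt (ln (x + 3))) has_real_derivative ?d) (at x)"
      using l that unfolding l_def
      by (auto intro!: derivative_eq_intros simp: divide_simps)
    moreover have "0 \<le> ?d"
    proof -
      have "x * (inverse (sqrt l) / 2 * (1 / (x + 3))) = (x / (x + 3)) * (inverse (sqrt l) / 2)" by simp
      also have "\<dots> \<le> 1 * 1"
      proof (intro mult_mono)
        have "inverse (sqrt l) \<le> inverse 1" using real_sqrt_ge_one[OF l] by (rule le_imp_inverse_le) simp
        then show "inverse (sqrt l) / 2 \<le> 1" by simp
      qed (use that l in auto)
      also have "\<dots> \<le> sqrt l" using l by simp
      finally show ?thesis by simp
    qed
    ultimately show ?thesis by blast
  qed
  have "(\<lambda>x. x / sqrt (ln (x + 3))) (real n) \<le> (\<lambda>x. x / sqrt (ln (x + 3))) (real n')"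
  proof (rule DERIV_nonneg_imp_nondecreasing[where f = "\<lambda>x. x / sqrt (ln (x + 3))"])
    show "real n \<le> real n'" using assms by simp
    fix x assume "real n \<le> x"
    then have "0 \<le> x" by (rule order_trans[rotated]) simp
    then show "\<exists>d. ((\<lambda>x. x / sqrt (ln (x + 3))) has_real_derivative d) (at x) \<and> 0 \<le> d" by (rule deriv)
  qed
  then show ?thesis by (simp add: exponent_def)
qed

lemma parent_sets_bound_le:
  "real (parent_sets_bound K n) \<le> 2 powr (3 + real (Suc K) * real (num_groups n + 2 * weight n))"
proof -
  let ?L = "num_groups n" and ?w = "2 * weight n"
  \<comment> \<open>Bounds both \<open>?L * ?w\<close> and the base of the \<open>K\<close>-th
    powers. The exponent \<open>Suc K\<close> ensures that \<open>X\<close> itself is covered when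
    \<open>K = 0\<close>.\<close>
  define X where "X = (2::nat) ^ (?L + ?w)"
  have X1: "1 \<le> X" by (simp add: X_def)
  then have XK: "1 \<le> X ^ Suc K" "X \<le> X ^ Suc K" by (simp_all add: one_le_power)
  have "?L < 2 ^ ?L" "?w < 2 ^ ?w" by (rule less_exp)+
  then have "?L * ?w \<le> X" unfolding X_def power_add by (intro mult_mono) auto
  moreover have "(?L + 1) ^ K * (2 ^ group_vars n) ^ K \<le> X ^ Suc K"
  proof -
    have "(?L + 1) * 2 ^ group_vars n \<le> 2 ^ ?L * 2 ^ ?w"
      using Suc_leI[OF \<open>?L < 2 ^ ?L\<close>] by (intro mult_mono power_increasing) (auto simp: group_vars_def weight_def)
    then have "((?L + 1) * 2 ^ group_vars n) ^ K \<le> X ^ K" unfolding X_def power_add by (intro power_mono) auto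
    also have "\<dots> \<le> X ^ Suc K" using X1 by (intro power_increasing) auto
    finally show ?thesis by (simp only: power_mult_distrib)
  qed
  ultimately have "parent_sets_bound K n \<le> 2 * X ^ Suc K + X ^ Suc K * 2 + 2 * X ^ Suc K"
    unfolding parent_sets_bound_def using XK by linarith
  also have "\<dots> \<le> 2 ^ 3 * X ^ Suc K" by simp
  also have "\<dots> = 2 ^ (3 + Suc K * (?L + ?w))" 
    unfolding X_def by (simp only: power_add[of 2 3] power_mult[symmetric] mult.commute[of "Suc K"])
  finally have "real (parent_sets_bound K n) \<le> real (2 ^ (3 + Suc K * (?L + ?w)))" by (rule of_nat_mono)
  also have "\<dots> = 2 powr real (3 + Suc K * (?L + ?w))"
    by (simp only: powr_realpow[OF zero_less_numeral] of_nat_power of_nat_numeral)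
  finally show ?thesis by (simp only: of_nat_add of_nat_mult of_nat_numeral)
qed

text \<open>The \<open>- 1\<close> in the exponent halves the bound; the other half is reserved for
  the parent sets of padding nodes.\<close>

lemma eventually_parent_sets_bound_le:
  "\<forall>\<^sub>F n in sequentially. real (parent_sets_bound K n) \<le> 2 powr (exponent n - 1)"
proof -
  let ?g = "\<lambda>n. real n / log 2 (real n) + 3 * log 2 (real n) + 9"
  have "?g \<in> o(exponent)" unfolding exponent_def by real_asymp
  then have "\<forall>\<^sub>F n in sequentially. ?g n \<le> 1 / (2 * real (Suc K)) * exponent n"
    by (rule eventually_smallo_le) (simp_all add: exponent_nonneg)
  moreover have "\<forall>\<^sub>F n in sequentially. 8 \<le> exponent n" unfolding exponent_def by real_asymp
  ultimately show ?thesis using eventually_ge_at_top[of 2]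
  proof eventually_elim
    case (elim n)
    have "real (num_groups n + 2 * weight n) \<le> ?g n"
      using num_groups_real(2)[OF elim(3)] weight_real(2)[OF elim(3)] by simp
    then have "real (Suc K) * real (num_groups n + 2 * weight n) \<le> real (Suc K) * (1 / (2 * real (Suc K)) * exponent n)"
      using elim(1) by (intro mult_left_mono) linarith+
    also have "\<dots> = exponent n / 2" by (simp add: field_simps del: of_nat_Suc)
    finally have "3 + real (Suc K) * real (num_groups n + 2 * weight n) \<le> exponent n - 1"
      using elim(2) by linarith
    then show ?case using order_trans[OF parent_sets_bound_le powr_mono] by simp
  qed
qed

text \<open>Isolated padding nodes make the instances that come from the finitely many small formulas
  large enough for the bound on the number of parent sets.\<close>

lemma exists_padding:
  obtains p where "\<And>n. real (parent_sets_bound K n + p) \<le> 2 powr exponent (num_nodes K p n)"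
proof -
  obtain n0 where n0: "\<And>n. n0 \<le> n \<Longrightarrow> real (parent_sets_bound K n) \<le> 2 powr (exponent n - 1)"
    using eventually_parent_sets_bound_le unfolding eventually_sequentially by blast
  define M where "M = Max ((\<lambda>n. real (parent_sets_bound K n)) ` {..n0})"
  have "filterlim (\<lambda>p. 2 powr (exponent p - 1)) at_top sequentially"
    unfolding exponent_def by real_asymp
  then have "\<forall>\<^sub>F p in sequentially. M \<le> 2 powr (exponent p - 1)" by (simp add: filterlim_at_top)
  moreover have "\<forall>\<^sub>F p in sequentially. real p \<le> 2 powr (exponent p - 1)" unfolding exponent_def by real_asymp
  ultimately have "\<forall>\<^sub>F p in sequentially. M \<le> 2 powr (exponent p - 1) \<and> real p \<le> 2 powr (exponent p - 1)"
    by (rule eventually_conj)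
  \<comment> \<open>The first condition settles the small formulas. The second accounts for the
    padding itself, since each padding node adds one parent set.\<close>
  then obtain p where p: "M \<le> 2 powr (exponent p - 1)" "real p \<le> 2 powr (exponent p - 1)"
    using eventually_happens'[OF sequentially_bot] by blast
  show thesis
  proof (rule that)
    fix n
    let ?N = "num_nodes K p n"
    have "exponent n \<le> exponent ?N" "exponent p \<le> exponent ?N"
      using num_nodes_ge[of n p K] by (auto intro: exponent_mono)
    then have le: "2 powr (exponent n - 1) \<le> 2 powr (exponent ?N - 1)" "2 powr (exponent p - 1) \<le> 2 powr (exponent ?N - 1)"
      by (auto intro: powr_mono)
    have "real (parent_sets_bound K n) \<le> 2 powr (exponent ?N - 1)"
    proof (cases "n0 \<le> n")
      case True
      then show ?thesis using n0 le(1) order_trans by blast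
    next
      case False
      then have "real (parent_sets_bound K n) \<le> M" unfolding M_def by (intro Max_ge) auto
      then show ?thesis using p(1) le(2) by linarith
    qed
    then have "real (parent_sets_bound K n + p) \<le> 2 * 2 powr (exponent ?N - 1)"
      unfolding of_nat_add using p(2) le(2) by linarith
    also have "\<dots> = 2 powr exponent ?N" by (simp add: powr_diff)
    finally show "real (parent_sets_bound K n + p) \<le> 2 powr exponent ?N" .
  qed
qed

lemma bigo_powr_mono:
  fixes g :: "nat \<Rightarrow> real"
  assumes "\<forall>\<^sub>F n in sequentially. g n \<le> h n"
  shows "(\<lambda>n. 2 powr g n) \<in> O(\<lambda>n. 2 powr h n)"
  by (rule bigoI[where c = 1]) (use assms in \<open>eventually_elim, simp\<close>)

text \<open>The gap between the two exponents absorbs the \<open>o(n)\<close> additional nodes in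
  the solver's time; building the instance and decoding take \<open>2 ^ o(n)\<close>.\<close>

lemma reduction_time:
  assumes T: "(\<lambda>n. real (T n)) \<in> O(\<lambda>n. 2 powr (\<delta> * real n))" and \<delta>: "\<delta> < \<delta>'" "0 < \<delta>'"
  shows "(\<lambda>n. real ((2 ^ (2 * weight n) + 2) ^ i + T (num_nodes K p n) + (num_nodes K p n + 2) ^ j))
    \<in> O(\<lambda>n. 2 powr (\<delta>' * real n))"
proof -
  let ?N = "num_nodes K p"
  \<comment> \<open>\<delta> may be negative, in which case more nodes would decrease the bound;
    \<open>d\<close> is safe for estimates from above.\<close>
  define d where "d = max \<delta> 0"
  have d: "0 \<le> d" "\<delta> \<le> d" "d < \<delta>'" using \<delta> by (auto simp: d_def)
  have N: "\<forall>\<^sub>F n in sequentially. real (?N n) \<le> n + overhead K p n"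
    using eventually_ge_at_top[of 2] by eventually_elim (rule num_nodes_le)
  have "filterlim ?N at_top sequentially"
    by (rule filterlim_at_top_mono[OF filterlim_ident])
      (use num_nodes_ge[of _ p K] in \<open>auto intro!: always_eventually intro: order_trans[OF le_add1]\<close>)
  from landau_o.big.compose[OF T this]
  have "(\<lambda>n. real (T (?N n))) \<in> O(\<lambda>n. 2 powr (\<delta> * real (?N n)))" .
  also have "(\<lambda>n. 2 powr (\<delta> * real (?N n))) \<in> O(\<lambda>n. 2 powr (\<delta>' * real n))"
  proof (rule bigo_powr_mono)
    \<comment> \<open>Chosen so that \<open>d\<close> times the overhead is at most
      \<open>(\<delta>' - d) * n\<close>; the \<open>+ 1\<close> avoids division by 0 when
      \<open>d = 0\<close>.\<close>
    have "\<forall>\<^sub>F n in sequentially. overhead K p n \<le> (\<delta>' - d) / (d + 1) * real n"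
      by (rule eventually_smallo_le[OF overhead_smallo]) (use d in auto)
    with N show "\<forall>\<^sub>F n in sequentially. \<delta> * real (?N n) \<le> \<delta>' * real n"
    proof eventually_elim
      case (elim n)
      have "\<delta> * real (?N n) \<le> d * real (?N n)" using d by (intro mult_right_mono) auto
      also have "\<dots> \<le> d * (n + (\<delta>' - d) / (d + 1) * real n)" using d elim by (intro mult_left_mono) auto
      also have "\<dots> = d * n + d / (d + 1) * ((\<delta>' - d) * n)" by (simp add: distrib_left ac_simps)
      also have "\<dots> \<le> d * n + 1 * ((\<delta>' - d) * n)"
        using d by (intro add_left_mono mult_right_mono) auto
      also have "\<dots> = \<delta>' * n" by (simp add: algebra_simps)
      finally show ?case .
    qed
  qed
  finally have 2: "(\<lambda>n. real (T (?N n))) \<in> O(\<lambda>n. 2 powr (\<delta>' * real n))" .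
  have "(\<lambda>n. (real (2 ^ (2 * weight n)) + 2) ^ i) \<in> O(\<lambda>n. 2 powr (real i * (real (2 * weight n) + 1)))"
  proof (rule bigoI[where c = 1], rule always_eventually, rule allI)
    fix n
    have "2 \<le> (2::real) ^ (2 * weight n)" using power_increasing[of 1 "2 * weight n" "2::real"] by (simp add: weight_def)
    then have "(real (2 ^ (2 * weight n)) + 2) ^ i \<le> (2 ^ (2 * weight n + 1)) ^ i" by (intro power_mono) auto
    also have "\<dots> = 2 powr (real (2 * weight n + 1) * real i)"
      by (simp only: powr_realpow[OF zero_less_numeral] power_mult flip: of_nat_mult)
    finally show "norm ((real (2 ^ (2 * weight n)) + 2) ^ i) \<le> 1 * norm (2 powr (real i * (real (2 * weight n) + 1)))"
      by (simp add: mult.commute add.commute)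
  qed
  also have "(\<lambda>n. 2 powr (real i * (real (2 * weight n) + 1))) \<in> O(\<lambda>n. 2 powr (\<delta>' * real n))"
  proof (rule bigo_powr_mono)
    let ?g = "\<lambda>n. real n / log 2 (real n) + 3 * log 2 (real n) + 9"
    have "?g \<in> o(\<lambda>n. real n)" by real_asymp
    then have "\<forall>\<^sub>F n in sequentially. ?g n \<le> \<delta>' / (real i + 1) * real n"
      by (rule eventually_smallo_le) (use \<delta> in auto)
    then show "\<forall>\<^sub>F n in sequentially. real i * (real (2 * weight n) + 1) \<le> \<delta>' * real n"
      using eventually_ge_at_top[of 2]
    proof eventually_elim
      case (elim n)
      have "0 \<le> log 2 (real n)" using elim(2) by simp
      then have "real (2 * weight n) + 1 \<le> ?g n" using weight_real(2)[OF elim(2)] by linarith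
      then have "real i * (real (2 * weight n) + 1) \<le> (real i + 1) * (\<delta>' / (real i + 1) * real n)"
        using elim(1) by (intro mult_mono) auto
      then show ?case by simp
    qed
  qed
  finally have 1: "(\<lambda>n. (real (2 ^ (2 * weight n)) + 2) ^ i) \<in> O(\<lambda>n. 2 powr (\<delta>' * real n))" .
  have "(\<lambda>n. (real (?N n) + 2) ^ j) \<in> O(\<lambda>n. 2 powr (real j * log 2 (2 * real n + 2)))"
  proof (rule bigoI[where c = 1])
    have "\<forall>\<^sub>F n in sequentially. overhead K p n \<le> 1 * real n"
      by (rule eventually_smallo_le[OF overhead_smallo]) auto
    with N show "\<forall>\<^sub>F n in sequentially. norm ((real (?N n) + 2) ^ j) \<le> 1 * norm (2 powr (real j * log 2 (2 * real n + 2)))"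
    proof eventually_elim
      case (elim n)
      have "2 powr (real j * log 2 (2 * real n + 2)) = (2 powr log 2 (2 * real n + 2)) powr real j"
        by (simp only: powr_powr mult.commute)
      also have "\<dots> = (2 * real n + 2) ^ j" by (simp add: powr_realpow)
      finally show ?case using elim by (simp add: power_mono)
    qed
  qed
  also have "(\<lambda>n. 2 powr (real j * log 2 (2 * real n + 2))) \<in> O(\<lambda>n. 2 powr (\<delta>' * real n))"
  proof (rule bigo_powr_mono)
    have "(\<lambda>n. log 2 (2 * real n + 2)) \<in> o(\<lambda>n. real n)" by real_asymp
    then have "\<forall>\<^sub>F n in sequentially. log 2 (2 * real n + 2) \<le> \<delta>' / (real j + 1) * real n"
      by (rule eventually_smallo_le) (use \<delta> in auto)
    then show "\<forall>\<^sub>F n in sequentially. real j * log 2 (2 * real n + 2) \<le> \<delta>' * real n"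
    proof eventually_elim
      case (elim n)
      then have "real j * log 2 (2 * real n + 2) \<le> (real j + 1) * (\<delta>' / (real j + 1) * real n)"
        by (intro mult_mono) auto
      then show ?case by simp
    qed
  qed
  finally have 3: "(\<lambda>n. (real (?N n) + 2) ^ j) \<in> O(\<lambda>n. 2 powr (\<delta>' * real n))" .
  show ?thesis using sum_in_bigo(1)[OF sum_in_bigo(1)[OF 1 2] 3]
    by (simp only: of_nat_add of_nat_power of_nat_numeral)
qed

theorem theorem10:
  fixes b :: "nat \<Rightarrow> nat"
  assumes "SETH"
    and "\<And>n. 1 \<le> b n"
  shows "\<exists>f::nat \<Rightarrow> real. f \<in> o(\<lambda>n. real n) \<and>
    (\<forall>\<delta>::real. \<delta> < 1 \<longrightarrow> \<not> solvable_in_time (bnsl b f) (\<lambda>n. 2 powr (\<delta> * real n)))"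
proof (intro exI conjI allI impI notI)
  show "exponent \<in> o(\<lambda>n. real n)" by (rule exponent_smallo)
  fix \<delta> :: real assume "\<delta> < 1" and "solvable_in_time (bnsl b exponent) (\<lambda>n. 2 powr (\<delta> * real n))"
  then obtain c T where c: "solves_within c (bnsl b exponent) T" "(\<lambda>n. real (T n)) \<in> O(\<lambda>n. 2 powr (\<delta> * real n))"
    unfolding solvable_in_time_def by blast
  \<comment> \<open>The midpoint between \<open>max \<delta> 0\<close> and 1: it leaves room above
    \<delta>, is positive even if \<delta> is not, and stays below 1 for SETH.\<close>
  define \<delta>' where "\<delta>' = (1 + max \<delta> 0) / 2"
  have \<delta>': "\<delta> < \<delta>'" "0 < \<delta>'" "\<delta>' < 1" using \<open>\<delta> < 1\<close> by (auto simp: \<delta>'_def max_def)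
  obtain k where k: "\<not> solvable_in_time (k_cnf_sat k) (\<lambda>n. 2 powr (\<delta>' * real n))"
    using assms(1) \<delta>'(3) unfolding SETH_def by blast
  \<comment> \<open>\<open>Suc k\<close> in place of \<open>k\<close>, because the gadget needs a
    positive bound on the number of groups per checker.\<close>
  obtain p where p: "\<And>n. real (parent_sets_bound (Suc k) n + p) \<le> 2 powr exponent (num_nodes (Suc k) p n)"
    using exists_padding by metis
  from solves_k_cnf_sat[OF c(1) assms(2) _ _ p, of k] obtain c' i j where
    "solves_within c' (k_cnf_sat k) (\<lambda>n. (2 ^ (2 * weight n) + 2) ^ i + T (num_nodes (Suc k) p n) + (num_nodes (Suc k) p n + 2) ^ j)"
    by auto
  with reduction_time[OF c(2) \<delta>'(1,2)] have "solvable_in_time (k_cnf_sat k) (\<lambda>n. 2 powr (\<delta>' * real n))"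
    unfolding solvable_in_time_def by blast
  with k show False by blast
qed

end
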